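(* Let $F:(M^m,g)\to(B^n,g')$ be a Clairaut conformal submersion between Riemannian manifolds with $r=e^f$. If $m\neq 2$, then there exists a function $\phi$ on $M$, constant along the fibers of $F$, such that $F:(M,\phi^2 g)\to(B,g')$ is a harmonic Clairaut conformal submersion with $r=\phi e^f$.
   Context: All manifolds, maps and functions are smooth; $\dim M=m$, $\dim B=n$. For a submersion $F:(M,g)\to(B,g')$, the vertical distribution is $\ker F_\ast$ and the horizontal distribution is its $g$-orthogonal complement. $F$ is a conformal submersion with dilation $\lambda:M\to\mathbb{R}^+$ if $g'(F_\ast X,F_\ast Y)=\lambda^2 g(X,Y)$ for all horizontal $X,Y$. A conformal submersion $F$ is a Clairaut conformal submersion with function $r:M\to\mathbb{R}^+$ if for every geodesic $\alpha$ of the metric on $M$ the function $t\mapsto r(\alpha(t))\sin\omega(t)$ is constant, where $\omega(t)\in[0,\pi/2]$ is the angle between $\dot\alpha(t)$ and the horizontal space at $\alpha(t)$. Writing $r=e^f$ means that $f:M\to\mathbb{R}$ is the function $\log r$. A smooth map between Riemannian manifolds is harmonic if its tension field (the trace, with respect to the domain metric, of its second fundamental form $\nabla F_\ast$) vanishes identically.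
   Formalization: "Constant along the fibers of F" is proved as constant on each connected component of each fiber; constancy on whole disconnected fibers can fail (covering of a flat 3-torus by R^3 with a non-periodic conformal metric). For connected fibers the two agree. *)

theory Defs
  imports "HOL-Analysis.Analysis"
begin

section \<open>Smooth maps between Euclidean spaces\<close>

text \<open>For open S: all iterated directional derivatives of order at most n exist and are
  continuous.\<close>

primrec C_times_on :: "nat \<Rightarrow> 'a::real_normed_vector set \<Rightarrow> ('a \<Rightarrow> 'b::real_normed_vector) \<Rightarrow> bool"
where
  "C_times_on 0 S f \<longleftrightarrow> continuous_on S f"
| "C_times_on (Suc n) S f \<longleftrightarrow>
     (\<forall>x\<in>S. f differentiable (at x)) \<and>
     (\<forall>v. C_times_on n S (\<lambda>x. frechet_derivative f (at x) v))"

definition smooth_on :: "'a::real_normed_vector set \<Rightarrow> ('a \<Rightarrow> 'b::real_normed_vector) \<Rightarrow> bool"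
  where "smooth_on S f \<longleftrightarrow> (\<forall>n. C_times_on n S f)"

definition partial :: "'m \<Rightarrow> (real^'m::finite \<Rightarrow> real) \<Rightarrow> real^'m \<Rightarrow> real"
  where "partial i f x = frechet_derivative f (at x) (axis i 1)"


section \<open>Smooth manifolds\<close>

text \<open>The underlying space of a manifold is a whole type, its dimension is the cardinality of the
  index type, and its smooth structure is given by a (not necessarily maximal) atlas. A chart
  is a pair of a domain and a coordinate map; outside the domain the coordinate map is irrelevant.
  Manifolds are not assumed to be connected.\<close>

type_synonym ('a, 'm) chart = "'a set \<times> ('a \<Rightarrow> real^'m)"

definition param :: "('a, 'm::finite) chart \<Rightarrow> real^'m \<Rightarrow> 'a"
  where "param c = inv_into (fst c) (snd c)"

definition smooth_atlas ::
    "('a::{t2_space, second_countable_topology}, 'm::finite) chart set \<Rightarrow> bool"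
  where "smooth_atlas A \<longleftrightarrow>
    (\<Union>c\<in>A. fst c) = UNIV \<and>
    (\<forall>c\<in>A. open (fst c) \<and> open (snd c ` fst c) \<and>
       homeomorphism (fst c) (snd c ` fst c) (snd c) (param c)) \<and>
    (\<forall>c\<in>A. \<forall>d\<in>A. smooth_on (snd c ` (fst c \<inter> fst d)) (snd d \<circ> param c))"

definition smooth_map ::
    "('a::topological_space, 'm::finite) chart set \<Rightarrow> ('b::topological_space, 'n::finite) chart set
      \<Rightarrow> ('a \<Rightarrow> 'b) \<Rightarrow> bool"
  where "smooth_map A B F \<longleftrightarrow>
    continuous_on UNIV F \<and>
    (\<forall>c\<in>A. \<forall>d\<in>B. smooth_on (snd c ` (fst c \<inter> F -` fst d)) (snd d \<circ> F \<circ> param c))"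

definition smooth_function :: "('a, 'm::finite) chart set \<Rightarrow> ('a \<Rightarrow> real) \<Rightarrow> bool"
  where "smooth_function A h \<longleftrightarrow> (\<forall>c\<in>A. smooth_on (snd c ` fst c) (h \<circ> param c))"

text \<open>Tangent vectors at a point are given by their components with respect to a chart around it.
  In these components, the differential of a map at p is the derivative of its coordinate
  expression.\<close>

definition local_rep ::
    "('a, 'm::finite) chart \<Rightarrow> ('b, 'n::finite) chart \<Rightarrow> ('a \<Rightarrow> 'b) \<Rightarrow> real^'m \<Rightarrow> real^'n"
  where "local_rep c d F = snd d \<circ> F \<circ> param c"

definition differential ::
    "('a, 'm::finite) chart \<Rightarrow> ('b, 'n::finite) chart \<Rightarrow> ('a \<Rightarrow> 'b) \<Rightarrow> 'a \<Rightarrow> real^'m \<Rightarrow> real^'n"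
  where "differential c d F p = frechet_derivative (local_rep c d F) (at (snd c p))"


section \<open>Riemannian metrics\<close>

text \<open>A metric assigns to a chart c and a point p in its domain the Gram matrix at p of
  the coordinate frame of c. The last condition is the transformation law of a covariant
  2-tensor.\<close>

type_synonym ('a, 'm) metric = "('a, 'm) chart \<Rightarrow> 'a \<Rightarrow> real^'m^'m"

definition ip :: "real^'m^'m \<Rightarrow> real^'m::finite \<Rightarrow> real^'m \<Rightarrow> real"
  where "ip G u v = u \<bullet> (G *v v)"

definition riemannian_manifold ::
    "('a::{t2_space, second_countable_topology}, 'm::finite) chart set \<Rightarrow> ('a, 'm) metric \<Rightarrow> bool"
  where "riemannian_manifold A g \<longleftrightarrow>
    smooth_atlas A \<and>
    (\<forall>c\<in>A. smooth_on (snd c ` fst c) (g c \<circ> param c)) \<and>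
    (\<forall>c\<in>A. \<forall>p\<in>fst c. transpose (g c p) = g c p \<and> (\<forall>v. v \<noteq> 0 \<longrightarrow> ip (g c p) v v > 0)) \<and>
    (\<forall>c\<in>A. \<forall>d\<in>A. \<forall>p\<in>fst c \<inter> fst d. \<forall>u v.
       ip (g c p) u v = ip (g d p) (differential c d id p u) (differential c d id p v))"

definition conformal_change :: "('a \<Rightarrow> real) \<Rightarrow> ('a, 'm) metric \<Rightarrow> ('a, 'm::finite) metric"
  where "conformal_change \<phi> g = (\<lambda>c p. (\<phi> p)\<^sup>2 *\<^sub>R g c p)"

text \<open>Christoffel symbol of the Levi-Civita connection, with upper index k.\<close>

definition christoffel ::
    "('a, 'm) metric \<Rightarrow> ('a, 'm::finite) chart \<Rightarrow> 'a \<Rightarrow> 'm \<Rightarrow> 'm \<Rightarrow> 'm \<Rightarrow> real"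
  where "christoffel g c p k i j =
    (\<Sum>l\<in>UNIV. matrix_inv (g c p) $ k $ l *
       (partial i (\<lambda>x. g c (param c x) $ j $ l) (snd c p)
      + partial j (\<lambda>x. g c (param c x) $ i $ l) (snd c p)
      - partial l (\<lambda>x. g c (param c x) $ i $ j) (snd c p))) / 2"


section \<open>Geodesics\<close>

definition velocity :: "('a, 'm::finite) chart \<Rightarrow> (real \<Rightarrow> 'a) \<Rightarrow> real \<Rightarrow> real^'m"
  where "velocity c \<alpha> t = vector_derivative (snd c \<circ> \<alpha>) (at t)"

text \<open>Twice differentiable solutions of the geodesic equation; these are automatically smooth.
  Regular geodesics exclude the constant ones, whose angle with a subspace is undefined.\<close>

definition geodesic_on ::
    "('a::topological_space, 'm::finite) chart set \<Rightarrow> ('a, 'm) metric \<Rightarrow> real set \<Rightarrow> (real \<Rightarrow> 'a) \<Rightarrow> bool"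
  where "geodesic_on A g I \<alpha> \<longleftrightarrow>
    open I \<and> is_interval I \<and> continuous_on I \<alpha> \<and>
    (\<forall>c\<in>A. \<forall>t\<in>I. \<alpha> t \<in> fst c \<longrightarrow>
       (snd c \<circ> \<alpha>) differentiable (at t) \<and>
       (velocity c \<alpha> has_vector_derivative
         (\<chi> k. - (\<Sum>i\<in>UNIV. \<Sum>j\<in>UNIV.
            christoffel g c (\<alpha> t) k i j * velocity c \<alpha> t $ i * velocity c \<alpha> t $ j))) (at t))"

definition regular_geodesic_on ::
    "('a::topological_space, 'm::finite) chart set \<Rightarrow> ('a, 'm) metric \<Rightarrow> real set \<Rightarrow> (real \<Rightarrow> 'a) \<Rightarrow> bool"
  where "regular_geodesic_on A g I \<alpha> \<longleftrightarrow>
    geodesic_on A g I \<alpha> \<and> (\<forall>c\<in>A. \<forall>t\<in>I. \<alpha> t \<in> fst c \<longrightarrow> velocity c \<alpha> t \<noteq> 0)"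


section \<open>Conformal and Clairaut conformal submersions\<close>

definition vertical ::
    "('a, 'm::finite) chart \<Rightarrow> ('b, 'n::finite) chart \<Rightarrow> ('a \<Rightarrow> 'b) \<Rightarrow> 'a \<Rightarrow> (real^'m) set"
  where "vertical c d F p = {v. differential c d F p v = 0}"

definition horizontal ::
    "('a, 'm) metric \<Rightarrow> ('a, 'm::finite) chart \<Rightarrow> ('b, 'n::finite) chart \<Rightarrow> ('a \<Rightarrow> 'b) \<Rightarrow> 'a
      \<Rightarrow> (real^'m) set"
  where "horizontal g c d F p = {u. \<forall>v\<in>vertical c d F p. ip (g c p) u v = 0}"

definition submersion ::
    "('a::topological_space, 'm::finite) chart set \<Rightarrow> ('b::topological_space, 'n::finite) chart set
      \<Rightarrow> ('a \<Rightarrow> 'b) \<Rightarrow> bool"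
  where "submersion A B F \<longleftrightarrow>
    smooth_map A B F \<and>
    (\<forall>c\<in>A. \<forall>d\<in>B. \<forall>p\<in>fst c \<inter> F -` fst d. surj (differential c d F p))"

definition conformal_submersion_with ::
    "('a::topological_space, 'm::finite) chart set \<Rightarrow> ('a, 'm) metric
      \<Rightarrow> ('b::topological_space, 'n::finite) chart set \<Rightarrow> ('b, 'n) metric
      \<Rightarrow> ('a \<Rightarrow> 'b) \<Rightarrow> ('a \<Rightarrow> real) \<Rightarrow> bool"
  where "conformal_submersion_with A g B g' F dil \<longleftrightarrow>
    submersion A B F \<and> smooth_function A dil \<and> (\<forall>p. dil p > 0) \<and>
    (\<forall>c\<in>A. \<forall>d\<in>B. \<forall>p\<in>fst c \<inter> F -` fst d.
       \<forall>X\<in>horizontal g c d F p. \<forall>Y\<in>horizontal g c d F p.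
         ip (g' d (F p)) (differential c d F p X) (differential c d F p Y)
           = (dil p)\<^sup>2 * ip (g c p) X Y)"

text \<open>The angle in [0, pi/2] between a nonzero vector and a subspace is the angle between the vector
  and its orthogonal projection to the subspace, and pi/2 if that projection is zero. Here
  lengths and orthogonality refer to the inner product with Gram matrix G.\<close>

definition orth_proj :: "real^'m^'m \<Rightarrow> (real^'m::finite) set \<Rightarrow> real^'m \<Rightarrow> real^'m"
  where "orth_proj G H v = (THE h. h \<in> H \<and> (\<forall>u\<in>H. ip G (v - h) u = 0))"

definition angle_with :: "real^'m^'m \<Rightarrow> (real^'m::finite) set \<Rightarrow> real^'m \<Rightarrow> real"
  where "angle_with G H v =
    arccos (sqrt (ip G (orth_proj G H v) (orth_proj G H v)) / sqrt (ip G v v))"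

definition clairaut_conformal_submersion ::
    "('a::{t2_space, second_countable_topology}, 'm::finite) chart set \<Rightarrow> ('a, 'm) metric
      \<Rightarrow> ('b::{t2_space, second_countable_topology}, 'n::finite) chart set \<Rightarrow> ('b, 'n) metric
      \<Rightarrow> ('a \<Rightarrow> 'b) \<Rightarrow> ('a \<Rightarrow> real) \<Rightarrow> bool"
  where "clairaut_conformal_submersion A g B g' F r \<longleftrightarrow>
    riemannian_manifold A g \<and> riemannian_manifold B g' \<and>
    (\<exists>dil. conformal_submersion_with A g B g' F dil) \<and>
    smooth_function A r \<and> (\<forall>p. r p > 0) \<and>
    (\<forall>I \<alpha>. regular_geodesic_on A g I \<alpha> \<longrightarrow>
       (\<exists>C. \<forall>t\<in>I. \<forall>c\<in>A. \<forall>d\<in>B. \<alpha> t \<in> fst c \<and> F (\<alpha> t) \<in> fst d \<longrightarrow>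
          r (\<alpha> t) *
            sin (angle_with (g c (\<alpha> t)) (horizontal g c d F (\<alpha> t)) (velocity c \<alpha> t)) = C))"

text \<open>The vertical distribution only sees the connected components of the fibers, so constancy
  along the fibers means constancy on each of these components. If all fibers are connected, this
  says that h takes the same value at any two points with the same image.\<close>

definition constant_along_fibers ::
    "('a::topological_space \<Rightarrow> 'b) \<Rightarrow> ('a \<Rightarrow> real) \<Rightarrow> bool"
  where "constant_along_fibers F h \<longleftrightarrow>
    (\<forall>b. \<forall>S. S \<in> components (F -` {b}) \<longrightarrow> h constant_on S)"


section \<open>Harmonic maps\<close>

text \<open>Component k of the second fundamental form on the coordinate fields i and j,
  i.e. of the pullback covariant derivative of F_*(e_j) along e_i minus F_* of the covariant
  derivative of e_j along e_i.\<close>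

definition second_fundamental_form ::
    "('a, 'm) metric \<Rightarrow> ('b, 'n) metric \<Rightarrow> ('a \<Rightarrow> 'b) \<Rightarrow> ('a, 'm::finite) chart \<Rightarrow> ('b, 'n::finite) chart
      \<Rightarrow> 'a \<Rightarrow> 'n \<Rightarrow> 'm \<Rightarrow> 'm \<Rightarrow> real"
  where "second_fundamental_form g g' F c d p k i j =
    partial i (partial j (\<lambda>x. local_rep c d F x $ k)) (snd c p)
    + (\<Sum>a\<in>UNIV. \<Sum>b\<in>UNIV. christoffel g' d (F p) k a b *
         partial i (\<lambda>x. local_rep c d F x $ a) (snd c p) *
         partial j (\<lambda>x. local_rep c d F x $ b) (snd c p))
    - (\<Sum>l\<in>UNIV. christoffel g c p l i j * partial l (\<lambda>x. local_rep c d F x $ k) (snd c p))"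

definition tension_field ::
    "('a, 'm) metric \<Rightarrow> ('b, 'n) metric \<Rightarrow> ('a \<Rightarrow> 'b) \<Rightarrow> ('a, 'm::finite) chart \<Rightarrow> ('b, 'n::finite) chart
      \<Rightarrow> 'a \<Rightarrow> real^'n"
  where "tension_field g g' F c d p =
    (\<chi> k. \<Sum>i\<in>UNIV. \<Sum>j\<in>UNIV.
       matrix_inv (g c p) $ i $ j * second_fundamental_form g g' F c d p k i j)"

definition harmonic_map ::
    "('a::topological_space, 'm::finite) chart set \<Rightarrow> ('a, 'm) metric
      \<Rightarrow> ('b::topological_space, 'n::finite) chart set \<Rightarrow> ('b, 'n) metric \<Rightarrow> ('a \<Rightarrow> 'b) \<Rightarrow> bool"
  where "harmonic_map A g B g' F \<longleftrightarrow>
    smooth_map A B F \<and>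
    (\<forall>c\<in>A. \<forall>d\<in>B. \<forall>p\<in>fst c \<inter> F -` fst d. tension_field g g' F c d p = 0)"

end

theory Submission
  imports Defs
begin

text \<open>Let h be the pullback of g' by F and let \<lambda> be the dilation. The tensor w = g - h/\<lambda>^2 measures the
  squared length of the vertical part of a vector, so the Clairaut relation says that the quadratic form
  S = r^2 w is constant along the velocity of every geodesic. Since a geodesic starts in every direction,
  this holds if and only if S is a Killing tensor, i.e. the cubic form (\<nabla>_v S)(v,v) vanishes. Evaluating the polarized
  cubic form on a vertical vector V and a horizontal vector X gives that r and \<lambda> have no vertical
  derivative and that the fibers are umbilic: the second fundamental form b of F satisfies
  b(V,V) = g(V,V) F_*(grad log r). On horizontal vectors b is determined by \<lambda>, and the trace of b is
  F_*(grad ((2 - n) log \<lambda> + (m - n) log r)). Passing from g to \<phi>^2 g multiplies S by \<phi>^4, which preserves the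
  Killing property if \<phi> has no vertical derivative, and replaces \<lambda> and r by \<lambda>/\<phi> and \<phi> r. The tension field
  vanishes for the choice log \<phi> = ((n - 2) log \<lambda> - (m - n) log r) / (m - 2).\<close>

text \<open>The geodesics of g and of \<phi>^2 g are different curves, so the Clairaut relation
  cannot be carried over curve by curve. The Killing equation is a condition at one point, linear in
  the Christoffel symbols, and that is where the conformal change is carried out. Extending vectors
  at a point to horizontal or vertical fields is avoided. The forms w and h are semidefinite, so
  each is minimal at a vector of its kernel, and its derivative on the kernel vanishes; this
  supplies the vanishing terms in the polarized cubic form. Deducing the Killing equation needs a
  geodesic with every prescribed nonzero initial velocity, and \<open>geodesic_on\<close> asks for
  the equation in every chart. Hence the Picard iteration on phase space and the transformation law
  of the Christoffel symbols. The Clairaut definition asks for one constant valid in all charts at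
  once. For the new metric the independence of the angle from the charts must be known before the
  relation itself, and it is inherited from the old metric because angles are conformally
  invariant.\<close>

section \<open>Calculus of finitely often differentiable functions\<close>

lemma C_times_on_cong:
  assumes "open S" "\<And>x. x \<in> S \<Longrightarrow> f x = g x" "C_times_on n S f"
  shows "C_times_on n S g"
  using assms(2,3)
proof (induction n arbitrary: f g)
  case 0
  then show ?case by (simp cong: continuous_on_cong)
next
  case (Suc n)
  have D: "frechet_derivative f (at x) = frechet_derivative g (at x)" if "x \<in> S" for x
    using frechet_derivative_transform_within_open[of f x S g] Suc.prems \<open>open S\<close> that by auto
  have "g differentiable (at x)" if "x \<in> S" for x
    using Suc.prems that \<open>open S\<close>
    by (metis C_times_on.simps(2) differentiable_def has_derivative_transform_within_open)
  moreover have "C_times_on n S (\<lambda>x. frechet_derivative g (at x) v)" for v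
    using Suc.IH[of "\<lambda>x. frechet_derivative f (at x) v" "\<lambda>x. frechet_derivative g (at x) v"]
      Suc.prems D by simp
  ultimately show ?case by simp
qed

text \<open>\<open>C_times_on\<close> speaks of \<open>frechet_derivative\<close>; on an open set
  any explicit formula for the derivative may replace it, and the closure lemmas below work with
  such formulas.\<close>

lemma C_times_on_SucI:
  assumes "open S" "\<And>x. x \<in> S \<Longrightarrow> (f has_derivative f' x) (at x)"
    and "\<And>v. C_times_on n S (\<lambda>x. f' x v)"
  shows "C_times_on (Suc n) S f"
proof -
  have D: "f' x = frechet_derivative f (at x)" if "x \<in> S" for x
    using assms(2)[OF that] by (rule frechet_derivative_at)
  have "C_times_on n S (\<lambda>x. frechet_derivative f (at x) v)" for v
    by (rule C_times_on_cong[OF \<open>open S\<close> _ assms(3)[of v]]) (simp add: D)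
  then show ?thesis
    using assms(2) by (auto simp: differentiable_def)
qed

lemma C_times_on_SucD: "C_times_on (Suc n) S f \<Longrightarrow> C_times_on n S f"
proof (induction n arbitrary: f)
  case 0
  then show ?case
    by (auto intro!: differentiable_imp_continuous_on differentiable_at_imp_differentiable_on)
next
  case (Suc n)
  then show ?case by (metis C_times_on.simps(2))
qed

lemma C_times_on_imp_differentiable: "C_times_on (Suc n) S f \<Longrightarrow> x \<in> S \<Longrightarrow> f differentiable (at x)"
  by simp

lemma C_times_on_subset: "C_times_on n S f \<Longrightarrow> T \<subseteq> S \<Longrightarrow> C_times_on n T f"
  by (induction n arbitrary: f) (auto intro: continuous_on_subset)

lemma C_times_on_const [simp]: "C_times_on n S (\<lambda>x. c)"
  by (induction n arbitrary: c) auto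

lemma C_times_on_linear:
  assumes "bounded_linear f"
  shows "C_times_on n S f"
proof (cases n)
  case 0
  then show ?thesis using assms by (simp add: linear_continuous_on)
next
  case (Suc k)
  have D: "(f has_derivative f) (at x)" for x
    using assms by (rule bounded_linear_imp_has_derivative)
  then have "frechet_derivative f (at x) = f" for x
    by (metis frechet_derivative_at)
  with D Suc show ?thesis by (auto simp: differentiable_def)
qed

lemma C_times_on_add:
  assumes "open S" "C_times_on n S f" "C_times_on n S g"
  shows "C_times_on n S (\<lambda>x. f x + g x)"
  using assms(2,3)
proof (induction n arbitrary: f g)
  case 0
  then show ?case by (auto intro: continuous_on_add)
next
  case (Suc n)
  show ?case
  proof (rule C_times_on_SucI[OF \<open>open S\<close>])
    fix x assume "x \<in> S"
    with Suc.prems show "((\<lambda>x. f x + g x) has_derivative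
        (\<lambda>v. frechet_derivative f (at x) v + frechet_derivative g (at x) v)) (at x)"
      by (auto simp: frechet_derivative_works intro: has_derivative_add)
  qed (use Suc in auto)
qed

lemma C_times_on_bilinear:
  assumes "bounded_bilinear bil" "open S" "C_times_on n S f" "C_times_on n S g"
  shows "C_times_on n S (\<lambda>x. bil (f x) (g x))"
  using assms(3,4)
proof (induction n arbitrary: f g)
  case 0
  then show ?case
    using bounded_bilinear.continuous_on[OF assms(1)] by auto
next
  case (Suc n)
  show ?case
  proof (rule C_times_on_SucI[OF \<open>open S\<close>])
    fix x assume "x \<in> S"
    with Suc.prems have "(f has_derivative frechet_derivative f (at x)) (at x)"
      "(g has_derivative frechet_derivative g (at x)) (at x)"
      by (auto simp: frechet_derivative_works)
    then show "((\<lambda>x. bil (f x) (g x)) has_derivative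
        (\<lambda>v. bil (f x) (frechet_derivative g (at x) v) + bil (frechet_derivative f (at x) v) (g x))) (at x)"
      by (rule bounded_bilinear.FDERIV[OF assms(1)])
  next
    fix v
    have "C_times_on n S f" "C_times_on n S g"
      using Suc.prems by (auto intro: C_times_on_SucD simp del: C_times_on.simps)
    moreover have "C_times_on n S (\<lambda>x. frechet_derivative f (at x) v)"
      "C_times_on n S (\<lambda>x. frechet_derivative g (at x) v)"
      using Suc.prems by auto
    ultimately show "C_times_on n S
        (\<lambda>x. bil (f x) (frechet_derivative g (at x) v) + bil (frechet_derivative f (at x) v) (g x))"
      by (intro C_times_on_add[OF \<open>open S\<close>] Suc.IH)
  qed
qed

lemmas C_times_on_mult =
  C_times_on_bilinear[OF bounded_bilinear_mult[where 'a=real]]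

lemma C_times_on_bounded_linear:
  assumes "bounded_linear L" "open S" "C_times_on n S f"
  shows "C_times_on n S (\<lambda>x. L (f x))"
  using assms(3)
proof (induction n arbitrary: f)
  case 0
  then show ?case
    by (simp add: bounded_linear.continuous_on[OF assms(1)])
next
  case (Suc n)
  show ?case
  proof (rule C_times_on_SucI[OF \<open>open S\<close>])
    fix x assume "x \<in> S"
    with Suc.prems show "((\<lambda>x. L (f x)) has_derivative (\<lambda>v. L (frechet_derivative f (at x) v))) (at x)"
      by (intro bounded_linear.has_derivative[OF assms(1)]) (simp add: frechet_derivative_works)
  qed (use Suc in auto)
qed

lemma C_times_on_sum:
  assumes "open S" "\<And>i. i \<in> I \<Longrightarrow> C_times_on n S (f i)"
  shows "C_times_on n S (\<lambda>x. \<Sum>i\<in>I. f i x)"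
  using assms(2) by (induction I rule: infinite_finite_induct) (auto intro!: C_times_on_add[OF \<open>open S\<close>])

lemma C_times_on_prod:
  fixes f :: "'i \<Rightarrow> 'a::real_normed_vector \<Rightarrow> real"
  assumes "open S" "\<And>i. i \<in> I \<Longrightarrow> C_times_on n S (f i)"
  shows "C_times_on n S (\<lambda>x. \<Prod>i\<in>I. f i x)"
  using assms(2) by (induction I rule: infinite_finite_induct) (auto intro!: C_times_on_mult[OF \<open>open S\<close>])

lemma bounded_linear_axis: "bounded_linear (axis i :: 'b::real_normed_vector \<Rightarrow> 'b^'i::finite)"
proof (rule bounded_linear_intro[where K=1])
  show "norm (axis i x :: 'b^'i) \<le> norm x * 1" for x :: 'b
  proof -
    have "norm (axis i x :: 'b^'i) \<le> (\<Sum>j\<in>UNIV. norm ((axis i x :: 'b^'i) $ j))"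
      unfolding norm_vec_def by (rule L2_set_le_sum) auto
    also have "\<dots> = norm x"
      by (simp add: axis_def if_distrib cong: if_cong)
    finally show ?thesis by simp
  qed
qed (auto simp: axis_def vec_eq_iff)

lemma vec_lambda_axis:
  fixes f :: "'i::finite \<Rightarrow> 'b::comm_monoid_add"
  shows "(\<chi> i. f i) = (\<Sum>i\<in>UNIV. axis i (f i))"
  by (auto simp: vec_eq_iff axis_def if_distrib cong: if_cong)

lemma C_times_on_vec_lambda:
  fixes f :: "'i::finite \<Rightarrow> 'a::real_normed_vector \<Rightarrow> 'b::real_normed_vector"
  assumes "open S" "\<And>i. C_times_on n S (f i)"
  shows "C_times_on n S (\<lambda>x. \<chi> i. f i x)"
  unfolding vec_lambda_axis using assms
  by (intro C_times_on_sum C_times_on_bounded_linear[OF bounded_linear_axis]) auto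

lemma C_times_on_nth:
  fixes f :: "'a::real_normed_vector \<Rightarrow> 'b::real_normed_vector^'i"
  shows "open S \<Longrightarrow> C_times_on n S f \<Longrightarrow> C_times_on n S (\<lambda>x. f x $ i)"
  using C_times_on_bounded_linear[OF bounded_linear_vec_nth] by blast

text \<open>The derivative involves the exponent a - 1, so the induction keeps the exponent
  arbitrary. Real exponents serve twice later: for the reciprocal of a determinant and for the
  powers that make up \<phi>.\<close>

lemma C_times_on_powr:
  fixes f :: "'a::real_normed_vector \<Rightarrow> real"
  assumes "open S" "\<And>x. x \<in> S \<Longrightarrow> f x > 0" "C_times_on n S f"
  shows "C_times_on n S (\<lambda>x. f x powr a)"
  using assms(3)
proof (induction n arbitrary: a)
  case 0
  have "\<forall>x\<in>S. f x \<noteq> 0"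
    using assms(2) by fastforce
  with 0 show ?case
    by (auto intro!: continuous_on_powr)
next
  case (Suc n)
  show ?case
  proof (rule C_times_on_SucI[OF \<open>open S\<close>])
    fix x assume "x \<in> S"
    with Suc.prems have "(f has_derivative frechet_derivative f (at x)) (at x)" "f x > 0"
      using assms(2) by (auto simp: frechet_derivative_works)
    then show "((\<lambda>x. f x powr a) has_derivative (\<lambda>v. a * f x powr (a - 1) * frechet_derivative f (at x) v)) (at x)"
      by (auto intro!: derivative_eq_intros simp: fun_eq_iff powr_diff)
  next
    fix v
    have "C_times_on n S f"
      using Suc.prems by (rule C_times_on_SucD)
    with Suc show "C_times_on n S (\<lambda>x. a * f x powr (a - 1) * frechet_derivative f (at x) v)"
      using \<open>open S\<close> by (intro C_times_on_mult) auto
  qed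
qed

text \<open>The inner derivative is the constant L, so the induction meets no products of
  derivatives. The application is the projection from phase space to positions.\<close>

lemma C_times_on_compose_linear:
  assumes "bounded_linear L" "open S" "C_times_on n S f"
  shows "C_times_on n (L -` S) (\<lambda>x. f (L x))"
  using assms(3)
proof (induction n arbitrary: f)
  case 0
  have "continuous_on (L -` S) L"
    using assms(1) by (rule linear_continuous_on)
  with 0 show ?case
    by (auto intro: continuous_on_compose2)
next
  case (Suc n)
  have "open (L -` S)"
    using assms(1,2) by (simp add: open_vimage linear_continuous_on)
  then show ?case
  proof (rule C_times_on_SucI)
    fix x assume "x \<in> L -` S"
    with Suc.prems have "(f has_derivative frechet_derivative f (at (L x))) (at (L x))"
      by (auto simp: frechet_derivative_works)
    from has_derivative_compose[OF bounded_linear_imp_has_derivative[OF assms(1)] this]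
    show "((\<lambda>x. f (L x)) has_derivative (\<lambda>v. frechet_derivative f (at (L x)) (L v))) (at x)" .
  qed (use Suc in auto)
qed

lemma C_times_on_det:
  fixes M :: "'a::real_normed_vector \<Rightarrow> real^'m::finite^'m"
  assumes "open S" "\<And>i j. C_times_on n S (\<lambda>x. M x $ i $ j)"
  shows "C_times_on n S (\<lambda>x. det (M x))"
  unfolding det_def
  by (intro C_times_on_sum C_times_on_mult C_times_on_prod assms C_times_on_const)

text \<open>Schwarz's theorem: the second difference over a small parallelogram is h^2 times either
  mixed derivative at some point nearby, and continuity forces the two values at x to agree.\<close>

lemma symmetric_second_derivative_real:
  fixes f :: "'a::real_normed_vector \<Rightarrow> real"
  assumes "open S" "x \<in> S" "C_times_on 2 S f"
  shows "frechet_derivative (\<lambda>y. frechet_derivative f (at y) b) (at x) a =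
    frechet_derivative (\<lambda>y. frechet_derivative f (at y) a) (at x) b"
proof -
  define D2 where "D2 u v y = frechet_derivative (\<lambda>y. frechet_derivative f (at y) u) (at y) v" for u v y
  have D1: "(f has_derivative frechet_derivative f (at y)) (at y)" if "y \<in> S" for y
    using assms(3) that by (auto simp: numeral_2_eq_2 frechet_derivative_works)
  have D2: "((\<lambda>y. frechet_derivative f (at y) u) has_derivative (\<lambda>v. D2 u v y)) (at y)"
    if "y \<in> S" for u y
    using assms(3) that unfolding D2_def by (auto simp: numeral_2_eq_2 frechet_derivative_works)
  have cont: "continuous_on S (D2 u v)" for u v
    using assms(3) unfolding D2_def by (auto simp: numeral_2_eq_2)
  (* two applications of the mean value theorem to the second difference *)
  have diff: "\<exists>\<xi>\<in>{0..h}. \<exists>\<eta>\<in>{0..h}. f (x + h *\<^sub>R u + h *\<^sub>R v) - f (x + h *\<^sub>R u) - f (x + h *\<^sub>R v) + f x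
      = D2 u v (x + \<xi> *\<^sub>R u + \<eta> *\<^sub>R v) * h * h"
    if h: "h > 0" and in_S: "\<And>s t. s \<in> {0..h} \<Longrightarrow> t \<in> {0..h} \<Longrightarrow> x + s *\<^sub>R u + t *\<^sub>R v \<in> S" for h u v
  proof -
    have "\<exists>\<xi>\<in>{0..h}. (f (x + h *\<^sub>R u + h *\<^sub>R v) - f (x + h *\<^sub>R u)) - (f (x + 0 *\<^sub>R u + h *\<^sub>R v) - f (x + 0 *\<^sub>R u)) =
       (\<lambda>k. k * (frechet_derivative f (at (x + \<xi> *\<^sub>R u + h *\<^sub>R v)) u - frechet_derivative f (at (x + \<xi> *\<^sub>R u)) u)) (h - 0)"
    proof (rule mvt_very_simple)
      fix s assume s: "0 \<le> s" "s \<le> h"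
      have "x + s *\<^sub>R u + h *\<^sub>R v \<in> S" "x + s *\<^sub>R u \<in> S"
        using in_S[of s h] in_S[of s 0] s h by auto
      note D = this[THEN D1]
      have lin: "frechet_derivative f (at y) (k *\<^sub>R u) = k * frechet_derivative f (at y) u" if "y \<in> S" for y k
        using linear_scale[OF has_derivative_linear[OF D1[OF that]], of k u] by simp
      have "((\<lambda>s. f (x + s *\<^sub>R u + h *\<^sub>R v) - f (x + s *\<^sub>R u)) has_derivative
        (\<lambda>k. frechet_derivative f (at (x + s *\<^sub>R u + h *\<^sub>R v)) (k *\<^sub>R u) - frechet_derivative f (at (x + s *\<^sub>R u)) (k *\<^sub>R u)))
        (at s within {0..h})"
        by (rule has_derivative_diff;
            rule has_derivative_compose[where f = "\<lambda>s. x + s *\<^sub>R u + h *\<^sub>R v" and g = f, OF _ D(1)]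
              has_derivative_compose[where f = "\<lambda>s. x + s *\<^sub>R u" and g = f, OF _ D(2)];
            auto intro!: derivative_eq_intros)
      then show "((\<lambda>s. f (x + s *\<^sub>R u + h *\<^sub>R v) - f (x + s *\<^sub>R u)) has_derivative
        (\<lambda>k. k * (frechet_derivative f (at (x + s *\<^sub>R u + h *\<^sub>R v)) u - frechet_derivative f (at (x + s *\<^sub>R u)) u)))
        (at s within {0..h})"
        using lin \<open>x + s *\<^sub>R u + h *\<^sub>R v \<in> S\<close> \<open>x + s *\<^sub>R u \<in> S\<close> by (simp add: algebra_simps)
    qed (use h in auto)
    then obtain \<xi> where \<xi>: "\<xi> \<in> {0..h}" and 1: "(f (x + h *\<^sub>R u + h *\<^sub>R v) - f (x + h *\<^sub>R u)) - (f (x + h *\<^sub>R v) - f x)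
      = h * (frechet_derivative f (at (x + \<xi> *\<^sub>R u + h *\<^sub>R v)) u - frechet_derivative f (at (x + \<xi> *\<^sub>R u)) u)"
      by auto
    have "\<exists>\<eta>\<in>{0..h}. frechet_derivative f (at (x + \<xi> *\<^sub>R u + h *\<^sub>R v)) u - frechet_derivative f (at (x + \<xi> *\<^sub>R u + 0 *\<^sub>R v)) u
       = (\<lambda>k. k * D2 u v (x + \<xi> *\<^sub>R u + \<eta> *\<^sub>R v)) (h - 0)"
    proof (rule mvt_very_simple)
      fix t assume t: "0 \<le> t" "t \<le> h"
      have y: "x + \<xi> *\<^sub>R u + t *\<^sub>R v \<in> S"
        using in_S \<xi> t by auto
      have lin: "D2 u (k *\<^sub>R v) y = k * D2 u v y" if "y \<in> S" for y k
        using linear_scale[OF has_derivative_linear[OF D2[OF that, of u]], of k v] by simp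
      have "((\<lambda>t. frechet_derivative f (at (x + \<xi> *\<^sub>R u + t *\<^sub>R v)) u) has_derivative
        (\<lambda>k. D2 u (k *\<^sub>R v) (x + \<xi> *\<^sub>R u + t *\<^sub>R v))) (at t within {0..h})"
        by (rule has_derivative_compose[where f = "\<lambda>t. x + \<xi> *\<^sub>R u + t *\<^sub>R v" and g = "\<lambda>y. frechet_derivative f (at y) u", OF _ D2[OF y]]) (auto intro!: derivative_eq_intros)
      then show "((\<lambda>t. frechet_derivative f (at (x + \<xi> *\<^sub>R u + t *\<^sub>R v)) u) has_derivative
        (\<lambda>k. k * D2 u v (x + \<xi> *\<^sub>R u + t *\<^sub>R v))) (at t within {0..h})"
        by (simp add: lin[OF y])
    qed (use h in auto)
    then obtain \<eta> where \<eta>: "\<eta> \<in> {0..h}"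
      and 2: "frechet_derivative f (at (x + \<xi> *\<^sub>R u + h *\<^sub>R v)) u - frechet_derivative f (at (x + \<xi> *\<^sub>R u)) u
       = h * D2 u v (x + \<xi> *\<^sub>R u + \<eta> *\<^sub>R v)"
      by auto
    from 1 2 show ?thesis
      by (intro bexI[OF _ \<xi>] bexI[OF _ \<eta>]) (simp add: algebra_simps)
  qed
  have "dist (D2 b a x) (D2 a b x) \<le> e" if "e > 0" for e
  proof -
    have "\<forall>\<^sub>F y in nhds x. dist (D2 u v y) (D2 u v x) < e / 2" for u v
    proof (rule tendstoD)
      have "isCont (D2 u v) x"
        using cont[of u v] assms(1,2) continuous_on_eq_continuous_at by blast
      then show "(D2 u v \<longlongrightarrow> D2 u v x) (nhds x)"
        by (simp add: isCont_def tendsto_at_iff_tendsto_nhds)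
    qed (use that in simp)
    then have "\<forall>\<^sub>F y in nhds x. y \<in> S \<and> dist (D2 b a y) (D2 b a x) < e / 2 \<and> dist (D2 a b y) (D2 a b x) < e / 2"
      using assms(1,2) by (intro eventually_conj eventually_nhds_in_open)
    then obtain d where "d > 0" and d: "\<And>y. dist y x < d \<Longrightarrow> y \<in> S \<and> dist (D2 b a y) (D2 b a x) < e / 2 \<and> dist (D2 a b y) (D2 a b x) < e / 2"
      by (auto simp: eventually_nhds_metric)
    \<comment> \<open>The parallelogram with sides h a and h b then stays within distance d / 2 of
      x; the summand 1 covers a = b = 0.\<close>
    define h where "h = d / 2 / (norm a + norm b + 1)"
    have n1: "norm a + norm b + 1 > 0"
      by (meson add_nonneg_pos add_nonneg_nonneg norm_ge_zero zero_less_one)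
    have "h > 0"
      unfolding h_def using \<open>d > 0\<close> n1 by auto
    have near: "dist (x + s *\<^sub>R a + t *\<^sub>R b) x < d" if "s \<in> {0..h}" "t \<in> {0..h}" for s t
    proof -
      have "dist (x + s *\<^sub>R a + t *\<^sub>R b) x = norm (s *\<^sub>R a + t *\<^sub>R b)"
        by (simp add: dist_norm algebra_simps)
      also have "\<dots> \<le> s * norm a + t * norm b"
        using that by (metis abs_of_nonneg atLeastAtMost_iff norm_scaleR norm_triangle_ineq)
      also have "\<dots> \<le> h * norm a + h * norm b"
        using that by (intro add_mono mult_right_mono) auto
      also have "\<dots> \<le> h * (norm a + norm b + 1)"
        using \<open>h > 0\<close> by (simp add: algebra_simps)
      also have "\<dots> = d / 2"
        by (metis h_def n1 nonzero_eq_divide_eq order_less_irrefl)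
      finally show ?thesis using \<open>d > 0\<close> by simp
    qed
    have near': "dist (x + t *\<^sub>R b + s *\<^sub>R a) x < d" if "s \<in> {0..h}" "t \<in> {0..h}" for s t
      using near[OF that] by (simp add: algebra_simps)
    obtain s t where st: "s \<in> {0..h}" "t \<in> {0..h}"
      and e1: "f (x + h *\<^sub>R a + h *\<^sub>R b) - f (x + h *\<^sub>R a) - f (x + h *\<^sub>R b) + f x = D2 a b (x + s *\<^sub>R a + t *\<^sub>R b) * h * h"
      using diff[OF \<open>h > 0\<close>, of a b] near d by blast
    obtain s' t' where st': "s' \<in> {0..h}" "t' \<in> {0..h}"
      and e2: "f (x + h *\<^sub>R b + h *\<^sub>R a) - f (x + h *\<^sub>R b) - f (x + h *\<^sub>R a) + f x = D2 b a (x + s' *\<^sub>R b + t' *\<^sub>R a) * h * h"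
      using diff[OF \<open>h > 0\<close>, of b a] near' d by blast
    have "x + h *\<^sub>R b + h *\<^sub>R a = x + h *\<^sub>R a + h *\<^sub>R b"
      by simp
    note e2' = e2[unfolded this]
    from e1 e2' have "D2 a b (x + s *\<^sub>R a + t *\<^sub>R b) * h * h = D2 b a (x + s' *\<^sub>R b + t' *\<^sub>R a) * h * h"
      by linarith
    then have "D2 a b (x + s *\<^sub>R a + t *\<^sub>R b) = D2 b a (x + s' *\<^sub>R b + t' *\<^sub>R a)"
      using \<open>h > 0\<close> by simp
    with d[OF near[OF st]] d[OF near'[OF st'(2,1)]] show ?thesis
      by (smt (verit) dist_commute dist_triangle_half_l field_sum_of_halves dist_triangle2)
  qed
  then have "D2 b a x = D2 a b x"
    by (metis dist_le_zero_iff field_le_epsilon add.left_neutral)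
  then show ?thesis by (simp add: D2_def)
qed

section \<open>Local solutions of autonomous differential equations\<close>

lemma picard_lindeloef_global:
  fixes F :: "'a::banach \<Rightarrow> 'a"
  assumes lip: "L-lipschitz_on UNIV F" and bound: "\<And>x. norm (F x) \<le> B"
  obtains T x where "T > 0" "x 0 = x0"
    "\<And>t. t \<in> {-T<..<T} \<Longrightarrow> (x has_vector_derivative F (x t)) (at t)"
proof -
  have "L \<ge> 0"
    using lip by (rule lipschitz_on_nonneg)
  have "B \<ge> 0"
    using bound[of 0] norm_ge_zero order_trans by blast
  \<comment> \<open>Each integral runs over a length of at most 2 T and the operator
    \<open>P\<close> contains two of them, so its Lipschitz constant is at most 4 T L. This T makes
    it at most 1/2, also for L = 0.\<close>
  define T where "T = 1 / (8 * (L + 1))"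
  have "T > 0" "4 * T * L \<le> 1 / 2"
    using \<open>L \<ge> 0\<close> by (auto simp: T_def field_simps)
  define cl where "cl t = max (-T) (min T t)" for t
  have cl: "cl t \<in> {-T..T}" for t
    using \<open>T > 0\<close> by (auto simp: cl_def)
  define I where "I y u = integral {-T..u} (\<lambda>s. F (y s))" for y :: "real \<Rightarrow> 'a" and u
  \<comment> \<open>Clamping time to [-T, T] lets the Picard operator act on bounded continuous
    functions on the whole line, a complete metric space. The integral from 0 is written as a
    difference of integrals from -T, which also covers negative times.\<close>
  define P where "P y t = x0 + I y (cl t) - I y 0" for y t
  have contF: "continuous_on X (\<lambda>s. F (y s))" if "continuous_on UNIV y" for X :: "real set" and y
    by (rule continuous_on_compose2[OF lipschitz_on_continuous_on[OF lip] continuous_on_subset[OF that]]) auto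
  have intF: "(\<lambda>s. F (y s)) integrable_on {a..b}" if "continuous_on UNIV y" for a b :: real and y
    using that by (intro integrable_continuous_real contF)
  have Ibound: "norm (I y u) \<le> B * (2 * T)" if "continuous_on UNIV y" "u \<in> {-T..T}" for y u
  proof -
    have "norm (I y u) \<le> B * (u - (-T))"
      unfolding I_def using that bound \<open>T > 0\<close> by (intro integral_bound contF) auto
    also have "\<dots> \<le> B * (2 * T)"
      using that \<open>B \<ge> 0\<close> by (intro mult_left_mono) auto
    finally show ?thesis .
  qed
  have Icont: "continuous_on {-T..T} (I y)" if "continuous_on UNIV y" for y
    unfolding I_def by (rule indefinite_integral_continuous_1[OF intF[OF that]])
  have P: "P y \<in> bcontfun" if "continuous_on UNIV y" for y
  proof (rule bcontfun_normI)
    have "continuous_on UNIV (\<lambda>t. I y (cl t))"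
      using cl by (intro continuous_on_compose2[OF Icont[OF that]]) (auto simp: cl_def intro!: continuous_intros)
    then show "continuous_on UNIV (P y)"
      unfolding P_def by (intro continuous_intros)
    show "norm (P y t) \<le> norm x0 + B * (2 * T) + B * (2 * T)" for t
    proof -
      have "norm (P y t) \<le> norm (x0 + I y (cl t)) + norm (I y 0)"
        unfolding P_def by (rule norm_triangle_ineq4)
      also have "\<dots> \<le> norm x0 + norm (I y (cl t)) + norm (I y 0)"
        by (simp add: norm_triangle_ineq)
      finally show ?thesis
        using Ibound[OF that cl, of t] Ibound[OF that, of 0] \<open>T > 0\<close> by simp
    qed
  qed
  define Q where "Q y = Bcontfun (P (apply_bcontfun y))" for y :: "real \<Rightarrow>\<^sub>C 'a"
  have Q: "apply_bcontfun (Q y) = P (apply_bcontfun y)" for y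
    unfolding Q_def by (rule Bcontfun_inverse) (simp add: P)
  have Idist: "norm (I (apply_bcontfun y) u - I (apply_bcontfun z) u) \<le> L * dist y z * (2 * T)"
    if "u \<in> {-T..T}" for y z u
  proof -
    have "norm (F (y s) - F (z s)) \<le> L * dist y z" for s
      using lipschitz_onD[OF lip, of "y s" "z s"] dist_bounded[of y s z] \<open>L \<ge> 0\<close>
      by (smt (verit) UNIV_I dist_norm mult_left_mono)
    then have "norm (integral {-T..u} (\<lambda>s. F (y s) - F (z s))) \<le> L * dist y z * (u - (-T))"
      using that \<open>T > 0\<close> by (intro integral_bound continuous_intros contF) auto
    also have "\<dots> \<le> L * dist y z * (2 * T)"
      using that \<open>L \<ge> 0\<close> by (intro mult_left_mono) auto
    finally show ?thesis
      unfolding I_def by (simp add: integral_diff[symmetric] intF)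
  qed
  have "dist (Q y) (Q z) \<le> 1/2 * dist y z" for y z
  proof (rule dist_bound)
    fix t
    have "dist (Q y t) (Q z t) = norm ((I y (cl t) - I z (cl t)) - (I y 0 - I z 0))"
      by (simp add: Q P_def dist_norm algebra_simps)
    also have "\<dots> \<le> norm (I y (cl t) - I z (cl t)) + norm (I y 0 - I z 0)"
      by (rule norm_triangle_ineq4)
    also have "\<dots> \<le> L * dist y z * (2 * T) + L * dist y z * (2 * T)"
      using Idist[OF cl] Idist[of 0] \<open>T > 0\<close> by (intro add_mono) auto
    also have "\<dots> = 4 * T * L * dist y z"
      by simp
    also have "\<dots> \<le> 1/2 * dist y z"
      using \<open>4 * T * L \<le> 1 / 2\<close> by (rule mult_right_mono) simp
    finally show "dist (Q y t) (Q z t) \<le> 1/2 * dist y z" .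
  qed
  then obtain y where "Q y = y"
    using banach_fix_type[of "1/2" Q] by auto
  with Q have fixp: "P y = y"
    by metis
  show ?thesis
  proof
    show "T > 0" by fact
    have "P y 0 = x0"
      using \<open>T > 0\<close> by (simp add: P_def cl_def)
    then show "apply_bcontfun y 0 = x0"
      by (simp add: fixp)
    fix t assume t: "t \<in> {-T<..<T}"
    have "(I y has_vector_derivative F (y t)) (at t within {-T..T})"
      unfolding I_def using t by (intro integral_has_vector_derivative contF) auto
    then have "(I y has_vector_derivative F (y t)) (at t)"
      using t by (simp add: at_within_Icc_at)
    then have "((\<lambda>t. x0 + I y t - I y 0) has_vector_derivative F (y t)) (at t)"
      by (auto intro!: derivative_eq_intros)
    then have "(P y has_vector_derivative F (y t)) (at t)"
      by (rule has_vector_derivative_transform_within_open[where S = "{-T<..<T}"])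
        (use t in \<open>auto simp: P_def cl_def\<close>)
    then show "(apply_bcontfun y has_vector_derivative F (y t)) (at t)"
      by (simp add: fixp)
  qed
qed

text \<open>Class C^1 here means continuity of each directional derivative, so the operator norm on
  the compact set is bounded through the finitely many basis directions.\<close>

lemma C_times_on_imp_lipschitz:
  fixes F :: "'a::euclidean_space \<Rightarrow> 'b::real_normed_vector"
  assumes "compact K" "convex K" "K \<subseteq> S" "C_times_on 1 S F"
  obtains L where "L-lipschitz_on K F"
proof -
  have D: "(F has_derivative frechet_derivative F (at x)) (at x)" if "x \<in> K" for x
    using assms(3,4) that by (auto simp: frechet_derivative_works)
  have "\<exists>C. \<forall>x\<in>K. norm (frechet_derivative F (at x) b) \<le> C" for b
  proof -
    have "continuous_on K (\<lambda>x. frechet_derivative F (at x) b)"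
      using assms(3,4) by (auto intro: continuous_on_subset)
    then have "bounded ((\<lambda>x. frechet_derivative F (at x) b) ` K)"
      using assms(1) by (intro compact_imp_bounded compact_continuous_image)
    then show ?thesis
      by (auto simp: bounded_iff)
  qed
  then obtain C where C: "\<And>b x. x \<in> K \<Longrightarrow> norm (frechet_derivative F (at x) b) \<le> C b"
    by metis
  define L where "L = (\<Sum>b\<in>Basis. \<bar>C b\<bar>)"
  have "L \<ge> 0"
    by (simp add: L_def sum_nonneg)
  have "onorm (frechet_derivative F (at x)) \<le> L" if "x \<in> K" for x
  proof (rule onorm_bound[OF \<open>L \<ge> 0\<close>])
    fix v
    have "frechet_derivative F (at x) v = frechet_derivative F (at x) (\<Sum>b\<in>Basis. (v \<bullet> b) *\<^sub>R b)"
      by (simp add: euclidean_representation)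
    also have "\<dots> = (\<Sum>b\<in>Basis. (v \<bullet> b) *\<^sub>R frechet_derivative F (at x) b)"
      using has_derivative_linear[OF D[OF that]] by (simp add: linear_sum linear_scale)
    finally have "norm (frechet_derivative F (at x) v) = norm (\<Sum>b\<in>Basis. (v \<bullet> b) *\<^sub>R frechet_derivative F (at x) b)"
      by simp
    also have "\<dots> \<le> (\<Sum>b\<in>Basis. norm v * \<bar>C b\<bar>)"
      by (intro sum_norm_le) (auto intro!: mult_mono simp: Basis_le_norm intro: order_trans[OF C[OF that]])
    also have "\<dots> = L * norm v"
      by (simp add: L_def sum_distrib_left mult.commute)
    finally show "norm (frechet_derivative F (at x) v) \<le> L * norm v" .
  qed
  then have "L-lipschitz_on K F"
    using differentiable_bound[OF assms(2) has_derivative_at_withinI[OF D]] \<open>L \<ge> 0\<close>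
    by (intro lipschitz_onI) (auto simp: dist_norm)
  then show ?thesis ..
qed

text \<open>Precomposing the field with the projection to a closed ball makes it bounded and
  Lipschitz everywhere. By continuity the solution stays in the ball for a short time, and there the
  modified field is the given one.\<close>

theorem local_flow_exists:
  fixes F :: "'a::euclidean_space \<Rightarrow> 'a"
  assumes "open S" "x0 \<in> S" "C_times_on 1 S F"
  obtains T x where "T > 0" "x 0 = x0"
    "\<And>t. t \<in> {-T<..<T} \<Longrightarrow> x t \<in> S \<and> (x has_vector_derivative F (x t)) (at t)"
proof -
  obtain r where "r > 0" and r: "cball x0 r \<subseteq> S"
    using assms(1,2) open_contains_cball by blast
  obtain L where L: "L-lipschitz_on (cball x0 r) F"
    using C_times_on_imp_lipschitz[OF compact_cball convex_cball r assms(3)] .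
  define G where "G x = F (closest_point (cball x0 r) x)" for x
  have cp: "closest_point (cball x0 r) x \<in> cball x0 r" for x
    using \<open>r > 0\<close> by (intro closest_point_in_set) auto
  have "L-lipschitz_on UNIV G"
  proof (rule lipschitz_onI)
    fix x y
    have "dist (G x) (G y) \<le> L * dist (closest_point (cball x0 r) x) (closest_point (cball x0 r) y)"
      unfolding G_def using lipschitz_onD[OF L cp cp] .
    also have "\<dots> \<le> L * dist x y"
      using lipschitz_on_nonneg[OF L] \<open>r > 0\<close>
      by (intro mult_left_mono closest_point_lipschitz) auto
    finally show "dist (G x) (G y) \<le> L * dist x y" .
  qed (rule lipschitz_on_nonneg[OF L])
  moreover obtain B where "\<And>x. norm (G x) \<le> B"
  proof -
    have "bounded (F ` cball x0 r)"
      using lipschitz_on_continuous_on[OF L] by (intro compact_imp_bounded compact_continuous_image) auto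
    with cp that show ?thesis
      unfolding G_def bounded_iff by blast
  qed
  ultimately obtain T x where T: "T > 0" "x 0 = x0"
    "\<And>t. t \<in> {-T<..<T} \<Longrightarrow> (x has_vector_derivative G (x t)) (at t)"
    using picard_lindeloef_global by blast
  have "isCont x 0"
    using has_vector_derivative_continuous[OF T(3)[of 0]] T(1) by simp
  then obtain d where "d > 0" and d: "\<And>t. \<bar>t\<bar> < d \<Longrightarrow> dist (x t) x0 < r"
    using \<open>r > 0\<close> T(2) unfolding continuous_at_eps_delta by (metis dist_real_def diff_zero)
  show ?thesis
  proof
    show "min T d > 0" "x 0 = x0"
      using T \<open>d > 0\<close> by auto
    fix t assume t: "t \<in> {- min T d<..<min T d}"
    then have "x t \<in> cball x0 r"
      using d[of t] by (auto simp: dist_commute less_imp_le)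
    then have "G (x t) = F (x t)"
      by (simp add: G_def closest_point_self)
    with \<open>x t \<in> cball x0 r\<close> T(3)[of t] r t
    show "x t \<in> S \<and> (x has_vector_derivative F (x t)) (at t)"
      by auto
  qed
qed

section \<open>Functions that are constant on the fibers of a submersion\<close>

text \<open>The map x + J (f x - f'(p) x), where J is a right inverse of f'(p), is a local
  diffeomorphism that straightens the fibers of f to affine subspaces.\<close>

lemma locally_constant_on_fiber:
  fixes f :: "'a::euclidean_space \<Rightarrow> 'b::euclidean_space" and u :: "'a \<Rightarrow> real"
  assumes "open U" "p \<in> U" "C_times_on 1 U f"
    and u: "\<And>x. x \<in> U \<Longrightarrow> u differentiable (at x)"
    and surj: "surj (frechet_derivative f (at p))"
    and vert: "\<And>x v. x \<in> U \<Longrightarrow> frechet_derivative f (at x) v = 0 \<Longrightarrow> frechet_derivative u (at x) v = 0"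
  obtains N where "open N" "p \<in> N" "N \<subseteq> U" "\<And>x. x \<in> N \<Longrightarrow> f x = f p \<Longrightarrow> u x = u p"
proof -
  have D: "(f has_derivative frechet_derivative f (at x)) (at x)" if "x \<in> U" for x
    using assms(3) that by (auto simp: frechet_derivative_works)
  define L where "L = frechet_derivative f (at p)"
  have "bounded_linear L"
    unfolding L_def using D[OF \<open>p \<in> U\<close>] by (rule has_derivative_bounded_linear)
  obtain J where "linear J" and LJ: "L \<circ> J = id"
    using linear_surjective_right_inverse[of L] surj bounded_linear.linear[OF \<open>bounded_linear L\<close>]
    unfolding L_def by auto
  have "bounded_linear J"
    using \<open>linear J\<close> by (simp add: linear_conv_bounded_linear)
  define \<psi> where "\<psi> x = x + J (f x - L x)" for x
  define \<psi>' where "\<psi>' x v = v + J (frechet_derivative f (at x) v - L v)" for x v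
  have D\<psi>: "(\<psi> has_derivative \<psi>' x) (at x)" if "x \<in> U" for x
    unfolding \<psi>_def \<psi>'_def
    by (intro derivative_intros D that bounded_linear.has_derivative[OF \<open>bounded_linear J\<close>]
        bounded_linear.has_derivative[OF \<open>bounded_linear L\<close>])
  have bl: "bounded_linear (\<psi>' x)" if "x \<in> U" for x
    using D\<psi>[OF that] by (rule has_derivative_bounded_linear)
  define \<Psi> where "\<Psi> x = Blinfun (\<psi>' x)" for x
  have \<Psi>: "blinfun_apply (\<Psi> x) = \<psi>' x" if "x \<in> U" for x
    unfolding \<Psi>_def using bl[OF that] by (rule bounded_linear_Blinfun_apply)
  have "continuous_on U \<Psi>"
  proof (rule continuous_on_blinfun_componentwise)
    fix i :: 'a assume "i \<in> Basis"
    have "continuous_on U (\<lambda>x. \<psi>' x i)"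
      unfolding \<psi>'_def using assms(3)
      by (intro continuous_intros bounded_linear.continuous_on[OF \<open>bounded_linear J\<close>]) auto
    then show "continuous_on U (\<lambda>x. blinfun_apply (\<Psi> x) i)"
      by (simp add: \<Psi> cong: continuous_on_cong)
  qed
  moreover have "id_blinfun o\<^sub>L \<Psi> p = id_blinfun"
    by (rule blinfun_eqI) (simp add: \<Psi> \<open>p \<in> U\<close> \<psi>'_def L_def linear_0[OF \<open>linear J\<close>])
  ultimately obtain U' V g g' where g: "open U'" "U' \<subseteq> U" "p \<in> U'" "open V" "\<psi> p \<in> V" "homeomorphism U' V \<psi> g"
    "\<And>y. y \<in> V \<Longrightarrow> (g has_derivative (g' y)) (at y)"
    using inverse_function_theorem[OF \<open>open U\<close> _ _ \<open>p \<in> U\<close>, of \<psi> \<Psi> id_blinfun] D\<psi> \<Psi> by metis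
  obtain e where "e > 0" and e: "ball (\<psi> p) e \<subseteq> V"
    using g(4,5) open_contains_ball by blast
  have L\<psi>: "L (\<psi> x) = f x" for x
    using LJ bounded_linear.linear[OF \<open>bounded_linear L\<close>]
    by (simp add: \<psi>_def linear_add fun_eq_iff)
  define N where "N = U' \<inter> \<psi> -` ball (\<psi> p) e"
  show ?thesis
  proof
    have "continuous_on U' \<psi>"
      using g(6) by (simp add: homeomorphism_def)
    then show "open N"
      unfolding N_def by (rule continuous_open_preimage[OF _ g(1)]) simp
    show "p \<in> N" "N \<subseteq> U"
      using g \<open>e > 0\<close> by (auto simp: N_def)
    fix x assume x: "x \<in> N" "f x = f p"
    define w where "w = \<psi> x - \<psi> p"
    have "L w = 0"
      using x L\<psi> bounded_linear.linear[OF \<open>bounded_linear L\<close>] by (simp add: w_def linear_diff)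
    \<comment> \<open>The segment from \<psi> p to \<psi> x is prolonged to an open convex set of
      parameters: openness gives two-sided derivatives also at 0 and 1, convexity gives constancy
      from a vanishing derivative.\<close>
    define S where "S = (\<lambda>s. \<psi> p + s *\<^sub>R w) -` ball (\<psi> p) e"
    have "open S"
      unfolding S_def by (intro open_vimage continuous_intros) auto
    have "convex S"
    proof -
      have "S = (\<lambda>s. s *\<^sub>R w) -` ball 0 e"
        by (auto simp: S_def dist_norm)
      moreover have "convex ((\<lambda>s. s *\<^sub>R w) -` ball 0 e)"
        by (intro convex_linear_vimage linearI) (auto simp: algebra_simps)
      ultimately show ?thesis by simp
    qed
    define c where "c s = g (\<psi> p + s *\<^sub>R w)" for s
    have inV: "\<psi> p + s *\<^sub>R w \<in> V" if "s \<in> S" for s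
      using that e by (auto simp: S_def)
    have c: "c s \<in> U" "f (c s) = f p" if "s \<in> S" for s
    proof -
      show "c s \<in> U"
        using g(2,6) inV[OF that] by (auto simp: c_def homeomorphism_def)
      have "\<psi> (c s) = \<psi> p + s *\<^sub>R w"
        using g(6) inV[OF that] by (auto simp: c_def homeomorphism_def)
      then have "f (c s) = L (\<psi> p + s *\<^sub>R w)"
        using L\<psi> by metis
      then show "f (c s) = f p"
        using L\<psi> \<open>L w = 0\<close> bounded_linear.linear[OF \<open>bounded_linear L\<close>]
        by (simp add: linear_add linear_scale)
    qed
    \<comment> \<open>f is constant along c, so the velocity of c lies in the kernel of the
      derivative of f, where by hypothesis the derivative of u vanishes too.\<close>
    have "(u \<circ> c has_derivative (\<lambda>h. 0)) (at s within S)" if "s \<in> S" for s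
    proof -
      define c' where "c' = (\<lambda>k. g' (\<psi> p + s *\<^sub>R w) (k *\<^sub>R w))"
      have c': "(c has_derivative c') (at s)"
        unfolding c_def c'_def
        by (rule has_derivative_compose[where f = "\<lambda>s. \<psi> p + s *\<^sub>R w" and g = g, OF _ g(7)[OF inV[OF that]]])
          (auto intro!: derivative_eq_intros)
      have "(f \<circ> c has_derivative frechet_derivative f (at (c s)) \<circ> c') (at s)"
        by (rule diff_chain_at[OF c' D[OF c(1)[OF that]]])
      moreover have "(f \<circ> c has_derivative (\<lambda>h. 0)) (at s)"
        by (rule has_derivative_transform_within_open[OF has_derivative_const[of "f p"] \<open>open S\<close> that])
          (simp add: c)
      ultimately have "frechet_derivative f (at (c s)) \<circ> c' = (\<lambda>h. 0)"
        by (rule has_derivative_unique)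
      then have "frechet_derivative u (at (c s)) \<circ> c' = (\<lambda>h. 0)"
        using vert[OF c(1)[OF that]] by (auto simp: fun_eq_iff)
      moreover have "(u \<circ> c has_derivative frechet_derivative u (at (c s)) \<circ> c') (at s)"
        using u[OF c(1)[OF that]] by (intro diff_chain_at[OF c']) (simp add: frechet_derivative_works)
      ultimately show ?thesis
        by (metis has_derivative_at_withinI)
    qed
    moreover have "0 \<in> S" "1 \<in> S"
      using x \<open>e > 0\<close> by (auto simp: S_def w_def N_def)
    ultimately have "(u \<circ> c) 0 = (u \<circ> c) 1"
      using has_derivative_zero_unique[OF \<open>convex S\<close>] by blast
    moreover have "c 0 = p" "c 1 = x"
      using g(3,6) x by (auto simp: c_def w_def N_def homeomorphism_def)
    ultimately show "u x = u p" by simp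
  qed
qed

section \<open>Bilinear forms given by matrices\<close>

lemma bounded_bilinear_matrix_vector_mult:
  "bounded_bilinear (\<lambda>(M::real^'m::finite^'k::finite) v. M *v v)"
  by (auto simp: bilinear_conv_bounded_bilinear[symmetric] bilinear_def matrix_vector_mult_add_rdistrib
      scaleR_matrix_vector_assoc intro!: linearI)

lemma ip_sum: "ip M a b = (\<Sum>i\<in>UNIV. \<Sum>j\<in>UNIV. a $ i * b $ j * M $ i $ j)"
  by (simp add: ip_def inner_vec_def matrix_vector_mult_def sum_distrib_left mult_ac)

lemma ip_simps:
  "ip M (a + b) c = ip M a c + ip M b c" "ip M a (b + c) = ip M a b + ip M a c"
  "ip M (a - b) c = ip M a c - ip M b c" "ip M a (b - c) = ip M a b - ip M a c"
  "ip (M + N) a b = ip M a b + ip N a b" "ip (M - N) a b = ip M a b - ip N a b"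
  "ip M (k *\<^sub>R a) b = k * ip M a b" "ip M a (k *\<^sub>R b) = k * ip M a b" "ip (k *\<^sub>R M) a b = k * ip M a b"
  "ip M 0 b = 0" "ip M a 0 = 0" "ip 0 a b = 0" "ip M (- a) b = - ip M a b" "ip M a (- b) = - ip M a b"
  by (simp_all add: ip_def inner_simps matrix_vector_right_distrib matrix_vector_mult_add_rdistrib
      matrix_vector_mult_diff_rdistrib matrix_vector_mult_diff_distrib matrix_vector_mult_scaleR
      scaleR_matrix_vector_assoc[symmetric] linear_neg[OF matrix_vector_mul_linear])

lemma linear_ip: "linear (\<lambda>a. ip M a b)" "linear (\<lambda>b. ip M a b)" "linear (\<lambda>M. ip M a b)"
  by (auto intro!: linearI simp: ip_simps)

lemma ip_sym: "transpose M = M \<Longrightarrow> ip M a b = ip M b a"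
  by (simp add: ip_def dot_lmul_matrix[symmetric] inner_commute) (metis dot_lmul_matrix inner_commute vector_transpose_matrix)

lemma has_derivative_ip:
  assumes "(M has_derivative M') (at x within S)" "(a has_derivative a') (at x within S)"
    "(b has_derivative b') (at x within S)"
  shows "((\<lambda>y. ip (M y) (a y) (b y)) has_derivative
    (\<lambda>h. ip (M' h) (a x) (b x) + ip (M x) (a' h) (b x) + ip (M x) (a x) (b' h))) (at x within S)"
proof -
  have "((\<lambda>y. a y \<bullet> (M y *v b y)) has_derivative
     (\<lambda>h. a x \<bullet> (M x *v b' h + M' h *v b x) + a' h \<bullet> (M x *v b x))) (at x within S)"
    by (intro has_derivative_inner assms bounded_bilinear.FDERIV[OF bounded_bilinear_matrix_vector_mult])
  then show ?thesis
    by (simp add: ip_def inner_add_right add_ac)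
qed

lemma ip_frechet_derivative:
  assumes "M differentiable (at x)"
  shows "((\<lambda>y. ip (M y) a b) has_derivative (\<lambda>z. ip (frechet_derivative M (at x) z) a b)) (at x)"
  using has_derivative_ip[OF frechet_derivative_works[THEN iffD1, OF assms] has_derivative_const has_derivative_const, of a b]
  by (simp add: ip_simps)

definition posdef :: "real^'m::finite^'m \<Rightarrow> bool" where
  "posdef M \<longleftrightarrow> transpose M = M \<and> (\<forall>v. v \<noteq> 0 \<longrightarrow> ip M v v > 0)"

lemma posdef_sym: "posdef M \<Longrightarrow> ip M a b = ip M b a"
  by (simp add: posdef_def ip_sym)

lemma posdef_nonneg: "posdef M \<Longrightarrow> ip M a a \<ge> 0"
  by (cases "a = 0") (auto simp: posdef_def ip_simps less_imp_le)

lemma posdef_eq_0: "posdef M \<Longrightarrow> ip M a a = 0 \<longleftrightarrow> a = 0"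
  by (cases "a = 0") (force simp: posdef_def ip_simps)+

lemma posdef_eqI:
  assumes "posdef M" "\<And>z. ip M a z = ip M b z"
  shows "a = b"
  using assms posdef_eq_0[of M "a - b"] by (simp add: ip_simps)

lemma posdef_invertible: "posdef M \<Longrightarrow> invertible M"
proof -
  assume M: "posdef M"
  have "inj ((*v) M)"
  proof (rule injI)
    fix a b assume "M *v a = M *v b"
    then have "ip M z a = ip M z b" for z
      by (simp add: ip_def)
    with M show "a = b"
      by (metis posdef_eqI posdef_sym)
  qed
  then show ?thesis
    by (metis invertible_left_inverse matrix_left_invertible_injective)
qed

lemma matrix_inv_mult:
  assumes "invertible A"
  shows "A ** matrix_inv A = mat 1" "matrix_inv A ** A = mat 1"
  using someI_ex[OF assms[unfolded invertible_def]] unfolding matrix_inv_def by auto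

lemma posdef_scale: "posdef M \<Longrightarrow> k > 0 \<Longrightarrow> posdef (k *\<^sub>R M)"
  by (simp add: posdef_def ip_simps transpose_scalar)

lemma vec_sum_axis: "(\<Sum>i\<in>UNIV. x $ i *\<^sub>R axis i 1) = (x::real^'m::finite)"
  using basis_expansion[of x] by (simp add: scalar_mult_eq_scaleR)

lemma linear_sum_axis:
  fixes x :: "real^'m::finite"
  assumes "linear f"
  shows "f x = (\<Sum>i\<in>UNIV. x $ i *\<^sub>R f (axis i 1))"
proof -
  have "f x = f (\<Sum>i\<in>UNIV. x $ i *\<^sub>R axis i 1)"
    by (simp add: vec_sum_axis)
  with assms show ?thesis
    by (simp add: linear_sum linear_scale)
qed

lemma bilinear_sum_axis:
  fixes a :: "real^'m::finite" and b :: "real^'k::finite"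
  assumes "\<And>v. linear (\<lambda>u. f u v)" "\<And>u. linear (\<lambda>v. f u v)"
  shows "f a b = (\<Sum>i\<in>UNIV. \<Sum>j\<in>UNIV. (a $ i * b $ j) *\<^sub>R f (axis i 1) (axis j 1))"
proof -
  have "f a b = (\<Sum>i\<in>UNIV. a $ i *\<^sub>R f (axis i 1) b)"
    using linear_sum_axis[OF assms(1)] .
  also have "\<dots> = (\<Sum>i\<in>UNIV. a $ i *\<^sub>R (\<Sum>j\<in>UNIV. b $ j *\<^sub>R f (axis i 1) (axis j 1)))"
    by (subst linear_sum_axis[OF assms(2)]) simp
  finally show ?thesis
    by (simp add: scaleR_sum_right)
qed

section \<open>Traces of bilinear forms with respect to an inner product\<close>

definition metric_trace :: "real^'m::finite^'m \<Rightarrow> (real^'m \<Rightarrow> real^'m \<Rightarrow> real) \<Rightarrow> real" where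
  "metric_trace G b = (\<Sum>i\<in>UNIV. \<Sum>j\<in>UNIV. matrix_inv G $ i $ j * b (axis i 1) (axis j 1))"

lemma metric_trace_simps:
  "metric_trace G (\<lambda>u v. b u v + c u v) = metric_trace G b + metric_trace G c"
  "metric_trace G (\<lambda>u v. b u v - c u v) = metric_trace G b - metric_trace G c"
  "metric_trace G (\<lambda>u v. k * b u v) = k * metric_trace G b"
  by (simp_all add: metric_trace_def algebra_simps sum.distrib sum_subtractf sum_distrib_left)

lemma ip_axis: "transpose G = G \<Longrightarrow> ip G v (axis j 1) = (G *v v) $ j"
  using ip_sym[of G v "axis j 1"] by (simp add: ip_def inner_axis')

lemma inverse_ip_axis:
  assumes "posdef G"
  shows "(\<Sum>j\<in>UNIV. matrix_inv G $ i $ j * ip G v (axis j 1)) = v $ i"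
proof -
  have "(\<Sum>j\<in>UNIV. matrix_inv G $ i $ j * ip G v (axis j 1)) = (matrix_inv G *v (G *v v)) $ i"
    using assms by (simp add: matrix_vector_mult_def[of "matrix_inv G"] ip_axis posdef_def)
  then show ?thesis
    using matrix_inv_mult(2)[OF posdef_invertible[OF assms]] by (simp add: matrix_vector_mul_assoc)
qed

lemma metric_trace_ip:
  assumes "posdef G"
  shows "metric_trace G (\<lambda>u v. ip G (L u) v) = (\<Sum>i\<in>UNIV. L (axis i 1) $ i)"
  using inverse_ip_axis[OF assms] by (simp add: metric_trace_def)

lemma metric_trace_rank_one:
  assumes "posdef G" "linear \<alpha>"
  shows "metric_trace G (\<lambda>u v. \<alpha> u * ip G z v) = \<alpha> z"
proof -
  have "metric_trace G (\<lambda>u v. \<alpha> u * ip G z v) =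
      (\<Sum>i\<in>UNIV. \<alpha> (axis i 1) * (\<Sum>j\<in>UNIV. matrix_inv G $ i $ j * ip G z (axis j 1)))"
    by (simp add: metric_trace_def sum_distrib_left mult_ac)
  also have "\<dots> = (\<Sum>i\<in>UNIV. z $ i *\<^sub>R \<alpha> (axis i 1))"
    by (simp add: inverse_ip_axis[OF assms(1)]) (simp add: mult.commute)
  finally show ?thesis
    using linear_sum_axis[OF assms(2), of z] by simp
qed

lemma matrix_inv_symmetric:
  assumes "posdef G"
  shows "matrix_inv G $ i $ j = matrix_inv G $ j $ i"
proof -
  let ?I = "matrix_inv G"
  note inv = matrix_inv_mult[OF posdef_invertible[OF assms]]
  have "transpose ?I ** G = mat 1"
    using inv(1) assms by (metis matrix_transpose_mul posdef_def transpose_mat)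
  then have "transpose ?I = ?I"
    by (metis inv(1) matrix_mul_assoc matrix_mul_lid matrix_mul_rid)
  then have "transpose ?I $ j $ i = ?I $ j $ i"
    by simp
  then show ?thesis
    by (simp add: transpose_def)
qed

lemma metric_trace_commute: "posdef G \<Longrightarrow> metric_trace G (\<lambda>u v. b v u) = metric_trace G b"
  unfolding metric_trace_def by (subst sum.swap) (simp add: matrix_inv_symmetric)

text \<open>The inverse Gram matrix represents the sum of e tensor e over an orthonormal basis. On
  this tensor, L acting on one factor agrees with its adjoint acting on the other;
  \<open>key\<close> is that identity in coordinates.\<close>

lemma metric_trace_adjoint:
  assumes G: "posdef G" and L: "linear L" "linear L'" "\<And>u v. ip G (L u) v = ip G u (L' v)"
    and b: "\<And>v. linear (\<lambda>u. b u v)" "\<And>u. linear (\<lambda>v. b u v)"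
  shows "metric_trace G (\<lambda>u v. b (L u) v) = metric_trace G (\<lambda>u v. b u (L' v))"
proof -
  define I where "I = matrix_inv G"
  have key: "(\<Sum>i\<in>UNIV. I $ i $ j * L (axis i 1) $ k) = (\<Sum>i\<in>UNIV. I $ k $ i * L' (axis i 1) $ j)" for j k
  proof -
    have "(\<Sum>i\<in>UNIV. I $ i $ j * L (axis i 1) $ k) = L (\<chi> i. I $ i $ j) $ k"
      by (subst linear_sum_axis[OF L(1)]) simp
    moreover have "(\<Sum>i\<in>UNIV. I $ k $ i * L' (axis i 1) $ j) = L' (\<chi> i. I $ k $ i) $ j"
      by (subst linear_sum_axis[OF L(2)]) simp
    moreover have "L (\<chi> i. I $ i $ j) $ k = L' (\<chi> i. I $ k $ i) $ j"
    proof -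
      \<comment> \<open>The columns of the inverse are the \<open>G\<close>-dual basis of the axes.
        So each coordinate of a vector is its inner product with a column, and the adjoint relation
        applies.\<close>
      have col: "G *v (\<chi> i. I $ i $ j) = axis j 1" for j
      proof -
        have "G ** I = mat 1"
          unfolding I_def by (rule matrix_inv_mult(1)[OF posdef_invertible[OF G]])
        then have "(G ** I) $ i $ j = mat 1 $ i $ j" for i
          by simp
        then show ?thesis
          by (simp add: vec_eq_iff matrix_matrix_mult_def matrix_vector_mult_def mat_def axis_def)
      qed
      have rc: "(\<chi> i. I $ k $ i) = (\<chi> i. I $ i $ k)"
        by (simp add: vec_eq_iff I_def matrix_inv_symmetric[OF G, of k])
      have "L (\<chi> i. I $ i $ j) $ k = ip G (L (\<chi> i. I $ i $ j)) (\<chi> i. I $ i $ k)"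
        by (simp add: ip_def col inner_axis)
      also have "\<dots> = ip G (L' (\<chi> i. I $ i $ k)) (\<chi> i. I $ i $ j)"
        using L(3) posdef_sym[OF G] by metis
      also have "\<dots> = L' (\<chi> i. I $ k $ i) $ j"
        by (simp add: ip_def col inner_axis rc[symmetric])
      finally show ?thesis .
    qed
    ultimately show ?thesis by simp
  qed
  have "metric_trace G (\<lambda>u v. b (L u) v) =
     (\<Sum>i\<in>UNIV. \<Sum>j\<in>UNIV. I $ i $ j * (\<Sum>k\<in>UNIV. L (axis i 1) $ k * b (axis k 1) (axis j 1)))"
    unfolding metric_trace_def I_def by (subst linear_sum_axis[OF b(1), of "L _"]) simp
  also have "\<dots> = (\<Sum>i\<in>UNIV. \<Sum>j\<in>UNIV. \<Sum>k\<in>UNIV. I $ i $ j * L (axis i 1) $ k * b (axis k 1) (axis j 1))"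
    by (simp add: sum_distrib_left mult_ac)
  also have "\<dots> = (\<Sum>j\<in>UNIV. \<Sum>i\<in>UNIV. \<Sum>k\<in>UNIV. I $ i $ j * L (axis i 1) $ k * b (axis k 1) (axis j 1))"
    by (rule sum.swap)
  also have "\<dots> = (\<Sum>j\<in>UNIV. \<Sum>k\<in>UNIV. \<Sum>i\<in>UNIV. I $ i $ j * L (axis i 1) $ k * b (axis k 1) (axis j 1))"
    by (intro sum.cong refl sum.swap)
  also have "\<dots> = (\<Sum>j\<in>UNIV. \<Sum>k\<in>UNIV. (\<Sum>i\<in>UNIV. I $ k $ i * L' (axis i 1) $ j) * b (axis k 1) (axis j 1))"
    by (simp add: key[symmetric] sum_distrib_right)
  also have "\<dots> = (\<Sum>k\<in>UNIV. \<Sum>j\<in>UNIV. \<Sum>i\<in>UNIV. I $ k $ i * L' (axis i 1) $ j * b (axis k 1) (axis j 1))"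
    by (subst sum.swap) (simp add: sum_distrib_right)
  also have "\<dots> = (\<Sum>k\<in>UNIV. \<Sum>i\<in>UNIV. \<Sum>j\<in>UNIV. I $ k $ i * L' (axis i 1) $ j * b (axis k 1) (axis j 1))"
    by (intro sum.cong refl sum.swap)
  also have "\<dots> = (\<Sum>k\<in>UNIV. \<Sum>i\<in>UNIV. I $ k $ i * (\<Sum>j\<in>UNIV. L' (axis i 1) $ j * b (axis k 1) (axis j 1)))"
    by (simp add: sum_distrib_left mult_ac)
  also have "\<dots> = metric_trace G (\<lambda>u v. b u (L' v))"
    unfolding metric_trace_def I_def by (subst linear_sum_axis[OF b(2), of _ "L' _"]) simp
  finally show ?thesis .
qed

text \<open>P is an orthogonal projection. Moving it across with \<open>metric_trace_adjoint\<close>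
  puts the product of P and 1 - P, which is 0, into one slot, so the mixed blocks have no
  trace.\<close>

lemma metric_trace_orthogonal_split:
  assumes G: "posdef G" and P: "linear P" "\<And>u v. ip G (P u) v = ip G u (P v)" "\<And>u. P (P u) = P u"
    and b: "\<And>v. linear (\<lambda>u. b u v)" "\<And>u. linear (\<lambda>v. b u v)"
  shows "metric_trace G b =
    metric_trace G (\<lambda>u v. b (P u) (P v)) + metric_trace G (\<lambda>u v. b (u - P u) (v - P v))"
proof -
  have bP: "linear (\<lambda>v. b u (P v))" "linear (\<lambda>v. b u (v - P v))" for u
    using linear_compose[OF P(1) b(2)[of u]] linear_compose_sub[OF b(2)[of u] linear_compose[OF P(1) b(2)[of u]]]
    by (auto simp: o_def linear_diff[OF b(2)])
  have cross: "metric_trace G (\<lambda>u v. b (P u) (v - P v)) = 0"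
  proof -
    have "metric_trace G (\<lambda>u v. b (P u) (v - P v)) = metric_trace G (\<lambda>u v. b u (P v - P (P v)))"
      by (rule metric_trace_adjoint[OF G P(1) P(1) P(2), of "\<lambda>u v. b u (v - P v)"])
        (use b(1) bP in auto)
    also have "\<dots> = 0"
      by (simp add: P(3) linear_0[OF b(2)] metric_trace_def)
    finally show ?thesis .
  qed
  have cross': "metric_trace G (\<lambda>u v. b (u - P u) (P v)) = 0"
  proof -
    have "metric_trace G (\<lambda>u v. b (P u) (P v)) = metric_trace G (\<lambda>u v. b u (P (P v)))"
      by (rule metric_trace_adjoint[OF G P(1) P(1) P(2), of "\<lambda>u v. b u (P v)"]) (use b(1) bP in auto)
    then show ?thesis
      by (simp add: P(3) linear_diff[OF b(1)] metric_trace_simps)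
  qed
  have "b u v = (b (P u) (P v) + b (u - P u) (v - P v)) + (b (P u) (v - P v) + b (u - P u) (P v))" for u v
    by (simp add: linear_diff[OF b(1)] linear_diff[OF b(2)])
  then have "metric_trace G b = metric_trace G
      (\<lambda>u v. (b (P u) (P v) + b (u - P u) (v - P v)) + (b (P u) (v - P v) + b (u - P u) (P v)))"
    by (intro arg_cong[where f = "metric_trace G"] ext)
  then show ?thesis
    unfolding metric_trace_simps cross cross' by simp
qed

section \<open>The Levi-Civita connection in coordinates\<close>

text \<open>The Christoffel symbols of a Gram matrix given as a function of the coordinates, with no
  chart involved; \<open>christoffel_christ\<close> links them to the manifold version.\<close>

definition christ :: "(real^'m \<Rightarrow> real^'m^'m) \<Rightarrow> real^'m::finite \<Rightarrow> 'm \<Rightarrow> 'm \<Rightarrow> 'm \<Rightarrow> real" where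
  "christ G x k i j = (\<Sum>l\<in>UNIV. matrix_inv (G x) $ k $ l *
     (partial i (\<lambda>y. G y $ j $ l) x + partial j (\<lambda>y. G y $ i $ l) x - partial l (\<lambda>y. G y $ i $ j) x)) / 2"

definition gam :: "(real^'m \<Rightarrow> real^'m^'m) \<Rightarrow> real^'m::finite \<Rightarrow> real^'m \<Rightarrow> real^'m \<Rightarrow> real^'m" where
  "gam G x u v = (\<chi> k. \<Sum>i\<in>UNIV. \<Sum>j\<in>UNIV. christ G x k i j * u $ i * v $ j)"

text \<open>The Christoffel symbols of the first kind as a trilinear form. They also make sense for
  the degenerate form h, which has no symbols of the second kind.\<close>

definition koszul :: "(real^'m \<Rightarrow> real^'m^'m) \<Rightarrow> real^'m::finite \<Rightarrow> real^'m \<Rightarrow> real^'m \<Rightarrow> real^'m \<Rightarrow> real" where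
  "koszul G x u v w = (ip (frechet_derivative G (at x) u) v w + ip (frechet_derivative G (at x) v) u w
     - ip (frechet_derivative G (at x) w) u v) / 2"

lemma linear_gam: "linear (\<lambda>u. gam G x u v)" "linear (\<lambda>v. gam G x u v)"
  by (auto intro!: linearI simp: gam_def vec_eq_iff algebra_simps sum.distrib sum_distrib_left)

lemma linear_koszul:
  assumes "G differentiable (at x)"
  shows "linear (\<lambda>u. koszul G x u v w)" "linear (\<lambda>v. koszul G x u v w)" "linear (\<lambda>w. koszul G x u v w)"
  using linear_frechet_derivative[OF assms]
  by (auto intro!: linearI simp: koszul_def linear_add linear_scale ip_simps field_simps)

lemma christ_koszul:
  assumes "G differentiable (at x)"
  shows "christ G x k i j = (\<Sum>l\<in>UNIV. matrix_inv (G x) $ k $ l * koszul G x (axis i 1) (axis j 1) (axis l 1))"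
proof -
  have D: "(G has_derivative frechet_derivative G (at x)) (at x)"
    using assms by (simp add: frechet_derivative_works)
  have "((\<lambda>y. G y $ j $ l) has_derivative (\<lambda>z. frechet_derivative G (at x) z $ j $ l)) (at x)" for j l
    by (rule bounded_linear.has_derivative[OF bounded_linear_vec_nth]
        bounded_linear.has_derivative[OF bounded_linear_vec_nth D])+
  then have "partial i (\<lambda>y. G y $ j $ l) x = frechet_derivative G (at x) (axis i 1) $ j $ l" for i j l
    unfolding partial_def by (metis frechet_derivative_at)
  moreover have "ip M (axis j 1) (axis l 1) = M $ j $ l" for M :: "real^'a^'a" and j l
    by (simp add: ip_def inner_axis' matrix_vector_mul_component inner_axis)
  ultimately show ?thesis
    by (simp add: christ_def koszul_def sum_divide_distrib)
qed

text \<open>Lowering the upper index cancels the inverse Gram matrix. The geometric identities for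
  \<open>gam\<close> below rest on this.\<close>

lemma ip_gam:
  assumes "G differentiable (at x)" "posdef (G x)"
  shows "ip (G x) (gam G x u v) w = koszul G x u v w"
proof -
  define \<kappa> where "\<kappa> = (\<chi> l. koszul G x u v (axis l 1))"
  have "gam G x u v = matrix_inv (G x) *v \<kappa>"
  proof -
    have "gam G x u v $ k = (matrix_inv (G x) *v \<kappa>) $ k" for k
    proof -
      have "gam G x u v $ k = (\<Sum>i\<in>UNIV. \<Sum>j\<in>UNIV. \<Sum>l\<in>UNIV. matrix_inv (G x) $ k $ l *
          ((u $ i * v $ j) *\<^sub>R koszul G x (axis i 1) (axis j 1) (axis l 1)))"
        by (simp add: gam_def christ_koszul[OF assms(1)] sum_distrib_right sum_distrib_left mult_ac)
      also have "\<dots> = (\<Sum>i\<in>UNIV. \<Sum>l\<in>UNIV. \<Sum>j\<in>UNIV. matrix_inv (G x) $ k $ l *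
          ((u $ i * v $ j) *\<^sub>R koszul G x (axis i 1) (axis j 1) (axis l 1)))"
        by (intro sum.cong refl sum.swap)
      also have "\<dots> = (\<Sum>l\<in>UNIV. \<Sum>i\<in>UNIV. \<Sum>j\<in>UNIV. matrix_inv (G x) $ k $ l *
          ((u $ i * v $ j) *\<^sub>R koszul G x (axis i 1) (axis j 1) (axis l 1)))"
        by (rule sum.swap)
      also have "\<dots> = (\<Sum>l\<in>UNIV. matrix_inv (G x) $ k $ l * koszul G x u v (axis l 1))"
        by (subst bilinear_sum_axis[where f = "\<lambda>u v. koszul G x u v (axis _ 1)" and a = u and b = v,
              OF linear_koszul(1)[OF assms(1)] linear_koszul(2)[OF assms(1)]])
          (simp add: sum_distrib_left)
      finally show ?thesis
        by (simp add: matrix_vector_mult_def \<kappa>_def)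
    qed
    then show ?thesis by (simp add: vec_eq_iff)
  qed
  then have "G x *v gam G x u v = \<kappa>"
    using matrix_inv_mult(1)[OF posdef_invertible[OF assms(2)]] by (simp add: matrix_vector_mul_assoc)
  then have "ip (G x) (gam G x u v) w = w \<bullet> \<kappa>"
    using posdef_sym[OF assms(2)] by (simp add: ip_def)
  also have "\<dots> = (\<Sum>i\<in>UNIV. w $ i *\<^sub>R koszul G x u v (axis i 1))"
    by (simp add: inner_vec_def \<kappa>_def)
  also have "\<dots> = koszul G x u v w"
    using linear_sum_axis[OF linear_koszul(3)[OF assms(1)]] by metis
  finally show ?thesis .
qed

lemma frechet_derivative_symmetric:
  assumes "open U" "x \<in> U" "\<And>y. y \<in> U \<Longrightarrow> transpose (G y) = G y" "G differentiable (at x)"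
  shows "ip (frechet_derivative G (at x) z) a b = ip (frechet_derivative G (at x) z) b a"
proof -
  have "((\<lambda>y. ip (G y) a b) has_derivative (\<lambda>z. ip (frechet_derivative G (at x) z) b a)) (at x)"
    by (rule has_derivative_transform_within_open[OF ip_frechet_derivative[OF assms(4)] assms(1,2)])
      (simp add: assms(3) ip_sym)
  then show ?thesis
    using has_derivative_unique[OF ip_frechet_derivative[OF assms(4), of a b]] by metis
qed

lemma gam_symmetric:
  assumes "open U" "x \<in> U" "\<And>y. y \<in> U \<Longrightarrow> posdef (G y)" "G differentiable (at x)"
  shows "gam G x a b = gam G x b a"
proof (rule posdef_eqI)
  show "posdef (G x)" using assms by blast
  have sym: "transpose (G y) = G y" if "y \<in> U" for y
    using assms(3)[OF that] by (simp add: posdef_def)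
  show "ip (G x) (gam G x a b) z = ip (G x) (gam G x b a) z" for z
    using frechet_derivative_symmetric[OF assms(1,2) sym assms(4)] assms
    by (simp add: ip_gam koszul_def)
qed

text \<open>Of the six terms with second derivatives of \<Phi> that the product rule produces,
  symmetry of second derivatives cancels four and merges the other two. T may be degenerate, so the
  formula serves both for transition maps, which are isometries, and for the pullback of g' by the
  submersion.\<close>

lemma koszul_pullback:
  fixes \<Phi> :: "real^'m::finite \<Rightarrow> real^'n::finite"
  assumes "open U" "x \<in> U" "C_times_on 2 U \<Phi>"
    and M: "M differentiable (at (\<Phi> x))" "transpose (M (\<Phi> x)) = M (\<Phi> x)"
    and T: "T differentiable (at x)"
    and eq: "\<And>y a b. y \<in> U \<Longrightarrow> ip (T y) a b =
        ip (M (\<Phi> y)) (frechet_derivative \<Phi> (at y) a) (frechet_derivative \<Phi> (at y) b)"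
  defines "D \<equiv> frechet_derivative \<Phi> (at x)"
  shows "koszul T x a b z = koszul M (\<Phi> x) (D a) (D b) (D z)
     + ip (M (\<Phi> x)) (frechet_derivative (\<lambda>y. frechet_derivative \<Phi> (at y) b) (at x) a) (D z)"
proof -
  define D2 where "D2 b = frechet_derivative (\<lambda>y. frechet_derivative \<Phi> (at y) b) (at x)" for b
  have DP: "(\<Phi> has_derivative D) (at x)"
    using assms(2,3) by (auto simp: D_def numeral_2_eq_2 frechet_derivative_works)
  have DD: "((\<lambda>y. frechet_derivative \<Phi> (at y) b) has_derivative D2 b) (at x)" for b
    using assms(2,3) by (auto simp: D2_def numeral_2_eq_2 frechet_derivative_works)
  have DM: "((\<lambda>y. M (\<Phi> y)) has_derivative (\<lambda>z. frechet_derivative M (at (\<Phi> x)) (D z))) (at x)"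
    using has_derivative_compose[OF DP frechet_derivative_works[THEN iffD1, OF M(1)]] .
  have DT: "ip (frechet_derivative T (at x) z) a b = ip (frechet_derivative M (at (\<Phi> x)) (D z)) (D a) (D b)
      + ip (M (\<Phi> x)) (D2 a z) (D b) + ip (M (\<Phi> x)) (D a) (D2 b z)" for z a b
  proof -
    note 1 = has_derivative_ip[OF DM DD[of a] DD[of b]]
    have "((\<lambda>y. ip (M (\<Phi> y)) (frechet_derivative \<Phi> (at y) a) (frechet_derivative \<Phi> (at y) b)) has_derivative
      (\<lambda>z. ip (frechet_derivative T (at x) z) a b)) (at x)"
      by (rule has_derivative_transform_within_open[OF ip_frechet_derivative[OF T] assms(1,2)]) (rule eq)
    from has_derivative_unique[OF this 1] show ?thesis
      by (simp add: fun_eq_iff D_def)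
  qed
  have sym: "D2 a b = D2 b a" for a b
  proof -
    have nth: "frechet_derivative (\<lambda>y. \<Phi> y $ k) (at y) v = frechet_derivative \<Phi> (at y) v $ k" if "y \<in> U" for y v k
    proof -
      have "(\<Phi> has_derivative frechet_derivative \<Phi> (at y)) (at y)"
        using assms(3) that by (auto simp: numeral_2_eq_2 frechet_derivative_works)
      from frechet_derivative_at[OF bounded_linear.has_derivative[OF bounded_linear_vec_nth this, of k]]
      show ?thesis by (simp add: fun_eq_iff)
    qed
    have nth2: "frechet_derivative (\<lambda>y. frechet_derivative (\<lambda>y. \<Phi> y $ k) (at y) b) (at x) a = D2 b a $ k" for k a b
    proof -
      have "((\<lambda>y. frechet_derivative \<Phi> (at y) b $ k) has_derivative (\<lambda>a. D2 b a $ k)) (at x)"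
        by (rule bounded_linear.has_derivative[OF bounded_linear_vec_nth DD])
      then have "((\<lambda>y. frechet_derivative (\<lambda>y. \<Phi> y $ k) (at y) b) has_derivative (\<lambda>a. D2 b a $ k)) (at x)"
        by (rule has_derivative_transform_within_open[OF _ assms(1,2)]) (simp add: nth)
      from frechet_derivative_at[OF this] show ?thesis
        by (simp add: fun_eq_iff)
    qed
    have "C_times_on 2 U (\<lambda>y. \<Phi> y $ k)" for k
      using assms(1,3) by (rule C_times_on_nth)
    from symmetric_second_derivative_real[OF assms(1,2) this, where a = a and b = b] show ?thesis
      by (simp add: nth2 vec_eq_iff)
  qed
  show ?thesis
    unfolding koszul_def DT D2_def[symmetric]
    using sym[of a b] sym[of a z] sym[of b z] ip_sym[OF M(2)]
    by (simp add: field_simps)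
qed

text \<open>The covariant derivative of S in direction v, evaluated at (v, v).\<close>

definition killing :: "(real^'m \<Rightarrow> real^'m^'m) \<Rightarrow> (real^'m \<Rightarrow> real^'m^'m) \<Rightarrow> real^'m::finite \<Rightarrow> real^'m \<Rightarrow> real" where
  "killing S G x v = ip (frechet_derivative S (at x) v) v v - 2 * ip (S x) (gam G x v v) v"

text \<open>The metric is parallel; along geodesics this becomes constancy of the speed.\<close>

lemma killing_metric: "G differentiable (at x) \<Longrightarrow> posdef (G x) \<Longrightarrow> killing G G x v = 0"
  by (simp add: killing_def ip_gam koszul_def)

text \<open>The acceleration of a geodesic is - \<open>gam\<close> of its velocity, which is exactly
  the correction from the ordinary to the covariant derivative. Symmetry of S merges the two
  acceleration terms into the factor 2 of \<open>killing\<close>.\<close>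

lemma killing_derivative:
  assumes "(x has_vector_derivative v t) (at t)" "(v has_vector_derivative - gam G (x t) (v t) (v t)) (at t)"
    and "S differentiable (at (x t))" "transpose (S (x t)) = S (x t)"
  shows "((\<lambda>s. ip (S (x s)) (v s) (v s)) has_real_derivative killing S G (x t) (v t)) (at t)"
proof -
  have x: "(x has_derivative (\<lambda>h. h *\<^sub>R v t)) (at t)"
    and v: "(v has_derivative (\<lambda>h. h *\<^sub>R (- gam G (x t) (v t) (v t)))) (at t)"
    using assms(1,2) by (auto simp: has_vector_derivative_def)
  have "((\<lambda>s. S (x s)) has_derivative (\<lambda>h. frechet_derivative S (at (x t)) (h *\<^sub>R v t))) (at t)"
    using has_derivative_compose[OF x frechet_derivative_works[THEN iffD1, OF assms(3)]] .
  from has_derivative_ip[OF this v v] show ?thesis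
    unfolding has_field_derivative_def
    by (rule has_derivative_eq_rhs)
      (use ip_sym[OF assms(4), of "v t" "gam G (x t) (v t) (v t)"] in
        \<open>simp add: fun_eq_iff killing_def linear_scale[OF linear_frechet_derivative[OF assms(3)]] ip_simps algebra_simps\<close>)
qed

section \<open>Conformal submersions in coordinates\<close>

definition pullback :: "(real^'n \<Rightarrow> real^'n^'n) \<Rightarrow> (real^'m \<Rightarrow> real^'n::finite) \<Rightarrow> real^'m::finite \<Rightarrow> real^'m^'m" where
  "pullback M \<Phi> x = (\<chi> i j. ip (M (\<Phi> x)) (frechet_derivative \<Phi> (at x) (axis i 1)) (frechet_derivative \<Phi> (at x) (axis j 1)))"

text \<open>With mu the inverse square of the dilation this is the squared length of the vertical part of a
  vector.\<close>

definition vertical_metric ::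
    "(real^'m \<Rightarrow> real^'m^'m) \<Rightarrow> (real^'n \<Rightarrow> real^'n^'n) \<Rightarrow> (real^'m \<Rightarrow> real^'n::finite) \<Rightarrow> (real^'m \<Rightarrow> real)
      \<Rightarrow> real^'m::finite \<Rightarrow> real^'m^'m" where
  "vertical_metric G M \<Phi> mu x = G x - mu x *\<^sub>R pullback M \<Phi> x"

lemma ip_pullback:
  assumes "\<Phi> differentiable (at x)"
  shows "ip (pullback M \<Phi> x) a b = ip (M (\<Phi> x)) (frechet_derivative \<Phi> (at x) a) (frechet_derivative \<Phi> (at x) b)"
proof -
  note lin = linear_frechet_derivative[OF assms]
  have "ip (M (\<Phi> x)) (frechet_derivative \<Phi> (at x) a) (frechet_derivative \<Phi> (at x) b) =
    (\<Sum>i\<in>UNIV. \<Sum>j\<in>UNIV. (a $ i * b $ j) *\<^sub>R ip (M (\<Phi> x)) (frechet_derivative \<Phi> (at x) (axis i 1)) (frechet_derivative \<Phi> (at x) (axis j 1)))"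
    by (rule bilinear_sum_axis) (auto intro!: linearI simp: linear_add[OF lin] linear_scale[OF lin] ip_simps)
  then show ?thesis
    by (subst ip_sum) (simp add: pullback_def)
qed

lemma differentiable_vec_lambda:
  fixes f :: "'i::finite \<Rightarrow> 'a::real_normed_vector \<Rightarrow> 'b::real_normed_vector"
  assumes "\<And>i. f i differentiable (at x)"
  shows "(\<lambda>y. \<chi> i. f i y) differentiable (at x)"
  unfolding vec_lambda_axis
proof (intro differentiable_sum ballI)
  fix i
  have "(f i has_derivative frechet_derivative (f i) (at x)) (at x)"
    using assms by (simp add: frechet_derivative_works)
  from bounded_linear.has_derivative[OF bounded_linear_axis this]
  show "(\<lambda>y. axis i (f i y)) differentiable (at x)"
    unfolding differentiable_def by blast
qed simp

lemma differentiable_pullback: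
  assumes "x \<in> U" "C_times_on 2 U \<Phi>" "M differentiable (at (\<Phi> x))"
  shows "pullback M \<Phi> differentiable (at x)"
proof -
  have DP: "(\<Phi> has_derivative frechet_derivative \<Phi> (at x)) (at x)"
    using assms(1,2) by (auto simp: numeral_2_eq_2 frechet_derivative_works)
  have DD: "((\<lambda>y. frechet_derivative \<Phi> (at y) b) has_derivative
      frechet_derivative (\<lambda>y. frechet_derivative \<Phi> (at y) b) (at x)) (at x)" for b
    using assms(1,2) by (auto simp: numeral_2_eq_2 frechet_derivative_works)
  have DM: "((\<lambda>y. M (\<Phi> y)) has_derivative (\<lambda>z. frechet_derivative M (at (\<Phi> x)) (frechet_derivative \<Phi> (at x) z))) (at x)"
    using has_derivative_compose[OF DP frechet_derivative_works[THEN iffD1, OF assms(3)]] .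
  show ?thesis
    unfolding pullback_def
    using has_derivative_ip[OF DM DD DD]
    by (intro differentiable_vec_lambda) (auto simp: differentiable_def)
qed

text \<open>A conformal submersion seen in one chart of each manifold. \<open>mu\<close> stands for
  the inverse square of the dilation, so that \<open>G\<close> on horizontal vectors is
  \<open>mu\<close> times the pullback of \<open>M\<close>.\<close>

locale conformal_chart =
  fixes U :: "(real^'m::finite) set" and W :: "(real^'n::finite) set"
    and G :: "real^'m \<Rightarrow> real^'m^'m" and M :: "real^'n \<Rightarrow> real^'n^'n"
    and \<Phi> :: "real^'m \<Rightarrow> real^'n" and mu :: "real^'m \<Rightarrow> real"
  assumes open_U: "open U" and maps: "\<And>x. x \<in> U \<Longrightarrow> \<Phi> x \<in> W"
    and G_diff: "\<And>x. x \<in> U \<Longrightarrow> G differentiable (at x)" and G_pos: "\<And>x. x \<in> U \<Longrightarrow> posdef (G x)"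
    and M_diff: "\<And>y. y \<in> W \<Longrightarrow> M differentiable (at y)" and M_pos: "\<And>y. y \<in> W \<Longrightarrow> posdef (M y)"
    and \<Phi>_C2: "C_times_on 2 U \<Phi>" and submersive: "\<And>x. x \<in> U \<Longrightarrow> surj (frechet_derivative \<Phi> (at x))"
    and mu_pos: "\<And>x. x \<in> U \<Longrightarrow> mu x > 0" and mu_diff: "\<And>x. x \<in> U \<Longrightarrow> mu differentiable (at x)"
    and conformal: "\<And>x X Y. x \<in> U \<Longrightarrow>
      (\<And>v. frechet_derivative \<Phi> (at x) v = 0 \<Longrightarrow> ip (G x) X v = 0) \<Longrightarrow>
      (\<And>v. frechet_derivative \<Phi> (at x) v = 0 \<Longrightarrow> ip (G x) Y v = 0) \<Longrightarrow>
      ip (G x) X Y = mu x * ip (M (\<Phi> x)) (frechet_derivative \<Phi> (at x) X) (frechet_derivative \<Phi> (at x) Y)"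
begin

abbreviation D where "D x \<equiv> frechet_derivative \<Phi> (at x)"
abbreviation h where "h \<equiv> pullback M \<Phi>"
abbreviation w where "w \<equiv> vertical_metric G M \<Phi> mu"

section \<open>Horizontal lift and horizontal projection\<close>

definition hor where "hor x u \<longleftrightarrow> (\<forall>v. D x v = 0 \<longrightarrow> ip (G x) u v = 0)"
definition lift where "lift x y = (SOME u. hor x u \<and> D x u = y)"
text \<open>The horizontal projection is factored through the base, so its trace can be read off
  from \<open>D x\<close> \<circ> \<open>lift x\<close> = \<open>id\<close>.\<close>

definition hp where "hp x v = lift x (D x v)"

lemma \<Phi>_diff: "x \<in> U \<Longrightarrow> \<Phi> differentiable (at x)"
  using \<Phi>_C2 by (auto simp: numeral_2_eq_2)

lemma linear_D: "x \<in> U \<Longrightarrow> linear (D x)"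
  using linear_frechet_derivative[OF \<Phi>_diff] .

lemma ip_h: "x \<in> U \<Longrightarrow> ip (h x) a b = ip (M (\<Phi> x)) (D x a) (D x b)"
  by (rule ip_pullback[OF \<Phi>_diff])

lemma ip_w: "x \<in> U \<Longrightarrow> ip (w x) a b = ip (G x) a b - mu x * ip (M (\<Phi> x)) (D x a) (D x b)"
  by (simp add: vertical_metric_def ip_simps ip_h)

lemma h_diff: "x \<in> U \<Longrightarrow> h differentiable (at x)"
  using differentiable_pullback[OF _ \<Phi>_C2 M_diff[OF maps]] by blast

lemma w_has_derivative:
  assumes "x \<in> U"
  shows "(w has_derivative (\<lambda>z. frechet_derivative G (at x) z -
      (frechet_derivative mu (at x) z *\<^sub>R h x + mu x *\<^sub>R frechet_derivative h (at x) z))) (at x)"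
  unfolding vertical_metric_def[abs_def]
  using G_diff[OF assms] mu_diff[OF assms] h_diff[OF assms]
  by (auto intro!: derivative_eq_intros simp: frechet_derivative_works fun_eq_iff)

lemma w_diff: "x \<in> U \<Longrightarrow> w differentiable (at x)"
  using w_has_derivative by (auto simp: differentiable_def)

lemma Dw: "x \<in> U \<Longrightarrow> frechet_derivative w (at x) z = frechet_derivative G (at x) z -
      (frechet_derivative mu (at x) z *\<^sub>R h x + mu x *\<^sub>R frechet_derivative h (at x) z)"
  by (rule fun_cong[OF frechet_derivative_at[OF w_has_derivative], symmetric])

lemma h_sym: "x \<in> U \<Longrightarrow> transpose (h x) = h x"
  using posdef_sym[OF M_pos[OF maps]] by (simp add: vec_eq_iff pullback_def transpose_def)

lemma w_sym: "x \<in> U \<Longrightarrow> transpose (w x) = w x"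
  using h_sym[of x] G_pos[of x] by (simp add: posdef_def vertical_metric_def transpose_def vec_eq_iff)

lemma hor_simps:
  "hor x a \<Longrightarrow> hor x b \<Longrightarrow> hor x (a + b)" "hor x a \<Longrightarrow> hor x b \<Longrightarrow> hor x (a - b)"
  "hor x a \<Longrightarrow> hor x (k *\<^sub>R a)"
  by (auto simp: hor_def ip_simps)

lemma hor_unique:
  assumes "x \<in> U" "hor x a" "hor x b" "D x a = D x b"
  shows "a = b"
proof -
  have "D x (a - b) = 0"
    using assms linear_D by (simp add: linear_diff)
  then have "ip (G x) (a - b) (a - b) = 0"
    using hor_simps(2)[OF assms(2,3)] by (simp add: hor_def)
  then show ?thesis
    using posdef_eq_0[OF G_pos[OF assms(1)]] by simp
qed

text \<open>J is the adjoint of D x with respect to G x and the Euclidean inner product of the base,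
  so its image is horizontal. If D x (J y) = 0, then J y has length 0, so y is orthogonal to the
  image of D x, which is everything; hence D x \<circ> J is injective and therefore onto.\<close>

lemma lift_exists:
  assumes "x \<in> U"
  shows "\<exists>u. hor x u \<and> D x u = y"
proof -
  define J where "J y = matrix_inv (G x) *v adjoint (D x) y" for y
  have J: "ip (G x) v (J y) = D x v \<bullet> y" for v y
  proof -
    have "G x *v J y = adjoint (D x) y"
      using matrix_inv_mult(1)[OF posdef_invertible[OF G_pos[OF assms]]]
      by (simp add: J_def matrix_vector_mul_assoc)
    then show ?thesis
      by (simp add: ip_def adjoint_works[OF linear_D[OF assms]])
  qed
  have "linear J"
    unfolding J_def using linear_compose[OF adjoint_linear[OF linear_D[OF assms]] matrix_vector_mul_linear]
    by (simp add: o_def)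
  then have lin: "linear (D x \<circ> J)"
    using linear_D[OF assms] by (rule linear_compose)
  have "inj (D x \<circ> J)"
    unfolding linear_injective_0[OF lin]
  proof safe
    fix y assume "(D x \<circ> J) y = 0"
    then have "J y = 0"
      using J[of "J y" y] posdef_eq_0[OF G_pos[OF assms]] by simp
    then have "D x v \<bullet> y = 0" for v
      using J[of v y] by (simp add: ip_simps)
    then show "y = 0"
      using submersive[OF assms] by (metis inner_eq_zero_iff surjD)
  qed
  then have "surj (D x \<circ> J)"
    by (rule linear_inj_imp_surj[OF lin])
  then obtain z where "y = D x (J z)"
    by (metis comp_apply surjD)
  moreover have "hor x (J z)"
    using J posdef_sym[OF G_pos[OF assms]] by (auto simp: hor_def)
  ultimately show ?thesis by blast
qed

lemma lift: "x \<in> U \<Longrightarrow> hor x (lift x y)" "x \<in> U \<Longrightarrow> D x (lift x y) = y"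
  unfolding lift_def using someI_ex[OF lift_exists] by blast+

lemma linear_lift: "x \<in> U \<Longrightarrow> linear (lift x)"
  using lift linear_D
  by (intro linearI; intro hor_unique[of x]) (auto simp: linear_add linear_scale hor_simps)

lemma linear_hp: "x \<in> U \<Longrightarrow> linear (hp x)"
  unfolding hp_def using linear_compose[OF linear_D linear_lift] by (simp add: o_def)

lemma hor_hp: "x \<in> U \<Longrightarrow> hor x (hp x v)"
  by (simp add: hp_def lift)

lemma D_hp: "x \<in> U \<Longrightarrow> D x (hp x v) = D x v"
  by (simp add: hp_def lift)

lemma vert_hp: "x \<in> U \<Longrightarrow> D x (v - hp x v) = 0"
  using linear_D by (simp add: linear_diff D_hp)

lemma hp_hor: "x \<in> U \<Longrightarrow> hor x X \<Longrightarrow> hp x X = X"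
  by (rule hor_unique[of x]) (simp_all add: hor_hp D_hp)

lemma conformal': "x \<in> U \<Longrightarrow> hor x X \<Longrightarrow> hor x Y \<Longrightarrow> ip (G x) X Y = mu x * ip (M (\<Phi> x)) (D x X) (D x Y)"
  by (rule conformal) (simp_all add: hor_def)

lemma hor_ip:
  assumes "x \<in> U" "hor x X"
  shows "ip (G x) X v = mu x * ip (M (\<Phi> x)) (D x X) (D x v)"
proof -
  have "ip (G x) X (v - hp x v) = 0"
    using assms vert_hp by (simp add: hor_def)
  then have "ip (G x) X v = ip (G x) X (hp x v)"
    by (simp add: ip_simps)
  with assms show ?thesis
    by (simp add: conformal' hor_hp D_hp)
qed

lemma w_hor: "x \<in> U \<Longrightarrow> hor x X \<Longrightarrow> ip (w x) X v = 0"
  by (simp add: ip_w hor_ip)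

lemma w_hor': "x \<in> U \<Longrightarrow> hor x X \<Longrightarrow> ip (w x) v X = 0"
  using ip_sym[OF w_sym] w_hor by metis

lemma w_vert: "x \<in> U \<Longrightarrow> D x v = 0 \<Longrightarrow> ip (w x) a v = ip (G x) a v"
  by (simp add: ip_w ip_simps)

lemma w_vertical_part: "x \<in> U \<Longrightarrow> ip (w x) v v = ip (G x) (v - hp x v) (v - hp x v)"
proof -
  assume x: "x \<in> U"
  have "ip (w x) v v = ip (w x) (v - hp x v) (v - hp x v)"
    by (simp add: ip_simps w_hor[OF x hor_hp[OF x]] w_hor'[OF x hor_hp[OF x]])
  then show ?thesis
    by (simp add: w_vert[OF x vert_hp[OF x]])
qed

lemma w_nonneg: "x \<in> U \<Longrightarrow> ip (w x) v v \<ge> 0"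
  by (simp add: w_vertical_part posdef_nonneg[OF G_pos])

lemma h_nonneg: "x \<in> U \<Longrightarrow> ip (h x) v v \<ge> 0"
  by (simp add: ip_h posdef_nonneg[OF M_pos[OF maps]])

text \<open>For a vector v that is null at x, the function S y (v, v) of y has a minimum at x, so
  its derivative vanishes there; polarization gives the mixed term. The vectors are kept constant in
  the chart and need not stay null at other points.\<close>

lemma derivative_of_semidefinite:
  assumes "x \<in> U" "S differentiable (at x)" "\<And>y. y \<in> U \<Longrightarrow> transpose (S y) = S y"
    and nonneg: "\<And>y v. y \<in> U \<Longrightarrow> ip (S y) v v \<ge> 0" and "ip (S x) a a = 0" "ip (S x) b b = 0" "ip (S x) a b = 0"
  shows "ip (frechet_derivative S (at x) z) a b = 0"
proof -
  have zero: "ip (frechet_derivative S (at x) z) v v = 0" if "ip (S x) v v = 0" for v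
  proof -
    have "(\<lambda>z. ip (frechet_derivative S (at x) z) v v) = (\<lambda>z. 0)"
      by (rule differential_zero_maxmin[OF assms(1) open_U ip_frechet_derivative[OF assms(2)]])
        (simp add: nonneg that)
    then show ?thesis by metis
  qed
  have "ip (S x) (a + b) (a + b) = 0"
    using assms ip_sym[OF assms(3)[OF assms(1)], of a b] by (simp add: ip_simps)
  from zero[OF this] zero[OF assms(5)] zero[OF assms(6)] show ?thesis
    using frechet_derivative_symmetric[OF open_U assms(1,3,2), of z a b] by (simp add: ip_simps)
qed

lemma Dw_hor:
  assumes "x \<in> U" "hor x X" "hor x Y"
  shows "ip (frechet_derivative w (at x) z) X Y = 0"
  by (rule derivative_of_semidefinite[OF assms(1) w_diff[OF assms(1)] w_sym w_nonneg])
    (simp_all add: w_hor assms)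

lemma Dh_vert:
  assumes "x \<in> U" "D x v = 0" "D x v' = 0"
  shows "ip (frechet_derivative h (at x) z) v v' = 0"
  by (rule derivative_of_semidefinite[OF assms(1) h_diff[OF assms(1)] h_sym h_nonneg])
    (simp_all add: ip_h ip_simps assms)

section \<open>The second fundamental form of the map\<close>

definition second_form where
  "second_form x a b = frechet_derivative (\<lambda>y. D y b) (at x) a + gam M (\<Phi> x) (D x a) (D x b) - D x (gam G x a b)"

lemma koszul_h:
  assumes "x \<in> U"
  shows "koszul h x a b z = koszul M (\<Phi> x) (D x a) (D x b) (D x z)
    + ip (M (\<Phi> x)) (frechet_derivative (\<lambda>y. D y b) (at x) a) (D x z)"
  using M_pos[OF maps[OF assms]]
  by (intro koszul_pullback[OF open_U assms \<Phi>_C2 M_diff[OF maps[OF assms]] _ h_diff[OF assms]])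
    (auto simp: ip_h posdef_def)

text \<open>The first two terms of \<open>second_form\<close>, paired with D x X, form the Koszul
  expression of the pullback h. In the third, horizontality of X turns the scaled pairing in the
  base into a pairing in G.\<close>

lemma second_form_koszul:
  assumes "x \<in> U" "hor x X"
  shows "mu x * ip (M (\<Phi> x)) (second_form x a b) (D x X) = mu x * koszul h x a b X - koszul G x a b X"
proof -
  have "mu x * ip (M (\<Phi> x)) (D x (gam G x a b)) (D x X) = ip (G x) (gam G x a b) X"
    using hor_ip[OF assms, of "gam G x a b"] posdef_sym[OF G_pos[OF assms(1)]]
      posdef_sym[OF M_pos[OF maps[OF assms(1)]]] by metis
  also have "\<dots> = koszul G x a b X"
    using assms by (simp add: ip_gam G_diff G_pos)
  finally show ?thesis
    using assms by (simp add: second_form_def ip_simps koszul_h ip_gam M_diff M_pos maps algebra_simps)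
qed

text \<open>By \<open>Dw_hor\<close> the derivatives of G and of mu h agree on horizontal pairs. The
  derivatives of h therefore cancel in \<open>second_form_koszul\<close>, and what remains is the
  usual conformal term with the logarithmic derivative of mu.\<close>

lemma second_form_hor:
  assumes x: "x \<in> U" and "hor x X" "hor x Y" "hor x Z"
  shows "mu x * ip (M (\<Phi> x)) (second_form x X Y) (D x Z) =
    - (frechet_derivative mu (at x) X * ip (G x) Y Z + frechet_derivative mu (at x) Y * ip (G x) X Z
       - frechet_derivative mu (at x) Z * ip (G x) X Y) / (2 * mu x)"
proof -
  have dG: "ip (frechet_derivative G (at x) z) a b =
      frechet_derivative mu (at x) z * ip (G x) a b / mu x + mu x * ip (frechet_derivative h (at x) z) a b"
    if "hor x a" "hor x b" for a b z
    using Dw_hor[OF x that, of z] mu_pos[OF x] by (simp add: Dw x ip_simps ip_h conformal'[OF x that])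
  show ?thesis
    unfolding second_form_koszul[OF x assms(4)] koszul_def dG[OF assms(3,4)] dG[OF assms(2,4)] dG[OF assms(2,3)]
    by (simp add: add_divide_distrib diff_divide_distrib algebra_simps)
qed

lemma second_form_symmetric: "x \<in> U \<Longrightarrow> hor x X \<Longrightarrow> ip (M (\<Phi> x)) (second_form x a b) (D x X) = ip (M (\<Phi> x)) (second_form x b a) (D x X)"
proof -
  assume x: "x \<in> U" and X: "hor x X"
  have "mu x * ip (M (\<Phi> x)) (second_form x a b) (D x X) = mu x * ip (M (\<Phi> x)) (second_form x b a) (D x X)"
    unfolding second_form_koszul[OF x X] koszul_def
    using frechet_derivative_symmetric[OF open_U x _ G_diff[OF x], of X a b]
      frechet_derivative_symmetric[OF open_U x h_sym h_diff[OF x], of X a b] G_pos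
    by (simp add: posdef_def algebra_simps)
  then show ?thesis
    using mu_pos[OF x] by simp
qed

lemma linear_second_form:
  assumes "x \<in> U"
  shows "linear (\<lambda>a. second_form x a b)" "linear (\<lambda>b. second_form x a b)"
proof -
  have D2: "((\<lambda>y. D y b) has_derivative frechet_derivative (\<lambda>y. D y b) (at x)) (at x)" for b
    using assms \<Phi>_C2 by (auto simp: numeral_2_eq_2 frechet_derivative_works)
  have eq: "frechet_derivative (\<lambda>y. D y b) (at x) = D2'"
    if "(f has_derivative D2') (at x)" "\<And>y. y \<in> U \<Longrightarrow> f y = D y b" for f D2' b
    using has_derivative_transform_within_open[OF that(1) open_U assms that(2)]
    by (metis frechet_derivative_at)
  have add: "frechet_derivative (\<lambda>y. D y (b + c)) (at x) = (\<lambda>z. frechet_derivative (\<lambda>y. D y b) (at x) z + frechet_derivative (\<lambda>y. D y c) (at x) z)" for b c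
    by (rule eq[OF has_derivative_add[OF D2 D2]]) (simp add: linear_add[OF linear_D])
  have scale: "frechet_derivative (\<lambda>y. D y (k *\<^sub>R b)) (at x) = (\<lambda>z. k *\<^sub>R frechet_derivative (\<lambda>y. D y b) (at x) z)" for b k
    by (rule eq[OF has_derivative_scaleR_right[OF D2]]) (simp add: linear_scale[OF linear_D])
  show "linear (\<lambda>a. second_form x a b)" "linear (\<lambda>b. second_form x a b)"
    unfolding second_form_def
    using has_derivative_linear[OF D2] linear_D[OF assms]
    by (auto intro!: linearI simp: add scale linear_add linear_scale linear_add[OF linear_gam(1)] linear_scale[OF linear_gam(1)]
      linear_add[OF linear_gam(2)] linear_scale[OF linear_gam(2)] algebra_simps)
qed

lemma killing_scaled:
  assumes x: "x \<in> U" and r: "r differentiable (at x)"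
  shows "(\<lambda>y. (r y)\<^sup>2 *\<^sub>R w y) differentiable (at x)"
    "killing (\<lambda>y. (r y)\<^sup>2 *\<^sub>R w y) G x v =
      2 * r x * frechet_derivative r (at x) v * ip (w x) v v + (r x)\<^sup>2 * killing w G x v"
proof -
  have "((\<lambda>y. (r y)\<^sup>2 *\<^sub>R w y) has_derivative
    (\<lambda>z. (2 * r x * frechet_derivative r (at x) z) *\<^sub>R w x + (r x)\<^sup>2 *\<^sub>R frechet_derivative w (at x) z)) (at x)"
    using r w_diff[OF x] by (auto intro!: derivative_eq_intros simp: frechet_derivative_works fun_eq_iff)
  then show "(\<lambda>y. (r y)\<^sup>2 *\<^sub>R w y) differentiable (at x)"
    and "killing (\<lambda>y. (r y)\<^sup>2 *\<^sub>R w y) G x v =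
      2 * r x * frechet_derivative r (at x) v * ip (w x) v v + (r x)\<^sup>2 * killing w G x v"
    by (auto simp: differentiable_def killing_def frechet_derivative_at[symmetric] ip_simps algebra_simps)
qed

end

text \<open>The Clairaut relation in infinitesimal form: the Killing equation for r^2 w at the
  single point x, in every direction. In this form the relation is transferred to the conformal
  metric.\<close>

locale clairaut_chart = conformal_chart U W G M \<Phi> mu
  for U :: "(real^'m::finite) set" and W :: "(real^'n::finite) set" and G M \<Phi> mu +
  fixes r :: "real^'m \<Rightarrow> real" and x :: "real^'m"
  assumes x: "x \<in> U" and r_pos: "r x > 0" and r_diff: "r differentiable (at x)"
    and killing: "\<And>v. killing (\<lambda>y. (r y)\<^sup>2 *\<^sub>R w y) G x v = 0"
begin

definition rho where "rho v = frechet_derivative r (at x) v / r x"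

lemma linear_rho: "linear rho"
  using linear_frechet_derivative[OF r_diff]
  by (auto intro!: linearI simp: rho_def linear_add linear_scale add_divide_distrib)

lemma cubic: "2 * rho v * ip (w x) v v + ip (frechet_derivative w (at x) v) v v - 2 * ip (w x) (gam G x v v) v = 0"
proof -
  have "(r x)\<^sup>2 * (2 * rho v * ip (w x) v v + killing w G x v) = 0"
    using killing[of v] r_pos unfolding killing_scaled(2)[OF x r_diff]
    by (simp add: rho_def power2_eq_square algebra_simps)
  then show ?thesis
    using r_pos by (simp add: killing_def)
qed

text \<open>The coefficients of \<open>s^3\<close>, \<open>s^2\<close> and \<open>s\<close> of the cubic form at the vector \<open>s V + X\<close>, compared at s = 1 and
  s = -1.\<close>

lemma polarized:
  assumes V: "D x V = 0" and X: "hor x X"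
  shows "2 * rho V * ip (G x) V V + ip (frechet_derivative w (at x) V) V V - 2 * koszul G x V V V = 0"
    and "2 * rho X * ip (G x) V V + ip (frechet_derivative w (at x) X) V V
      + 2 * ip (frechet_derivative w (at x) V) V X - 4 * koszul G x V X V = 0"
    and "ip (frechet_derivative w (at x) V) X X + 2 * ip (frechet_derivative w (at x) X) V X - 2 * koszul G x X X V = 0"
proof -
  define a where "a s t u = ip (frechet_derivative w (at x) s) t u" for s t u
  have a: "a (s + s') t u = a s t u + a s' t u" "a (s - s') t u = a s t u - a s' t u"
    "a t (s + s') u = a t s u + a t s' u" "a t (s - s') u = a t s u - a t s' u"
    "a t u (s + s') = a t u s + a t u s'" "a t u (s - s') = a t u s - a t u s'" for s s' t u
    using linear_frechet_derivative[OF w_diff[OF x]]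
    by (simp_all add: a_def ip_simps linear_add linear_diff)
  have asym: "a s X V = a s V X" for s
    unfolding a_def by (rule frechet_derivative_symmetric[OF open_U x w_sym w_diff[OF x]])
  have k: "ip (w x) (gam G x s t) V = koszul G x s t V" for s t
    using V by (simp add: w_vert x ip_gam G_diff G_pos)
  have ks: "koszul G x X V V = koszul G x V X V"
    using gam_symmetric[OF open_U x G_pos G_diff[OF x], of X V] k by metis
  note gl = linear_add[OF linear_gam(1)] linear_add[OF linear_gam(2)] linear_diff[OF linear_gam(1)] linear_diff[OF linear_gam(2)]
  note wX = w_hor[OF x X] w_hor'[OF x X] w_vert[OF x V, of V]
  \<comment> \<open>At the pure vector X the cubic form reduces to this term, because X lies in the
    kernel of w. Knowing it, and the value at V, separates the coefficients in the values at V + X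
    and V - X.\<close>
  have "a X X X = 0"
    unfolding a_def by (rule Dw_hor[OF x X X])
  moreover have p1: "2 * rho V * ip (G x) V V + a V V V - 2 * koszul G x V V V = 0"
    using cubic[of V] unfolding k a_def wX(3) .
  moreover have "2 * (rho V + rho X) * ip (G x) V V + a (V + X) (V + X) (V + X)
      - 2 * (koszul G x V V V + 2 * koszul G x V X V + koszul G x X X V) = 0"
    using cubic[of "V + X"] unfolding a_def[symmetric] ip_simps wX gl k ks linear_add[OF linear_rho] by (simp add: a)
  moreover have "2 * (rho V - rho X) * ip (G x) V V + a (V - X) (V - X) (V - X)
      - 2 * (koszul G x V V V - 2 * koszul G x V X V + koszul G x X X V) = 0"
    using cubic[of "V - X"] unfolding a_def[symmetric] ip_simps wX gl k ks linear_diff[OF linear_rho] by (simp add: a)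
  ultimately show "2 * rho V * ip (G x) V V + ip (frechet_derivative w (at x) V) V V - 2 * koszul G x V V V = 0"
    "2 * rho X * ip (G x) V V + ip (frechet_derivative w (at x) X) V V
      + 2 * ip (frechet_derivative w (at x) V) V X - 4 * koszul G x V X V = 0"
    "ip (frechet_derivative w (at x) V) X X + 2 * ip (frechet_derivative w (at x) X) V X - 2 * koszul G x X X V = 0"
    unfolding a_def[symmetric] a asym by (simp_all add: algebra_simps)
qed

lemma Dw_vert:
  assumes "D x V = 0" "D x V' = 0"
  shows "ip (frechet_derivative w (at x) z) V V' = ip (frechet_derivative G (at x) z) V V'"
  using Dh_vert[OF x assms] assms by (simp add: Dw x ip_simps ip_h)

text \<open>In the s^3 coefficient the derivative of w along V and twice the Koszul term are both
  the derivative of G on (V, V). They cancel and leave 2 rho(V) G(V, V).\<close>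

lemma rho_vert:
  assumes V: "D x V = 0"
  shows "rho V = 0"
proof (cases "V = 0")
  case False
  have "hor x 0"
    by (simp add: hor_def ip_simps)
  have "rho V * ip (G x) V V = 0"
    using polarized(1)[OF V \<open>hor x 0\<close>] Dw_vert[OF V V] by (simp add: koszul_def)
  with False show ?thesis
    using posdef_eq_0[OF G_pos[OF x]] by simp
qed (simp add: linear_0[OF linear_rho])

text \<open>Since the derivatives of w and G agree on vertical pairs, the s^2 coefficient is this
  identity for V = V'. Both sides are symmetric bilinear forms, so the diagonal determines
  them.\<close>

lemma second_form_vert:
  assumes "D x V = 0" "D x V' = 0" "hor x X"
  shows "mu x * ip (M (\<Phi> x)) (second_form x V V') (D x X) = rho X * ip (G x) V V'"
proof -
  define q where "q V V' = mu x * ip (M (\<Phi> x)) (second_form x V V') (D x X) - rho X * ip (G x) V V'" for V V'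
  have diag: "q V V = 0" if V: "D x V = 0" for V
  proof -
    have 1: "ip (frechet_derivative w (at x) V) V X = ip (frechet_derivative G (at x) V) V X - mu x * ip (frechet_derivative h (at x) V) V X"
      using V by (simp add: Dw x ip_simps ip_h)
    have 2: "koszul G x V X V = ip (frechet_derivative G (at x) X) V V / 2"
      using frechet_derivative_symmetric[OF open_U x _ G_diff[OF x], of V V X] G_pos
      by (simp add: koszul_def posdef_def)
    have 3: "koszul h x V V X = ip (frechet_derivative h (at x) V) V X"
      using Dh_vert[OF x V V] by (simp add: koszul_def)
    show ?thesis
      using polarized(2)[OF V assms(3)] Dw_vert[OF V V, of X]
      unfolding q_def second_form_koszul[OF x assms(3)] 1 2 3
      by (simp add: koszul_def field_simps)
  qed
  have sym: "q V' V = q V V'"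
    using second_form_symmetric[OF x assms(3), of V V'] posdef_sym[OF G_pos[OF x], of V V'] by (simp add: q_def)
  have "q (V + V') (V + V') = q V V + q V' V' + q V V' + q V' V"
    unfolding q_def linear_add[OF linear_second_form(1)[OF x]] linear_add[OF linear_second_form(2)[OF x]] ip_simps
    by (simp add: algebra_simps)
  then have "2 * q V V' = 0"
    using diag assms linear_add[OF linear_D[OF x]] sym by simp
  then show ?thesis by (simp add: q_def)
qed

text \<open>The s coefficient for a horizontal X with nonzero image says that dmu(V) h(X, X) is 2 mu
  times the Koszul expression of h at (X, X, V). By the pullback formula the latter is paired with D
  x V, which is 0.\<close>

lemma mu_vert:
  assumes V: "D x V = 0"
  shows "frechet_derivative mu (at x) V = 0"
proof -
  \<comment> \<open>An index type is nonempty, so the base has positive dimension; any coordinate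
    axis, lifted, will do.\<close>
  obtain X where X: "hor x X" "D x X \<noteq> 0"
  proof -
    have "D x (lift x (axis undefined 1)) = axis undefined 1"
      by (simp add: lift x)
    moreover have "(axis undefined 1 :: real^'n) \<noteq> 0"
      by (simp add: axis_eq_0_iff)
    ultimately show ?thesis
      using that[OF lift(1)[OF x]] by metis
  qed
  have 1: "ip (frechet_derivative w (at x) X) V X = ip (frechet_derivative G (at x) X) V X - mu x * ip (frechet_derivative h (at x) X) V X"
    using V by (simp add: Dw x ip_simps ip_h)
  have 2: "ip (frechet_derivative G (at x) V) X X - (frechet_derivative mu (at x) V * ip (h x) X X + mu x * ip (frechet_derivative h (at x) V) X X) = 0"
    using Dw_hor[OF x X(1) X(1), of V] by (simp add: Dw x ip_simps)
  have 3: "koszul h x X X V = 0"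
    unfolding koszul_h[OF x] V by (simp add: koszul_def ip_simps linear_0[OF linear_frechet_derivative[OF M_diff[OF maps[OF x]]]])
  have "ip (frechet_derivative G (at x) X) X V = ip (frechet_derivative G (at x) X) V X"
    "ip (frechet_derivative h (at x) X) X V = ip (frechet_derivative h (at x) X) V X"
    using frechet_derivative_symmetric[OF open_U x _ G_diff[OF x], of X V X]
      frechet_derivative_symmetric[OF open_U x h_sym h_diff[OF x], of X V X] G_pos
    by (simp_all add: posdef_def)
  then have "frechet_derivative mu (at x) V * ip (h x) X X = 2 * mu x * koszul h x X X V"
    using polarized(3)[OF V X(1)] Dw_hor[OF x X(1) X(1), of V] 1 2 by (simp add: koszul_def field_simps)
  with 3 have "frechet_derivative mu (at x) V * ip (h x) X X = 0"
    by simp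
  moreover have "ip (h x) X X \<noteq> 0"
    using X(2) posdef_eq_0[OF M_pos[OF maps[OF x]]] by (simp add: ip_h x)
  ultimately show ?thesis by simp
qed

section \<open>The trace of the second fundamental form\<close>

lemma trace_hp: "(\<Sum>i\<in>UNIV. hp x (axis i 1) $ i) = real CARD('n)"
proof -
  have DL: "D x \<circ> lift x = id"
    using lift(2)[OF x] by auto
  have "(\<Sum>i\<in>UNIV. hp x (axis i 1) $ i) = trace (matrix (lift x) ** matrix (D x))"
    by (subst matrix_compose[symmetric, OF linear_D[OF x] linear_lift[OF x]]) (simp add: trace_def matrix_def hp_def)
  also have "\<dots> = trace (matrix (D x) ** matrix (lift x))"
    by (rule trace_mul_sym)
  also have "\<dots> = trace (mat 1 :: real^'n^'n)"
    by (subst matrix_compose[symmetric, OF linear_lift[OF x] linear_D[OF x]]) (simp add: DL matrix_id_mat_1)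
  finally show ?thesis
    by (simp add: trace_I)
qed

text \<open>On the horizontal block there are two rank-one terms with trace dmu(Z) each, against
  dmu(Z) times the horizontal projection, which has trace n; together they give the factor n - 2. On
  the vertical block the form is rho(Z) times the vertical projection, which has trace m -
  n.\<close>

lemma tension:
  assumes Z: "hor x Z"
  shows "mu x * metric_trace (G x) (\<lambda>a b. ip (M (\<Phi> x)) (second_form x a b) (D x Z)) =
    (real CARD('n) - 2) / 2 * (frechet_derivative mu (at x) Z / mu x) + (real CARD('m) - real CARD('n)) * rho Z"
proof -
  define P where "P u = u - hp x u" for u
  define b where "b u v = mu x * ip (M (\<Phi> x)) (second_form x u v) (D x Z)" for u v
  let ?dmu = "frechet_derivative mu (at x)"
  note lhp = linear_hp[OF x]
  have linP: "linear P"
    unfolding P_def using lhp by (intro linear_compose_sub linear_id[unfolded id_def])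
  have hvz: "ip (G x) (hp x u) v = ip (G x) (hp x u) (hp x v)" for u v
  proof -
    have "ip (G x) (hp x u) (v - hp x v) = 0"
      using hor_hp[OF x, of u] vert_hp[OF x, of v] by (simp add: hor_def)
    then show ?thesis by (simp add: ip_simps)
  qed
  have hself: "ip (G x) (hp x u) v = ip (G x) u (hp x v)" for u v
    using hvz posdef_sym[OF G_pos[OF x]] by metis
  have Pself: "ip (G x) (P u) v = ip (G x) u (P v)" for u v
    by (simp add: P_def ip_simps hself)
  have hh: "hp x (hp x u) = hp x u" for u
    by (rule hp_hor[OF x hor_hp[OF x]])
  have PP: "P (P u) = P u" for u
    by (simp add: P_def linear_diff[OF lhp] hh)
  have linb: "linear (\<lambda>u. b u v)" "linear (\<lambda>v. b u v)" for u v
    unfolding b_def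
    by (auto intro!: linearI simp: linear_add[OF linear_second_form(1)[OF x]] linear_add[OF linear_second_form(2)[OF x]]
      linear_scale[OF linear_second_form(1)[OF x]] linear_scale[OF linear_second_form(2)[OF x]] ip_simps algebra_simps)
  have vert: "b (P u) (P v) = rho Z * ip (G x) (P u) v" for u v
    using second_form_vert[OF _ _ Z, of "P u" "P v"] vert_hp[OF x] Pself PP by (simp add: b_def P_def[symmetric])
  have horb: "b (u - P u) (v - P v) = (- 1 / (2 * mu x)) * ((?dmu (hp x u) * ip (G x) Z v + ?dmu (hp x v) * ip (G x) Z u)
     - ?dmu Z * ip (G x) (hp x u) v)" for u v
  proof -
    have "ip (G x) (hp x v) Z = ip (G x) Z v" for v
      using hself[of v Z] hp_hor[OF x Z] posdef_sym[OF G_pos[OF x]] by metis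
    then show ?thesis
      using second_form_hor[OF x hor_hp[OF x] hor_hp[OF x] Z, of u v] hvz[of u v]
      by (simp add: b_def P_def algebra_simps add_divide_distrib diff_divide_distrib)
  qed
  have ldh: "linear (\<lambda>u. ?dmu (hp x u))"
    using linear_compose[OF lhp linear_frechet_derivative[OF mu_diff[OF x]]] by (simp add: o_def)
  note G = G_pos[OF x]
  have "metric_trace (G x) (\<lambda>u v. ?dmu (hp x u) * ip (G x) Z v) = ?dmu Z"
    using metric_trace_rank_one[OF G ldh, of Z] hp_hor[OF x Z] by simp
  moreover from this have "metric_trace (G x) (\<lambda>u v. ?dmu (hp x v) * ip (G x) Z u) = ?dmu Z"
    using metric_trace_commute[OF G, of "\<lambda>u v. ?dmu (hp x u) * ip (G x) Z v"] by simp
  ultimately have tr_hor: "metric_trace (G x) (\<lambda>u v. b (u - P u) (v - P v)) =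
     (- 1 / (2 * mu x)) * ((?dmu Z + ?dmu Z) - ?dmu Z * real CARD('n))"
    unfolding horb metric_trace_simps by (simp add: metric_trace_ip[OF G] trace_hp)
  have "(\<Sum>i\<in>UNIV. P (axis i 1) $ i) = real CARD('m) - real CARD('n)"
    by (simp add: P_def sum_subtractf trace_hp)
  then have tr_vert: "metric_trace (G x) (\<lambda>u v. b (P u) (P v)) = rho Z * (real CARD('m) - real CARD('n))"
    unfolding vert metric_trace_simps by (simp add: metric_trace_ip[OF G])
  have "mu x * metric_trace (G x) (\<lambda>a b. ip (M (\<Phi> x)) (second_form x a b) (D x Z)) = metric_trace (G x) b"
    unfolding b_def[abs_def] metric_trace_simps by simp
  also have "\<dots> = rho Z * (real CARD('m) - real CARD('n)) + (- 1 / (2 * mu x)) * ((?dmu Z + ?dmu Z) - ?dmu Z * real CARD('n))"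
    unfolding metric_trace_orthogonal_split[OF G linP Pself PP linb] tr_hor tr_vert by simp
  finally show ?thesis
    using mu_pos[OF x] by (simp add: field_simps)
qed

text \<open>Every vector of the base is the image of its horizontal lift, so \<open>tension\<close>
  determines all inner products of the traced form with vectors of the base.\<close>

lemma tension_zero:
  assumes "\<And>z. (real CARD('n) - 2) / 2 * (frechet_derivative mu (at x) z / mu x)
      + (real CARD('m) - real CARD('n)) * (frechet_derivative r (at x) z / r x) = 0"
  shows "(\<Sum>i\<in>UNIV. \<Sum>j\<in>UNIV. matrix_inv (G x) $ i $ j *\<^sub>R second_form x (axis i 1) (axis j 1)) = 0"
proof (rule posdef_eqI[OF M_pos[OF maps[OF x]]])
  fix y
  have "mu x * metric_trace (G x) (\<lambda>a b. ip (M (\<Phi> x)) (second_form x a b) (D x (lift x y))) = 0"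
    unfolding tension[OF lift(1)[OF x]] using assms by (simp add: rho_def)
  then show "ip (M (\<Phi> x)) (\<Sum>i\<in>UNIV. \<Sum>j\<in>UNIV. matrix_inv (G x) $ i $ j *\<^sub>R second_form x (axis i 1) (axis j 1)) y
      = ip (M (\<Phi> x)) 0 y"
    using mu_pos[OF x]
    by (simp add: metric_trace_def lift x ip_simps linear_sum[OF linear_ip(1)])
qed

end

section \<open>Conformal change in coordinates\<close>

lemma koszul_conformal:
  assumes "\<phi> differentiable (at x)" "G differentiable (at x)"
  shows "koszul (\<lambda>y. (\<phi> y)\<^sup>2 *\<^sub>R G y) x a b c = (\<phi> x)\<^sup>2 * koszul G x a b c
    + \<phi> x * (frechet_derivative \<phi> (at x) a * ip (G x) b c + frechet_derivative \<phi> (at x) b * ip (G x) a c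
      - frechet_derivative \<phi> (at x) c * ip (G x) a b)"
proof -
  have "((\<lambda>y. (\<phi> y)\<^sup>2 *\<^sub>R G y) has_derivative
    (\<lambda>z. (2 * \<phi> x * frechet_derivative \<phi> (at x) z) *\<^sub>R G x + (\<phi> x)\<^sup>2 *\<^sub>R frechet_derivative G (at x) z)) (at x)"
    using assms by (auto intro!: derivative_eq_intros simp: frechet_derivative_works fun_eq_iff)
  from frechet_derivative_at[OF this, symmetric] show ?thesis
    by (simp add: koszul_def ip_simps field_simps)
qed

lemma (in conformal_chart) conformal_change_chart:
  assumes "\<And>x. x \<in> U \<Longrightarrow> \<phi> x > 0" "\<And>x. x \<in> U \<Longrightarrow> \<phi> differentiable (at x)"
  shows "conformal_chart U W (\<lambda>x. (\<phi> x)\<^sup>2 *\<^sub>R G x) M \<Phi> (\<lambda>x. (\<phi> x)\<^sup>2 * mu x)"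
proof
  fix x X Y
  assume "x \<in> U" "\<And>v. D x v = 0 \<Longrightarrow> ip ((\<phi> x)\<^sup>2 *\<^sub>R G x) X v = 0" "\<And>v. D x v = 0 \<Longrightarrow> ip ((\<phi> x)\<^sup>2 *\<^sub>R G x) Y v = 0"
  with conformal[of x X Y] assms(1)[of x]
  show "ip ((\<phi> x)\<^sup>2 *\<^sub>R G x) X Y = (\<phi> x)\<^sup>2 * mu x * ip (M (\<Phi> x)) (D x X) (D x Y)"
    by (simp add: ip_simps)
next
  show "(\<lambda>x. (\<phi> x)\<^sup>2 *\<^sub>R G x) differentiable at x" if "x \<in> U" for x
    using assms(2)[OF that] G_diff[OF that] by (intro differentiable_scaleR differentiable_power)
  show "(\<lambda>x. (\<phi> x)\<^sup>2 * mu x) differentiable at x" if "x \<in> U" for x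
    using assms(2)[OF that] mu_diff[OF that] by (intro differentiable_mult differentiable_power)
  show "posdef ((\<phi> x)\<^sup>2 *\<^sub>R G x)" if "x \<in> U" for x
    using assms(1)[OF that] G_pos[OF that] by (simp add: posdef_scale)
  show "(\<phi> x)\<^sup>2 * mu x > 0" if "x \<in> U" for x
    using assms(1)[OF that] mu_pos[OF that] by simp
qed (use open_U maps M_diff M_pos \<Phi>_C2 submersive in auto)

text \<open>On (v, v) the Christoffel symbols change by 2 dlog \<phi>(v) v - G(v, v) grad log
  \<phi>. By \<open>vert\<close> the gradient is horizontal, hence in the kernel of w. The remaining
  term contributes -4 dlog \<phi>(v) w(v, v) to the Killing form, up to the factor s^2, and this
  cancels the derivative of \<phi>^4.\<close>

lemma (in clairaut_chart) conformal_change_clairaut_chart: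
  assumes \<phi>: "\<And>x. x \<in> U \<Longrightarrow> \<phi> x > 0" "\<And>x. x \<in> U \<Longrightarrow> \<phi> differentiable (at x)"
    and vert: "\<And>v. D x v = 0 \<Longrightarrow> frechet_derivative \<phi> (at x) v = 0"
  shows "clairaut_chart U W (\<lambda>x. (\<phi> x)\<^sup>2 *\<^sub>R G x) M \<Phi> (\<lambda>x. (\<phi> x)\<^sup>2 * mu x) (\<lambda>x. \<phi> x * r x) x"
proof -
  let ?G = "\<lambda>x. (\<phi> x)\<^sup>2 *\<^sub>R G x" and ?mu = "\<lambda>x. (\<phi> x)\<^sup>2 * mu x"
  interpret c: conformal_chart U W ?G M \<Phi> ?mu
    by (rule conformal_change_chart[OF \<phi>])
  have cw: "c.w y = (\<phi> y)\<^sup>2 *\<^sub>R w y" for y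
    by (simp add: vertical_metric_def scaleR_diff_right)
  note D\<phi> = \<phi>(2)[OF x]
  \<comment> \<open>The new tensor (\<phi> r)^2 \<phi>^2 w equals s^2 w, so
    \<open>killing_scaled\<close> for the old metric applies with s in place of r.\<close>
  define s where "s = (\<lambda>y. (\<phi> y)\<^sup>2 * r y)"
  have s: "s differentiable (at x)" "frechet_derivative s (at x) v =
      2 * \<phi> x * frechet_derivative \<phi> (at x) v * r x + (\<phi> x)\<^sup>2 * frechet_derivative r (at x) v" for v
  proof -
    have "(s has_derivative (\<lambda>v. 2 * \<phi> x * frechet_derivative \<phi> (at x) v * r x + (\<phi> x)\<^sup>2 * frechet_derivative r (at x) v)) (at x)"
      unfolding s_def using D\<phi> r_diff by (auto intro!: derivative_eq_intros simp: frechet_derivative_works fun_eq_iff)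
    then show "s differentiable (at x)" "frechet_derivative s (at x) v =
      2 * \<phi> x * frechet_derivative \<phi> (at x) v * r x + (\<phi> x)\<^sup>2 * frechet_derivative r (at x) v"
      by (auto simp: differentiable_def frechet_derivative_at[symmetric])
  qed
  have S: "(\<lambda>y. (\<phi> y * r y)\<^sup>2 *\<^sub>R c.w y) = (\<lambda>y. (s y)\<^sup>2 *\<^sub>R w y)"
    unfolding cw by (simp add: s_def power2_eq_square mult_ac)
  have gam: "ip (w x) (gam ?G x v v) v = ip (w x) (gam G x v v) v + 2 * frechet_derivative \<phi> (at x) v / \<phi> x * ip (w x) v v" for v
  proof -
    define p where "p = v - hp x v"
    have p: "D x p = 0"
      unfolding p_def by (rule vert_hp[OF x])
    have wp: "ip (w x) a v = ip (G x) a p" for a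
    proof -
      have "ip (w x) a v = ip (w x) a p"
        by (simp add: p_def ip_simps w_hor'[OF x hor_hp[OF x]])
      then show ?thesis
        by (simp add: w_vert[OF x p])
    qed
    have "(\<phi> x)\<^sup>2 * ip (G x) (gam ?G x v v) p = koszul ?G x v v p"
      using ip_gam[OF c.G_diff[OF x] c.G_pos[OF x], of v v p] by (simp add: ip_simps)
    also have "\<dots> = (\<phi> x)\<^sup>2 * ip (G x) (gam G x v v) p + 2 * \<phi> x * frechet_derivative \<phi> (at x) v * ip (G x) v p"
      unfolding koszul_conformal[OF D\<phi> G_diff[OF x]]
      by (simp add: vert[OF p] ip_gam G_diff G_pos x)
    finally have "\<phi> x * (\<phi> x * ip (G x) (gam ?G x v v) p - \<phi> x * ip (G x) (gam G x v v) p
        - 2 * frechet_derivative \<phi> (at x) v * ip (G x) v p) = 0"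
      by (simp add: algebra_simps power2_eq_square)
    with \<phi>(1)[OF x] have "\<phi> x * ip (G x) (gam ?G x v v) p - \<phi> x * ip (G x) (gam G x v v) p
        - 2 * frechet_derivative \<phi> (at x) v * ip (G x) v p = 0"
      unfolding mult_eq_0_iff by simp
    then show ?thesis
      unfolding wp using \<phi>(1)[OF x] by (simp add: field_simps)
  qed
  show ?thesis
  proof (unfold_locales)
    fix v
    have "killing (\<lambda>y. (s y)\<^sup>2 *\<^sub>R w y) ?G x v = killing (\<lambda>y. (s y)\<^sup>2 *\<^sub>R w y) G x v
       - 4 * (s x)\<^sup>2 * (frechet_derivative \<phi> (at x) v / \<phi> x) * ip (w x) v v"
      by (simp add: killing_def ip_simps gam algebra_simps)
    also have "\<dots> = (\<phi> x)^4 * killing (\<lambda>y. (r y)\<^sup>2 *\<^sub>R w y) G x v"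
      unfolding killing_scaled(2)[OF x s(1)] killing_scaled(2)[OF x r_diff] s(2)
      using \<phi>(1)[OF x] by (simp add: s_def field_simps power2_eq_square power4_eq_xxxx)
    finally show "killing (\<lambda>y. (\<phi> y * r y)\<^sup>2 *\<^sub>R c.w y) ?G x v = 0"
      by (simp add: S killing)
  qed (use x \<phi> r_pos r_diff D\<phi> in auto)
qed

section \<open>Existence of geodesics\<close>

text \<open>Cramer's rule expresses an entry of the inverse as a quotient of determinants, which are
  polynomials in the entries.\<close>

lemma C_times_on_matrix_inv:
  fixes G :: "'a::real_normed_vector \<Rightarrow> real^'m::finite^'m"
  assumes "open S" "C_times_on n S G" "\<And>x. x \<in> S \<Longrightarrow> invertible (G x)"
  shows "C_times_on n S (\<lambda>x. matrix_inv (G x) $ k $ l)"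
proof -
  define N where "N x = det (\<chi> i j. if j = k then axis l 1 $ i else G x $ i $ j)" for x
  have entry: "C_times_on n S (\<lambda>x. G x $ i $ j)" for i j
    using assms(1,2) by (intro C_times_on_nth)
  have det: "C_times_on n S (\<lambda>x. det (G x))"
    by (rule C_times_on_det[OF assms(1) entry])
  have N: "C_times_on n S N"
    unfolding N_def
  proof (rule C_times_on_det[OF assms(1)])
    show "C_times_on n S (\<lambda>x. (\<chi> i j. if j = k then axis l 1 $ i else G x $ i $ j) $ i $ j)" for i j
      by (cases "j = k") (simp_all add: entry)
  qed
  have det0: "det (G x) \<noteq> 0" if "x \<in> S" for x
    using assms(3)[OF that] by (simp add: invertible_det_nz)
  \<comment> \<open>The determinant may be negative while \<open>C_times_on_powr\<close> asks for a
    positive base, so its reciprocal is written as the determinant times the inverse of its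
    square.\<close>
  have eq: "N x * (det (G x) * (det (G x) * det (G x)) powr (-1)) = matrix_inv (G x) $ k $ l" if "x \<in> S" for x
  proof -
    have "G x *v (matrix_inv (G x) *v axis l 1) = axis l 1"
      using matrix_inv_mult(1)[OF assms(3)[OF that]] by (simp add: matrix_vector_mul_assoc)
    then have "matrix_inv (G x) *v axis l 1 = (\<chi> k. det (\<chi> i j. if j = k then axis l 1 $ i else G x $ i $ j) / det (G x))"
      using cramer[OF det0[OF that]] by blast
    then have "(matrix_inv (G x) *v axis l 1) $ k = N x / det (G x)"
      by (simp add: N_def)
    moreover have "(matrix_inv (G x) *v axis l 1) $ k = matrix_inv (G x) $ k $ l"
      by (simp add: matrix_vector_mul_component inner_axis)
    ultimately show ?thesis
      using det0[OF that] by (simp add: powr_minus field_simps)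
  qed
  show ?thesis
  proof (rule C_times_on_cong[OF assms(1) eq])
    have "det (G x) * det (G x) > 0" if "x \<in> S" for x
      using det0[OF that] by (metis not_real_square_gt_zero)
    then show "C_times_on n S (\<lambda>x. N x * (det (G x) * (det (G x) * det (G x)) powr (-1)))"
      by (intro C_times_on_mult C_times_on_powr assms(1) N det)
  qed
qed

lemma C_times_on_christ:
  assumes "open S" "C_times_on (Suc n) S G" "\<And>x. x \<in> S \<Longrightarrow> invertible (G x)"
  shows "C_times_on n S (\<lambda>x. christ G x k i j)"
proof -
  have "C_times_on (Suc n) S (\<lambda>x. G x $ j $ l)" for j l
    using assms(1,2) by (intro C_times_on_nth)
  then have "C_times_on n S (partial i (\<lambda>x. G x $ j $ l))" for i j l
    unfolding partial_def by simp
  moreover have "C_times_on n S (\<lambda>x. matrix_inv (G x) $ k $ l)" for l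
    using C_times_on_matrix_inv[OF assms(1) C_times_on_SucD[OF assms(2)] assms(3)] .
  moreover have eq: "christ G x k i j = (\<Sum>l\<in>UNIV. matrix_inv (G x) $ k $ l *
     ((1/2) * (partial i (\<lambda>y. G y $ j $ l) x + partial j (\<lambda>y. G y $ i $ l) x + (- 1) * partial l (\<lambda>y. G y $ i $ j) x)))" for x
    by (simp add: christ_def sum_divide_distrib)
  ultimately show ?thesis
    unfolding eq by (intro C_times_on_sum C_times_on_mult C_times_on_add C_times_on_const assms(1)) auto
qed

text \<open>The geodesic equation as a first-order system in positions and velocities. Zero
  velocities are excluded from the open phase space, so the solution is regular on its whole
  interval.\<close>

lemma geodesic_spray_flow:
  fixes G :: "real^'m::finite \<Rightarrow> real^'m^'m"
  assumes "open U" "C_times_on 2 U G" "\<And>x. x \<in> U \<Longrightarrow> posdef (G x)" "x0 \<in> U" "v0 \<noteq> 0"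
  obtains T x v where "T > 0" "x 0 = x0" "v 0 = v0"
    "\<And>t. t \<in> {-T<..<T} \<Longrightarrow> x t \<in> U \<and> v t \<noteq> 0 \<and> (x has_vector_derivative v t) (at t) \<and>
       (v has_vector_derivative - gam G (x t) (v t) (v t)) (at t)"
proof -
  define S where "S = U \<times> (- {0 :: real^'m})"
  have "open S"
    unfolding S_def using assms(1) by (intro open_Times) auto
  define H where "H z = (snd z, - gam G (fst z) (snd z) (snd z))" for z :: "(real^'m) \<times> (real^'m)"
  have "C_times_on 1 (fst -` U) (\<lambda>z. christ G (fst z) k i j)" for k i j
    using assms posdef_invertible
    by (intro C_times_on_compose_linear[OF bounded_linear_fst] C_times_on_christ) (auto simp: numeral_2_eq_2)
  then have chr: "C_times_on 1 S (\<lambda>z. christ G (fst z) k i j)" for k i j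
    by (rule C_times_on_subset) (auto simp: S_def)
  have snd: "C_times_on 1 S (\<lambda>z. snd z $ i)" for i
    by (rule C_times_on_linear, rule bounded_linear_compose[OF bounded_linear_vec_nth bounded_linear_snd])
  have "C_times_on 1 S (\<lambda>z. gam G (fst z) (snd z) (snd z))"
    unfolding gam_def
    by (intro C_times_on_vec_lambda C_times_on_sum C_times_on_mult chr snd \<open>open S\<close>)
  then have "C_times_on 1 S (\<lambda>z. (0 :: real^'m, - gam G (fst z) (snd z) (snd z)))"
    by (rule C_times_on_bounded_linear[rotated 2])
      (auto intro!: bounded_linear_Pair bounded_linear_zero bounded_linear_minus bounded_linear_ident \<open>open S\<close>)
  moreover have "C_times_on 1 S (\<lambda>z. (snd z, 0 :: real^'m))"
    by (intro C_times_on_linear bounded_linear_Pair bounded_linear_snd bounded_linear_zero)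
  ultimately have "C_times_on 1 S (\<lambda>z. (0 :: real^'m, - gam G (fst z) (snd z) (snd z)) + (snd z, 0))"
    by (rule C_times_on_add[OF \<open>open S\<close>])
  then have "C_times_on 1 S H"
    by (simp add: H_def[abs_def])
  moreover have "(x0, v0) \<in> S"
    using assms by (simp add: S_def)
  ultimately obtain T z where T: "T > 0" "z 0 = (x0, v0)"
    "\<And>t. t \<in> {-T<..<T} \<Longrightarrow> z t \<in> S \<and> (z has_vector_derivative H (z t)) (at t)"
    using local_flow_exists[OF \<open>open S\<close>] by metis
  show ?thesis
  proof
    show "T > 0" "fst (z 0) = x0" "snd (z 0) = v0"
      using T by auto
    fix t assume t: "t \<in> {-T<..<T}"
    have z: "(z has_vector_derivative H (z t)) (at t)"
      using T(3)[OF t] by blast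
    show "fst (z t) \<in> U \<and> snd (z t) \<noteq> 0 \<and> ((\<lambda>t. fst (z t)) has_vector_derivative snd (z t)) (at t) \<and>
       ((\<lambda>t. snd (z t)) has_vector_derivative - gam G (fst (z t)) (snd (z t)) (snd (z t))) (at t)"
      using T(3)[OF t] bounded_linear.has_vector_derivative[OF bounded_linear_fst z]
        bounded_linear.has_vector_derivative[OF bounded_linear_snd z]
      by (auto simp: S_def H_def)
  qed
qed

text \<open>Both the base point and the vector move. Only the directional derivatives of \<psi> are
  known to be differentiable, so the vector is expanded in the standard basis with scalar
  coefficients depending on time.\<close>

lemma has_vector_derivative_velocity_image:
  fixes \<psi> :: "real^'m::finite \<Rightarrow> real^'k::finite"
  assumes "x t \<in> U" "open U" "C_times_on 2 U \<psi>"
    and x: "(x has_vector_derivative v t) (at t)" and v: "(v has_vector_derivative a) (at t)"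
  shows "((\<lambda>s. frechet_derivative \<psi> (at (x s)) (v s)) has_vector_derivative
     frechet_derivative \<psi> (at (x t)) a + frechet_derivative (\<lambda>y. frechet_derivative \<psi> (at y) (v t)) (at (x t)) (v t)) (at t)"
proof -
  have lin: "linear (frechet_derivative \<psi> (at y))" if "y \<in> U" for y
    using assms(3) that by (auto intro!: linear_frechet_derivative simp: numeral_2_eq_2)
  define D2 where "D2 b = frechet_derivative (\<lambda>y. frechet_derivative \<psi> (at y) b) (at (x t))" for b
  have DD: "((\<lambda>y. frechet_derivative \<psi> (at y) b) has_derivative D2 b) (at (x t))" for b
    using assms(1,3) by (auto simp: D2_def numeral_2_eq_2 frechet_derivative_works)
  have D2: "D2 b = (\<lambda>z. \<Sum>i\<in>UNIV. b $ i *\<^sub>R D2 (axis i 1) z)" for b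
  proof -
    have "((\<lambda>y. \<Sum>i\<in>UNIV. b $ i *\<^sub>R frechet_derivative \<psi> (at y) (axis i 1)) has_derivative
        (\<lambda>z. \<Sum>i\<in>UNIV. b $ i *\<^sub>R D2 (axis i 1) z)) (at (x t))"
      by (intro has_derivative_sum has_derivative_scaleR_right DD)
    then have "((\<lambda>y. frechet_derivative \<psi> (at y) b) has_derivative
        (\<lambda>z. \<Sum>i\<in>UNIV. b $ i *\<^sub>R D2 (axis i 1) z)) (at (x t))"
      by (rule has_derivative_transform_within_open[OF _ assms(2,1)])
        (rule linear_sum_axis[OF lin, symmetric])
    then show ?thesis
      by (rule has_derivative_unique[OF DD])
  qed
  have comp: "((\<lambda>s. frechet_derivative \<psi> (at (x s)) b) has_vector_derivative D2 b (v t)) (at t)" for b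
  proof -
    have "((\<lambda>s. frechet_derivative \<psi> (at (x s)) b) has_derivative (\<lambda>h. D2 b (h *\<^sub>R v t))) (at t)"
      using has_derivative_compose[OF x[unfolded has_vector_derivative_def] DD] .
    then show ?thesis
      by (simp add: has_vector_derivative_def linear_scale[OF has_derivative_linear[OF DD]])
  qed
  have nth: "((\<lambda>s. v s $ i) has_vector_derivative a $ i) (at t)" for i
    by (rule bounded_linear.has_vector_derivative[OF bounded_linear_vec_nth v])
  have sum: "((\<lambda>s. \<Sum>i\<in>UNIV. v s $ i *\<^sub>R frechet_derivative \<psi> (at (x s)) (axis i 1)) has_vector_derivative
     (\<Sum>i\<in>UNIV. v t $ i *\<^sub>R D2 (axis i 1) (v t) + a $ i *\<^sub>R frechet_derivative \<psi> (at (x t)) (axis i 1))) (at t)"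
    by (intro has_vector_derivative_sum has_vector_derivative_scaleR[OF nth[unfolded has_real_derivative_iff_has_vector_derivative[symmetric]] comp])
  have "isCont x t"
    using x by (rule has_vector_derivative_continuous)
  then have "\<forall>\<^sub>F s in at t. x s \<in> U"
    using assms(1,2) by (auto simp: isCont_def dest: topological_tendstoD)
  moreover have "(\<Sum>i\<in>UNIV. v s $ i *\<^sub>R frechet_derivative \<psi> (at (x s)) (axis i 1)) = frechet_derivative \<psi> (at (x s)) (v s)"
    if "x s \<in> U" for s
    by (rule linear_sum_axis[OF lin[OF that], symmetric])
  ultimately have ev: "\<forall>\<^sub>F s in at t. (\<Sum>i\<in>UNIV. v s $ i *\<^sub>R frechet_derivative \<psi> (at (x s)) (axis i 1)) = frechet_derivative \<psi> (at (x s)) (v s)"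
    by (auto elim: eventually_mono)
  have rhs: "(\<Sum>i\<in>UNIV. v t $ i *\<^sub>R D2 (axis i 1) (v t) + a $ i *\<^sub>R frechet_derivative \<psi> (at (x t)) (axis i 1)) =
      frechet_derivative \<psi> (at (x t)) a + D2 (v t) (v t)"
    using linear_sum_axis[OF lin[OF assms(1)], of a] fun_cong[OF D2[of "v t"], of "v t"]
    by (simp add: sum.distrib)
  show ?thesis
    using sum unfolding rhs D2_def[symmetric] has_vector_derivative_def
    by (rule has_derivative_transform_eventually[OF _ ev])
      (simp_all add: linear_sum_axis[OF lin[OF assms(1)], symmetric])
qed

section \<open>Changes of charts\<close>

lemma atlas_chart:
  assumes "smooth_atlas A" "c \<in> A"
  shows "open (fst c)" "open (snd c ` fst c)"
    and "p \<in> fst c \<Longrightarrow> param c (snd c p) = p"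
    and "y \<in> snd c ` fst c \<Longrightarrow> snd c (param c y) = y" "y \<in> snd c ` fst c \<Longrightarrow> param c y \<in> fst c"
    and "continuous_on (fst c) (snd c)" "continuous_on (snd c ` fst c) (param c)"
  using assms by (auto simp: smooth_atlas_def homeomorphism_def)

lemma open_chart_image:
  assumes "smooth_atlas A" "c \<in> A" "open X"
  shows "open (snd c ` (fst c \<inter> X))"
proof -
  note c = atlas_chart[OF assms(1,2)]
  have "snd c ` (fst c \<inter> X) = snd c ` fst c \<inter> param c -` X"
    using c(3,4,5) by (auto intro!: rev_image_eqI)
  moreover have "open (snd c ` fst c \<inter> param c -` X)"
    by (rule continuous_open_preimage[OF c(7,2) assms(3)])
  ultimately show ?thesis by simp
qed

lemma christoffel_christ:
  "param c (snd c p) = p \<Longrightarrow> christoffel g c p k i j = christ (g c \<circ> param c) (snd c p) k i j"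
  by (simp add: christoffel_def christ_def)

lemma gam_christoffel:
  "param c (snd c p) = p \<Longrightarrow>
   (\<chi> k. - (\<Sum>i\<in>UNIV. \<Sum>j\<in>UNIV. christoffel g c p k i j * u $ i * v $ j)) = - gam (g c \<circ> param c) (snd c p) u v"
  by (simp add: gam_def christoffel_christ vec_eq_iff)

lemma riemannian_chart:
  assumes "riemannian_manifold A g" "c \<in> A"
  shows "C_times_on n (snd c ` fst c) (g c \<circ> param c)"
    and "x \<in> snd c ` fst c \<Longrightarrow> posdef ((g c \<circ> param c) x)"
    and "x \<in> snd c ` fst c \<Longrightarrow> (g c \<circ> param c) differentiable (at x)"
proof -
  show C: "C_times_on n (snd c ` fst c) (g c \<circ> param c)" for n
    using assms by (simp add: riemannian_manifold_def smooth_on_def)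
  show "x \<in> snd c ` fst c \<Longrightarrow> (g c \<circ> param c) differentiable (at x)"
    by (rule C_times_on_imp_differentiable[OF C])
  have "smooth_atlas A"
    using assms by (simp add: riemannian_manifold_def)
  then show "x \<in> snd c ` fst c \<Longrightarrow> posdef ((g c \<circ> param c) x)"
    using assms atlas_chart(5)[of A c x] unfolding riemannian_manifold_def posdef_def o_apply by blast
qed

locale chart_change =
  fixes A :: "('a::{t2_space, second_countable_topology}, 'm::finite) chart set" and g :: "('a, 'm) metric" and c d
  assumes riem: "riemannian_manifold A g" and c: "c \<in> A" and d: "d \<in> A"
begin

abbreviation \<psi> where "\<psi> \<equiv> snd d \<circ> param c"
abbreviation U where "U \<equiv> snd c ` (fst c \<inter> fst d)"
abbreviation D where "D x \<equiv> frechet_derivative \<psi> (at x)"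

lemma atlas: "smooth_atlas A"
  using riem by (simp add: riemannian_manifold_def)

lemma open_U: "open U"
  by (rule open_chart_image[OF atlas c atlas_chart(1)[OF atlas d]])

lemma \<psi>_smooth: "C_times_on n U \<psi>"
  using atlas c d by (simp add: smooth_atlas_def smooth_on_def)

lemma \<psi>_diff: "x \<in> U \<Longrightarrow> \<psi> differentiable (at x)"
  by (rule C_times_on_imp_differentiable[OF \<psi>_smooth])

lemma in_charts: "x \<in> U \<Longrightarrow> x \<in> snd c ` fst c \<and> \<psi> x \<in> snd d ` fst d \<and> param d (\<psi> x) = param c x"
  using atlas_chart(3)[OF atlas c] atlas_chart(3)[OF atlas d] by auto

lemma metric_change: "x \<in> U \<Longrightarrow> ip ((g c \<circ> param c) x) a b = ip ((g d \<circ> param d) (\<psi> x)) (D x a) (D x b)"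
proof -
  assume "x \<in> U"
  then obtain p where p: "x = snd c p" "p \<in> fst c \<inter> fst d"
    by blast
  have pp: "param c x = p" "param d (\<psi> x) = p"
    using p atlas_chart(3)[OF atlas c] atlas_chart(3)[OF atlas d] by auto
  have "ip (g c p) a b = ip (g d p) (differential c d id p a) (differential c d id p b)"
    using riem c d p(2) unfolding riemannian_manifold_def by blast
  then show ?thesis
    using pp by (simp add: differential_def local_rep_def p(1)[symmetric])
qed

text \<open>By the transformation law of the metric the differential of a transition map preserves
  lengths, so the inverse transition map does not have to be differentiated.\<close>

lemma D_nonzero: "x \<in> U \<Longrightarrow> v \<noteq> 0 \<Longrightarrow> D x v \<noteq> 0"
proof
  assume x: "x \<in> U" and "v \<noteq> 0" "D x v = 0"
  then have "ip ((g c \<circ> param c) x) v v = 0"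
    unfolding metric_change[OF x] by (simp add: ip_simps)
  then show False
    using posdef_eq_0[OF riemannian_chart(2)[OF riem c]] in_charts[OF x] \<open>v \<noteq> 0\<close> by blast
qed

lemma surj_D: "x \<in> U \<Longrightarrow> surj (D x)"
proof -
  assume x: "x \<in> U"
  have lin: "linear (D x)"
    by (rule linear_frechet_derivative[OF \<psi>_diff[OF x]])
  then have "inj (D x)"
    using D_nonzero[OF x] by (auto simp: linear_injective_0)
  with lin show ?thesis
    by (rule linear_inj_imp_surj)
qed

text \<open>The transition map is an isometry, so \<open>koszul_pullback\<close> gives the classical
  transformation law after pairing with vectors D x w; these are all vectors because D x is
  onto.\<close>

lemma gam_change:
  assumes x: "x \<in> U"
  shows "D x (gam (g c \<circ> param c) x a b) = gam (g d \<circ> param d) (\<psi> x) (D x a) (D x b)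
    + frechet_derivative (\<lambda>y. D y b) (at x) a"
proof (rule posdef_eqI)
  note x' = in_charts[OF x, THEN conjunct1] in_charts[OF x, THEN conjunct2, THEN conjunct1]
  let ?G = "g c \<circ> param c" and ?M = "g d \<circ> param d"
  note G = riemannian_chart(2,3)[OF riem c x'(1)] and M = riemannian_chart(2,3)[OF riem d x'(2)]
  show "posdef (?M (\<psi> x))"
    by (rule M)
  fix z
  obtain w where w: "z = D x w"
    using surj_D[OF x] by blast
  have "ip (?M (\<psi> x)) (D x (gam ?G x a b)) z = ip (?G x) (gam ?G x a b) w"
    unfolding w by (rule metric_change[OF x, symmetric])
  also have "\<dots> = koszul ?G x a b w"
    by (rule ip_gam[OF G(2,1)])
  also have "\<dots> = koszul ?M (\<psi> x) (D x a) (D x b) (D x w) + ip (?M (\<psi> x)) (frechet_derivative (\<lambda>y. D y b) (at x) a) (D x w)"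
    using M(1) by (intro koszul_pullback[OF open_U x \<psi>_smooth M(2) _ G(2) metric_change]) (simp_all add: posdef_def)
  finally show "ip (?M (\<psi> x)) (D x (gam ?G x a b)) z = ip (?M (\<psi> x)) (gam ?M (\<psi> x) (D x a) (D x b)
      + frechet_derivative (\<lambda>y. D y b) (at x) a) z"
    by (simp only: w ip_simps ip_gam[OF M(2,1)])
qed

lemma velocity_change:
  assumes "\<alpha> t \<in> fst c \<inter> fst d" "isCont \<alpha> t" "((snd c \<circ> \<alpha>) has_vector_derivative v) (at t)"
  shows "((snd d \<circ> \<alpha>) has_vector_derivative D (snd c (\<alpha> t)) v) (at t)"
proof -
  have "snd c (\<alpha> t) \<in> U"
    using assms(1) by blast
  then have D: "(\<psi> has_derivative D ((snd c \<circ> \<alpha>) t)) (at ((snd c \<circ> \<alpha>) t))"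
    using \<psi>_diff by (simp add: frechet_derivative_works)
  have "(\<psi> \<circ> (snd c \<circ> \<alpha>) has_vector_derivative D ((snd c \<circ> \<alpha>) t) v) (at t)"
    using diff_chain_at[OF assms(3)[unfolded has_vector_derivative_def] D] linear_scale[OF has_derivative_linear[OF D]]
    by (simp add: has_vector_derivative_def o_def)
  moreover have "\<forall>\<^sub>F s in nhds t. (\<psi> \<circ> (snd c \<circ> \<alpha>)) s = (snd d \<circ> \<alpha>) s"
  proof -
    have "\<forall>\<^sub>F s in nhds t. \<alpha> s \<in> fst c"
      using assms(1,2) atlas_chart(1)[OF atlas c]
      by (auto simp: isCont_def tendsto_at_iff_tendsto_nhds dest: topological_tendstoD)
    then show ?thesis
      using atlas_chart(3)[OF atlas c] by (auto elim: eventually_mono)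
  qed
  moreover from this have "(\<psi> \<circ> (snd c \<circ> \<alpha>)) t = (snd d \<circ> \<alpha>) t"
    by (rule eventually_nhds_x_imp_x)
  ultimately show ?thesis
    by (subst has_vector_derivative_cong_ev[where S = UNIV and g = "\<psi> \<circ> (snd c \<circ> \<alpha>)"])
      (auto elim: eventually_mono)
qed

end

text \<open>The equation is solved in the chart c only. A geodesic has to satisfy it in every chart
  that the curve meets, which follows from the transformation law of \<open>gam\<close>.\<close>

lemma geodesic_exists:
  fixes A :: "('a::{t2_space, second_countable_topology}, 'm::finite) chart set"
  assumes riem: "riemannian_manifold A g" and c: "c \<in> A" and p: "p \<in> fst c" and v0: "v0 \<noteq> 0"
  obtains T \<alpha> where "T > 0" "regular_geodesic_on A g {-T<..<T} \<alpha>" "\<alpha> 0 = p" "velocity c \<alpha> 0 = v0"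
proof -
  have atlas: "smooth_atlas A"
    using riem by (simp add: riemannian_manifold_def)
  note cc = atlas_chart[OF atlas c]
  let ?G = "g c \<circ> param c"
  obtain T x v where T: "T > 0" "x 0 = snd c p" "v 0 = v0" and
    flow: "\<And>t. t \<in> {-T<..<T} \<Longrightarrow> x t \<in> snd c ` fst c \<and> v t \<noteq> 0 \<and> (x has_vector_derivative v t) (at t) \<and>
       (v has_vector_derivative - gam ?G (x t) (v t) (v t)) (at t)"
    using geodesic_spray_flow[OF cc(2) riemannian_chart(1,2)[OF riem c] _ v0] p by blast
  define \<alpha> where "\<alpha> = param c \<circ> x"
  have \<alpha>: "\<alpha> t \<in> fst c" "snd c (\<alpha> t) = x t" if "t \<in> {-T<..<T}" for t
    using flow[OF that] cc(4,5) by (auto simp: \<alpha>_def)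
  have contx: "continuous_on {-T<..<T} x"
    using flow by (intro continuous_at_imp_continuous_on ballI) (blast intro: has_vector_derivative_continuous)
  have cont: "continuous_on {-T<..<T} \<alpha>"
    unfolding \<alpha>_def using flow by (intro continuous_on_compose contx continuous_on_subset[OF cc(7)]) auto
  have isCont: "isCont \<alpha> t" if "t \<in> {-T<..<T}" for t
    using cont that by (simp add: continuous_on_eq_continuous_at)
  have vel: "((snd c \<circ> \<alpha>) has_vector_derivative v t) (at t)" if "t \<in> {-T<..<T}" for t
  proof (rule has_vector_derivative_transform_within_open[where f = x, OF _ open_greaterThanLessThan that])
    show "(x has_vector_derivative v t) (at t)"
      using flow[OF that] by blast
    show "x s = (snd c \<circ> \<alpha>) s" if "s \<in> {-T<..<T}" for s
      by (simp add: \<alpha>(2)[OF that])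
  qed
  have key: "((snd d \<circ> \<alpha>) has_vector_derivative frechet_derivative (snd d \<circ> param c) (at (x t)) (v t)) (at t)"
    "velocity d \<alpha> t = frechet_derivative (snd d \<circ> param c) (at (x t)) (v t)" "velocity d \<alpha> t \<noteq> 0"
    if "d \<in> A" "t \<in> {-T<..<T}" "\<alpha> t \<in> fst d" for d t
  proof -
    interpret chart_change A g c d
      using riem c that(1) by unfold_locales
    have x: "x t \<in> U"
      using that \<alpha>[OF that(2)] by force
    show 1: "((snd d \<circ> \<alpha>) has_vector_derivative D (x t) (v t)) (at t)"
      using velocity_change[OF _ isCont[OF that(2)] vel[OF that(2)]] that \<alpha>[OF that(2)] by simp
    then show 2: "velocity d \<alpha> t = D (x t) (v t)"
      unfolding velocity_def by (rule vector_derivative_at)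
    show "velocity d \<alpha> t \<noteq> 0"
      unfolding 2 using flow[OF that(2)] D_nonzero[OF x] by blast
  qed
  have geo: "(velocity d \<alpha> has_vector_derivative - gam (g d \<circ> param d) (snd d (\<alpha> t)) (velocity d \<alpha> t) (velocity d \<alpha> t)) (at t)"
    if "d \<in> A" "t \<in> {-T<..<T}" "\<alpha> t \<in> fst d" for d t
  proof -
    interpret chart_change A g c d
      using riem c that(1) by unfold_locales
    have x: "x t \<in> U"
      using that \<alpha>[OF that(2)] by force
    note fl = flow[OF that(2)]
    have op: "open ({-T<..<T} \<inter> \<alpha> -` fst d)"
      by (rule continuous_open_preimage[OF cont _ atlas_chart(1)[OF atlas that(1)]]) simp
    have "((\<lambda>s. D (x s) (v s)) has_vector_derivative
        D (x t) (- gam ?G (x t) (v t) (v t)) + frechet_derivative (\<lambda>y. D y (v t)) (at (x t)) (v t)) (at t)"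
      by (rule has_vector_derivative_velocity_image[where x = x and v = v and t = t, OF x open_U \<psi>_smooth])
        (use fl in blast)+
    \<comment> \<open>By \<open>gam_change\<close> the second derivative of the transition map
      cancels, and the geodesic equation of the chart d is left.\<close>
    then have dv: "((\<lambda>s. D (x s) (v s)) has_vector_derivative - gam (g d \<circ> param d) (\<psi> (x t)) (D (x t) (v t)) (D (x t) (v t))) (at t)"
      using linear_frechet_derivative[OF \<psi>_diff[OF x]] by (simp add: linear_neg gam_change[OF x])
    have "(velocity d \<alpha> has_vector_derivative - gam (g d \<circ> param d) (\<psi> (x t)) (D (x t) (v t)) (D (x t) (v t))) (at t)"
      by (rule has_vector_derivative_transform_within_open[OF dv op]) (use that key(2)[OF that(1)] in simp_all)
    then show ?thesis
      using key(2)[OF that] \<alpha>[OF that(2)] by (simp add: \<alpha>_def)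
  qed
  have "geodesic_on A g {-T<..<T} \<alpha>"
    unfolding geodesic_on_def
  proof (intro conjI ballI impI)
    fix d t assume that: "d \<in> A" "t \<in> {-T<..<T}" "\<alpha> t \<in> fst d"
    show "(snd d \<circ> \<alpha>) differentiable (at t)"
      using key(1)[OF that] by (rule differentiableI_vector)
    show "(velocity d \<alpha> has_vector_derivative
         (\<chi> k. - (\<Sum>i\<in>UNIV. \<Sum>j\<in>UNIV. christoffel g d (\<alpha> t) k i j * velocity d \<alpha> t $ i * velocity d \<alpha> t $ j))) (at t)"
      unfolding gam_christoffel[OF atlas_chart(3)[OF atlas that(1,3)]] by (rule geo[OF that])
  qed (use cont in \<open>auto simp: is_interval_def\<close>)
  with key(3) have "regular_geodesic_on A g {-T<..<T} \<alpha>"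
    by (simp add: regular_geodesic_on_def)
  moreover have "\<alpha> 0 = p"
    using T cc(3)[OF p] by (simp add: \<alpha>_def)
  moreover have "velocity c \<alpha> 0 = v0"
    using vel[of 0] T unfolding velocity_def by (simp add: vector_derivative_at)
  ultimately show ?thesis
    using that T(1) by blast
qed

section \<open>The Clairaut relation\<close>

text \<open>The cosine is the length of the horizontal part divided by the length of v. By
  Pythagoras the squared sine is the share of the vertical part, whose squared length is w.\<close>

lemma (in conformal_chart) sin_angle:
  assumes x: "x \<in> U" and "v \<noteq> 0"
  shows "sin (angle_with (G x) {u. hor x u} v) = sqrt (ip (w x) v v / ip (G x) v v)"
proof -
  note G = G_pos[OF x]
  have orth: "ip (G x) (v - hp x v) u = 0" if "hor x u" for u
    using that vert_hp[OF x] posdef_sym[OF G] by (metis hor_def)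
  \<comment> \<open>The definite description needs uniqueness: two candidates differ by a horizontal
    vector that is orthogonal to itself.\<close>
  have proj: "orth_proj (G x) {u. hor x u} v = hp x v"
    unfolding orth_proj_def
  proof (rule the_equality)
    show "hp x v \<in> {u. hor x u} \<and> (\<forall>u\<in>{u. hor x u}. ip (G x) (v - hp x v) u = 0)"
      using orth hor_hp[OF x] by simp
    fix y assume y: "y \<in> {u. hor x u} \<and> (\<forall>u\<in>{u. hor x u}. ip (G x) (v - y) u = 0)"
    define z where "z = hp x v - y"
    have "hor x z"
      using y hor_hp[OF x] by (simp add: z_def hor_simps)
    with y orth have "ip (G x) (v - y) z = 0" "ip (G x) (v - hp x v) z = 0"
      by blast+
    then have "ip (G x) z z = 0"
      by (simp add: z_def ip_simps)
    then show "y = hp x v"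
      using posdef_eq_0[OF G] by (simp add: z_def)
  qed
  define q e where "q = ip (G x) (hp x v) (hp x v)" and "e = ip (G x) v v"
  have "ip (G x) (v - hp x v) (hp x v) = 0"
    by (rule orth[OF hor_hp[OF x]])
  then have e: "e = q + ip (w x) v v"
    using posdef_sym[OF G, of "hp x v" v] by (simp add: w_vertical_part[OF x] q_def e_def ip_simps)
  have "e > 0"
    using G \<open>v \<noteq> 0\<close> by (simp add: posdef_def e_def)
  have "q \<ge> 0"
    by (simp add: q_def posdef_nonneg[OF G])
  define s where "s = sqrt q / sqrt e"
  have "0 \<le> s" "s \<le> 1"
    using \<open>e > 0\<close> \<open>q \<ge> 0\<close> w_nonneg[OF x, of v] by (auto simp: s_def e)
  moreover have "1 - s\<^sup>2 = ip (w x) v v / e"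
    using \<open>e > 0\<close> \<open>q \<ge> 0\<close> by (simp add: s_def power_divide field_simps) (simp add: e)
  ultimately show ?thesis
    unfolding angle_with_def proj q_def[symmetric] e_def[symmetric] s_def[symmetric]
    by (simp add: sin_arccos)
qed

lemma angle_with_scale:
  assumes "k > 0"
  shows "angle_with (k *\<^sub>R G) H v = angle_with G H v"
proof -
  have "orth_proj (k *\<^sub>R G) H v = orth_proj G H v"
    using assms by (simp add: orth_proj_def ip_simps)
  then show ?thesis
    using assms by (simp add: angle_with_def ip_simps real_sqrt_mult)
qed

lemma smooth_function_chart:
  assumes "smooth_function A r" "c \<in> A"
  shows "C_times_on n (snd c ` fst c) (r \<circ> param c)"
    and "x \<in> snd c ` fst c \<Longrightarrow> (r \<circ> param c) differentiable (at x)"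
proof -
  show C: "C_times_on n (snd c ` fst c) (r \<circ> param c)" for n
    using assms by (simp add: smooth_function_def smooth_on_def)
  show "x \<in> snd c ` fst c \<Longrightarrow> (r \<circ> param c) differentiable (at x)"
    by (rule C_times_on_imp_differentiable[OF C])
qed

definition inverse_square_dilation :: "('a, 'm::finite) chart \<Rightarrow> ('a \<Rightarrow> real) \<Rightarrow> real^'m \<Rightarrow> real" where
  "inverse_square_dilation c dil x = 1 / (dil (param c x))\<^sup>2"

section \<open>Passing between the global definitions and their chart expressions\<close>

locale manifold_submersion =
  fixes A :: "('a::{t2_space, second_countable_topology}, 'm::finite) chart set" and g :: "('a, 'm) metric"
    and B :: "('b::{t2_space, second_countable_topology}, 'n::finite) chart set" and g' :: "('b, 'n) metric"
    and F :: "'a \<Rightarrow> 'b" and dil :: "'a \<Rightarrow> real"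
  assumes riem: "riemannian_manifold A g" and riem': "riemannian_manifold B g'"
    and submersion: "conformal_submersion_with A g B g' F dil"
begin

abbreviation U where "U c d \<equiv> snd c ` (fst c \<inter> F -` fst d)"
abbreviation chart where
  "chart c d \<equiv> conformal_chart (U c d) (snd d ` fst d) (g c \<circ> param c) (g' d \<circ> param d) (local_rep c d F)
     (inverse_square_dilation c dil)"
abbreviation clairaut where
  "clairaut c d \<equiv> clairaut_chart (U c d) (snd d ` fst d) (g c \<circ> param c) (g' d \<circ> param d) (local_rep c d F)
     (inverse_square_dilation c dil)"
abbreviation vmet where
  "vmet c d \<equiv> vertical_metric (g c \<circ> param c) (g' d \<circ> param d) (local_rep c d F) (inverse_square_dilation c dil)"
abbreviation angle where
  "angle c d p v \<equiv> angle_with (g c p) (horizontal g c d F p) v"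

lemma atlas: "smooth_atlas A" "smooth_atlas B"
  using riem riem' by (auto simp: riemannian_manifold_def)

lemma dil: "smooth_function A dil" "dil p > 0"
  using submersion by (auto simp: conformal_submersion_with_def)

lemma continuous_F: "continuous_on UNIV F"
  using submersion by (simp add: conformal_submersion_with_def submersion_def smooth_map_def)

lemma open_chart_domain: "c \<in> A \<Longrightarrow> d \<in> B \<Longrightarrow> open (fst c \<inter> F -` fst d)" "c \<in> A \<Longrightarrow> d \<in> B \<Longrightarrow> open (U c d)"
proof -
  assume c: "c \<in> A" and d: "d \<in> B"
  have "open (F -` fst d)"
    using continuous_F atlas_chart(1)[OF atlas(2) d] by (simp add: continuous_on_open_vimage)
  then show "open (fst c \<inter> F -` fst d)" "open (U c d)"
    using atlas_chart(1)[OF atlas(1) c] open_chart_image[OF atlas(1) c] by auto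
qed

lemma chart:
  assumes c: "c \<in> A" and d: "d \<in> B"
  shows "chart c d"
proof
  note cc = atlas_chart[OF atlas(1) c] and dd = atlas_chart[OF atlas(2) d]
  have sub: "U c d \<subseteq> snd c ` fst c"
    by blast
  show "open (U c d)"
    by (rule open_chart_domain(2)[OF c d])
  show "local_rep c d F x \<in> snd d ` fst d" if "x \<in> U c d" for x
    using that cc(3) by (auto simp: local_rep_def)
  show "(g c \<circ> param c) differentiable (at x)" "posdef ((g c \<circ> param c) x)" if "x \<in> U c d" for x
    using that sub riemannian_chart(2,3)[OF riem c] by blast+
  show "(g' d \<circ> param d) differentiable (at y)" "posdef ((g' d \<circ> param d) y)" if "y \<in> snd d ` fst d" for y
    using that riemannian_chart(2,3)[OF riem' d] by blast+
  show "C_times_on 2 (U c d) (local_rep c d F)"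
    using submersion c d
    unfolding conformal_submersion_with_def submersion_def smooth_map_def smooth_on_def local_rep_def by blast
  show "inverse_square_dilation c dil x > 0" for x
    unfolding inverse_square_dilation_def by (intro divide_pos_pos zero_less_power dil) simp
  show "inverse_square_dilation c dil differentiable (at x)" if "x \<in> U c d" for x
  proof -
    have "(\<lambda>x. dil (param c x)) differentiable (at x)"
      using smooth_function_chart(2)[OF dil(1) c, of x] that sub by (auto simp: o_def)
    moreover have "(dil (param c x))\<^sup>2 \<noteq> 0"
      using dil(2)[of "param c x"] by simp
    ultimately show ?thesis
      unfolding inverse_square_dilation_def[abs_def]
      by (intro differentiable_divide differentiable_power) auto
  qed
  fix x assume "x \<in> U c d"
  then obtain p where p: "p \<in> fst c \<inter> F -` fst d" and x: "x = snd c p"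
    by blast
  have pp: "param c x = p" "local_rep c d F x = snd d (F p)" "param d (snd d (F p)) = F p"
    using p cc(3) dd(3) by (auto simp: local_rep_def x)
  show "surj (frechet_derivative (local_rep c d F) (at x))"
    using submersion c d p x
    unfolding conformal_submersion_with_def submersion_def differential_def by blast
  fix X Y
  assume X: "\<And>v. frechet_derivative (local_rep c d F) (at x) v = 0 \<Longrightarrow> ip ((g c \<circ> param c) x) X v = 0"
    and Y: "\<And>v. frechet_derivative (local_rep c d F) (at x) v = 0 \<Longrightarrow> ip ((g c \<circ> param c) x) Y v = 0"
  have "X \<in> horizontal g c d F p" "Y \<in> horizontal g c d F p"
    using X Y pp by (auto simp: horizontal_def vertical_def differential_def x)
  then have "ip (g' d (F p)) (differential c d F p X) (differential c d F p Y) = (dil p)\<^sup>2 * ip (g c p) X Y"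
    using submersion c d p unfolding conformal_submersion_with_def by blast
  then show "ip ((g c \<circ> param c) x) X Y = inverse_square_dilation c dil x * ip ((g' d \<circ> param d) (local_rep c d F x))
      (frechet_derivative (local_rep c d F) (at x) X) (frechet_derivative (local_rep c d F) (at x) Y)"
    using dil(2)[of p] pp by (simp add: inverse_square_dilation_def differential_def x)
qed

lemma sin_angle_chart:
  assumes c: "c \<in> A" and d: "d \<in> B" and p: "p \<in> fst c \<inter> F -` fst d" and "v \<noteq> 0"
  shows "sin (angle c d p v) = sqrt (ip (vmet c d (snd c p)) v v / ip ((g c \<circ> param c) (snd c p)) v v)"
    and "ip (vmet c d (snd c p)) v v \<ge> 0" and "ip ((g c \<circ> param c) (snd c p)) v v > 0"
proof -
  interpret conformal_chart "U c d" "snd d ` fst d" "g c \<circ> param c" "g' d \<circ> param d" "local_rep c d F" "inverse_square_dilation c dil"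
    by (rule chart[OF c d])
  have x: "snd c p \<in> U c d"
    using p by blast
  have pp: "param c (snd c p) = p"
    using p atlas_chart(3)[OF atlas(1) c] by blast
  have "horizontal g c d F p = {u. hor (snd c p) u}"
    by (auto simp: horizontal_def vertical_def differential_def hor_def pp)
  then show "sin (angle c d p v) = sqrt (ip (vmet c d (snd c p)) v v / ip ((g c \<circ> param c) (snd c p)) v v)"
    using sin_angle[OF x \<open>v \<noteq> 0\<close>] pp by simp
  show "ip (vmet c d (snd c p)) v v \<ge> 0"
    by (rule w_nonneg[OF x])
  show "ip ((g c \<circ> param c) (snd c p)) v v > 0"
    using G_pos[OF x] \<open>v \<noteq> 0\<close> by (simp add: posdef_def)
qed

lemma geodesic_in_chart:
  assumes "regular_geodesic_on A g I \<alpha>" "t \<in> I" "c \<in> A" "\<alpha> t \<in> fst c"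
  shows "((snd c \<circ> \<alpha>) has_vector_derivative velocity c \<alpha> t) (at t)"
    "(velocity c \<alpha> has_vector_derivative - gam (g c \<circ> param c) ((snd c \<circ> \<alpha>) t) (velocity c \<alpha> t) (velocity c \<alpha> t)) (at t)"
    "velocity c \<alpha> t \<noteq> 0"
proof -
  have 1: "(snd c \<circ> \<alpha>) differentiable (at t)"
    and 2: "(velocity c \<alpha> has_vector_derivative
         (\<chi> k. - (\<Sum>i\<in>UNIV. \<Sum>j\<in>UNIV.
            christoffel g c (\<alpha> t) k i j * velocity c \<alpha> t $ i * velocity c \<alpha> t $ j))) (at t)"
    and 3: "velocity c \<alpha> t \<noteq> 0"
    using assms unfolding regular_geodesic_on_def geodesic_on_def by blast+
  show "((snd c \<circ> \<alpha>) has_vector_derivative velocity c \<alpha> t) (at t)"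
    using 1 unfolding velocity_def by (simp add: vector_derivative_works)
  show "(velocity c \<alpha> has_vector_derivative - gam (g c \<circ> param c) ((snd c \<circ> \<alpha>) t) (velocity c \<alpha> t) (velocity c \<alpha> t)) (at t)"
    using 2 unfolding gam_christoffel[OF atlas_chart(3)[OF atlas(1) assms(3,4)]] by simp
  show "velocity c \<alpha> t \<noteq> 0" by (rule 3)
qed

text \<open>This turns the Clairaut function into the root of a quotient of two quadratic forms in
  the velocity, each of which can be differentiated along geodesics.\<close>

lemma clairaut_quantity:
  assumes c: "c \<in> A" and d: "d \<in> B" and p: "p \<in> fst c \<inter> F -` fst d" and "v \<noteq> 0" and "r p > 0"
  shows "r p * sin (angle c d p v) =
    sqrt (ip ((((r \<circ> param c) (snd c p))\<^sup>2) *\<^sub>R vmet c d (snd c p)) v v / ip ((g c \<circ> param c) (snd c p)) v v)"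
proof -
  have "param c (snd c p) = p"
    using p atlas_chart(3)[OF atlas(1) c] by blast
  then show ?thesis
    unfolding sin_angle_chart(1)[OF assms(1-4)] ip_simps using \<open>r p > 0\<close>
    by (simp add: real_sqrt_mult real_sqrt_divide)
qed

lemma geodesic_derivatives:
  assumes geo: "regular_geodesic_on A g I \<alpha>" "t \<in> I" and c: "c \<in> A" and d: "d \<in> B"
    and p: "\<alpha> t \<in> fst c \<inter> F -` fst d" and r: "smooth_function A r"
  defines "S \<equiv> \<lambda>y. ((r \<circ> param c) y)\<^sup>2 *\<^sub>R vmet c d y" and "G \<equiv> g c \<circ> param c" and "x \<equiv> snd c \<circ> \<alpha>" and "v \<equiv> velocity c \<alpha>"
  shows "((\<lambda>s. ip (S (x s)) (v s) (v s)) has_real_derivative killing S G (x t) (v t)) (at t)"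
    and "((\<lambda>s. ip (G (x s)) (v s) (v s)) has_real_derivative 0) (at t)"
proof -
  interpret conformal_chart "U c d" "snd d ` fst d" "g c \<circ> param c" "g' d \<circ> param d" "local_rep c d F" "inverse_square_dilation c dil"
    by (rule chart[OF c d])
  have x: "x t \<in> U c d"
    using p by (auto simp: x_def)
  have rd: "(r \<circ> param c) differentiable (at (x t))"
    using smooth_function_chart(2)[OF r c] x by blast
  have \<alpha>: "\<alpha> t \<in> fst c"
    using p by blast
  note gd = geodesic_in_chart[OF geo c \<alpha>, folded x_def v_def G_def]
  have G: "G differentiable (at (x t))" "posdef (G (x t))"
    using G_diff[OF x] G_pos[OF x] by (simp_all add: G_def)
  have St: "transpose (S (x t)) = S (x t)"
    unfolding S_def transpose_scalar w_sym[OF x] ..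
  show "((\<lambda>s. ip (S (x s)) (v s) (v s)) has_real_derivative killing S G (x t) (v t)) (at t)"
    by (rule killing_derivative[where x = x and v = v and t = t and S = S and G = G, OF gd(1,2) _ St]) (unfold S_def, rule killing_scaled(1)[OF x rd])
  have "((\<lambda>s. ip (G (x s)) (v s) (v s)) has_real_derivative killing G G (x t) (v t)) (at t)"
    using G by (intro killing_derivative[where x = x and v = v and t = t and S = G and G = G, OF gd(1,2)]) (simp_all add: posdef_def)
  then show "((\<lambda>s. ip (G (x s)) (v s) (v s)) has_real_derivative 0) (at t)"
    by (simp add: killing_metric[OF G])
qed

lemma open_geodesic_chart:
  assumes "regular_geodesic_on A g I \<alpha>" and c: "c \<in> A" and d: "d \<in> B"
  shows "open (I \<inter> \<alpha> -` (fst c \<inter> F -` fst d))"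
proof -
  have "open I" "continuous_on I \<alpha>"
    using assms(1) by (auto simp: regular_geodesic_on_def geodesic_on_def)
  then show ?thesis
    using open_chart_domain(1)[OF c d] by (metis continuous_open_preimage)
qed

text \<open>Along the geodesic with initial velocity v0, the quotient of r^2 w by the squared speed
  is constant, and so is the speed. So r^2 w is constant along the velocity, and its derivative at
  time 0 is the Killing form at v0.\<close>

lemma clairaut_imp_clairaut_chart:
  assumes cl: "clairaut_conformal_submersion A g B g' F r"
    and c: "c \<in> A" and d: "d \<in> B" and p: "p \<in> fst c \<inter> F -` fst d"
  shows "clairaut c d (r \<circ> param c) (snd c p)"
proof -
  interpret conformal_chart "U c d" "snd d ` fst d" "g c \<circ> param c" "g' d \<circ> param d" "local_rep c d F" "inverse_square_dilation c dil"
    by (rule chart[OF c d])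
  let ?r = "r \<circ> param c" and ?G = "g c \<circ> param c"
  have r: "smooth_function A r" "\<And>p. r p > 0"
    using cl by (auto simp: clairaut_conformal_submersion_def)
  have x: "snd c p \<in> U c d"
    using p by blast
  show ?thesis
  proof unfold_locales
    show "snd c p \<in> U c d" by fact
    show "?r (snd c p) > 0"
      using r(2) by simp
    show "?r differentiable (at (snd c p))"
      using smooth_function_chart(2)[OF r(1) c] x by blast
    fix v0
    define S where "S = (\<lambda>y. (?r y)\<^sup>2 *\<^sub>R vmet c d y)"
    have "killing S ?G (snd c p) v0 = 0"
    proof (cases "v0 = 0")
      case True
      then show ?thesis
        by (simp add: killing_def ip_simps)
    next
      case False
      obtain T \<alpha> where \<alpha>: "T > 0" "regular_geodesic_on A g {-T<..<T} \<alpha>" "\<alpha> 0 = p" "velocity c \<alpha> 0 = v0"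
        using geodesic_exists[OF riem c _ False] p by blast
      obtain C where C: "\<And>t c d. t \<in> {-T<..<T} \<Longrightarrow> c \<in> A \<Longrightarrow> d \<in> B \<Longrightarrow> \<alpha> t \<in> fst c \<Longrightarrow> F (\<alpha> t) \<in> fst d \<Longrightarrow>
          r (\<alpha> t) * sin (angle c d (\<alpha> t) (velocity c \<alpha> t)) = C"
        using cl \<alpha>(2) unfolding clairaut_conformal_submersion_def by metis
      define q where "q t = ip (S ((snd c \<circ> \<alpha>) t)) (velocity c \<alpha> t) (velocity c \<alpha> t)" for t
      define e where "e t = ip (?G ((snd c \<circ> \<alpha>) t)) (velocity c \<alpha> t) (velocity c \<alpha> t)" for t
      define J where "J = {-T<..<T} \<inter> \<alpha> -` (fst c \<inter> F -` fst d)"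
      have J: "open J" "0 \<in> J"
        using open_geodesic_chart[OF \<alpha>(2) c d] \<alpha>(1,3) p by (auto simp: J_def)
      \<comment> \<open>The constant C bounds no sign: squaring is harmless because the quotient
        under the root is nonnegative.\<close>
      have qe: "q t = C\<^sup>2 * e t" if t: "t \<in> J" for t
      proof -
        have \<alpha>t: "\<alpha> t \<in> fst c \<inter> F -` fst d" and tT: "t \<in> {-T<..<T}"
          using t by (auto simp: J_def)
        have v: "velocity c \<alpha> t \<noteq> 0"
          using geodesic_in_chart(3)[OF \<alpha>(2) tT c] \<alpha>t by blast
        have e: "e t > 0"
          using sin_angle_chart(3)[OF c d \<alpha>t v] by (simp add: e_def)
        have q: "q t \<ge> 0"
          using sin_angle_chart(2)[OF c d \<alpha>t v] by (simp add: q_def S_def ip_simps)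
        have "r (\<alpha> t) * sin (angle c d (\<alpha> t) (velocity c \<alpha> t)) = sqrt (q t / e t)"
          unfolding clairaut_quantity[OF c d \<alpha>t v, of r, OF r(2)] by (simp add: q_def e_def S_def)
        then have "C = sqrt (q t / e t)"
          using C[OF tT c d] \<alpha>t by simp
        then have "C\<^sup>2 = q t / e t"
          using q e by simp
        then show ?thesis
          using e by simp
      qed
      have T0: "0 \<in> {-T<..<T}"
        using \<alpha>(1) by simp
      note D = geodesic_derivatives[OF \<alpha>(2) T0 c d _ r(1)]
      have "(q has_real_derivative killing S ?G (snd c p) v0) (at 0)"
        using D(1) p \<alpha>(3,4) by (simp add: q_def[abs_def] S_def)
      moreover have "((\<lambda>t. C\<^sup>2 * e t) has_real_derivative C\<^sup>2 * 0) (at 0)"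
        using D(2) p \<alpha>(3) by (intro DERIV_cmult) (simp add: e_def[abs_def])
      then have "(q has_real_derivative C\<^sup>2 * 0) (at 0)"
        unfolding has_field_derivative_def
        by (rule has_derivative_transform_within_open[OF _ J]) (rule qe[symmetric])
      then have "(q has_real_derivative 0) (at 0)"
        by simp
      ultimately show ?thesis
        by (rule DERIV_unique)
    qed
    then show "killing (\<lambda>y. (?r y)\<^sup>2 *\<^sub>R vmet c d y) ?G (snd c p) v0 = 0"
      by (simp add: S_def)
  qed
qed

text \<open>The converse of \<open>clairaut_imp_clairaut_chart\<close>. In a fixed chart, numerator
  and denominator of the quotient have zero derivative along the geodesic, so the Clairaut function
  is locally constant, and the interval is connected. \<open>indep\<close> makes this function well
  defined when the curve passes from one chart to another.\<close>

lemma clairaut_relation: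
  assumes r: "smooth_function A r" "\<And>p. r p > 0"
    and charts: "\<And>c d p. c \<in> A \<Longrightarrow> d \<in> B \<Longrightarrow> p \<in> fst c \<inter> F -` fst d \<Longrightarrow> clairaut c d (r \<circ> param c) (snd c p)"
    and indep: "\<And>t c d c' d'. t \<in> I \<Longrightarrow> c \<in> A \<Longrightarrow> d \<in> B \<Longrightarrow> c' \<in> A \<Longrightarrow> d' \<in> B \<Longrightarrow>
      \<alpha> t \<in> fst c \<inter> F -` fst d \<Longrightarrow> \<alpha> t \<in> fst c' \<inter> F -` fst d' \<Longrightarrow>
      sin (angle c d (\<alpha> t) (velocity c \<alpha> t)) = sin (angle c' d' (\<alpha> t) (velocity c' \<alpha> t))"
    and geo: "regular_geodesic_on A g I \<alpha>"
  shows "\<exists>C. \<forall>t\<in>I. \<forall>c\<in>A. \<forall>d\<in>B. \<alpha> t \<in> fst c \<and> F (\<alpha> t) \<in> fst d \<longrightarrow>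
          r (\<alpha> t) * sin (angle c d (\<alpha> t) (velocity c \<alpha> t)) = C"
proof -
  define val where "val t c d = r (\<alpha> t) * sin (angle c d (\<alpha> t) (velocity c \<alpha> t))"
    for t and c :: "('a, 'm) chart" and d :: "('b, 'n) chart"
  have "\<exists>c d. c \<in> A \<and> d \<in> B \<and> p \<in> fst c \<inter> F -` fst d" for p
    using atlas unfolding smooth_atlas_def by blast
  then obtain cc dd where cd: "\<And>p. cc p \<in> A" "\<And>p. dd p \<in> B" "\<And>p. p \<in> fst (cc p) \<inter> F -` fst (dd p)"
    by metis
  define V where "V t = val t (cc (\<alpha> t)) (dd (\<alpha> t))" for t
  have V: "val t c d = V t" if "t \<in> I" "c \<in> A" "d \<in> B" "\<alpha> t \<in> fst c \<inter> F -` fst d" for t c d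
    unfolding val_def V_def using indep[OF that(1-3) cd(1,2) that(4) cd(3)] by simp
  have conn: "connected I" "open I"
    using geo is_interval_connected by (auto simp: regular_geodesic_on_def geodesic_on_def)
  have "V constant_on I"
  proof (rule locally_constant_imp_constant[OF conn(1)])
    fix t0 assume t0: "t0 \<in> I"
    define c d where "c = cc (\<alpha> t0)" and "d = dd (\<alpha> t0)"
    have c: "c \<in> A" and d: "d \<in> B" and p0: "\<alpha> t0 \<in> fst c \<inter> F -` fst d"
      using cd by (auto simp: c_def d_def)
    define S where "S = (\<lambda>y. ((r \<circ> param c) y)\<^sup>2 *\<^sub>R vmet c d y)"
    define q where "q t = ip (S ((snd c \<circ> \<alpha>) t)) (velocity c \<alpha> t) (velocity c \<alpha> t)" for t
    define e where "e t = ip ((g c \<circ> param c) ((snd c \<circ> \<alpha>) t)) (velocity c \<alpha> t) (velocity c \<alpha> t)" for t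
    have "open (I \<inter> \<alpha> -` (fst c \<inter> F -` fst d))"
      by (rule open_geodesic_chart[OF geo c d])
    moreover have "t0 \<in> I \<inter> \<alpha> -` (fst c \<inter> F -` fst d)"
      using t0 p0 by blast
    ultimately obtain \<epsilon> where "\<epsilon> > 0" and \<epsilon>: "ball t0 \<epsilon> \<subseteq> I \<inter> \<alpha> -` (fst c \<inter> F -` fst d)"
      using open_contains_ball by blast
    have in_ball: "t \<in> I" "\<alpha> t \<in> fst c \<inter> F -` fst d" if "t \<in> ball t0 \<epsilon>" for t
      using that \<epsilon> by auto
    have Vqe: "V t = sqrt (q t / e t)" if t: "t \<in> ball t0 \<epsilon>" for t
    proof -
      have "velocity c \<alpha> t \<noteq> 0"
        using geodesic_in_chart(3)[OF geo in_ball(1)[OF t] c] in_ball(2)[OF t] by blast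
      from clairaut_quantity[OF c d in_ball(2)[OF t] this, of r, OF r(2)]
      show ?thesis
        unfolding V[OF in_ball(1)[OF t] c d in_ball(2)[OF t], symmetric] val_def by (simp add: q_def e_def S_def)
    qed
    have Dq: "(q has_real_derivative 0) (at t within ball t0 \<epsilon>)" if t: "t \<in> ball t0 \<epsilon>" for t
    proof -
      interpret clairaut_chart "U c d" "snd d ` fst d" "g c \<circ> param c" "g' d \<circ> param d" "local_rep c d F" "inverse_square_dilation c dil"
        "r \<circ> param c" "snd c (\<alpha> t)"
        by (rule charts[OF c d in_ball(2)[OF t]])
      have "(q has_real_derivative killing S (g c \<circ> param c) (snd c (\<alpha> t)) (velocity c \<alpha> t)) (at t)"
        using geodesic_derivatives(1)[OF geo in_ball(1)[OF t] c d in_ball(2)[OF t] r(1)]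
        by (simp add: q_def[abs_def] S_def)
      then show ?thesis
        unfolding S_def killing by (rule has_field_derivative_at_within)
    qed
    have De: "(e has_real_derivative 0) (at t within ball t0 \<epsilon>)" if t: "t \<in> ball t0 \<epsilon>" for t
    proof -
      have "(e has_real_derivative 0) (at t)"
        using geodesic_derivatives(2)[OF geo in_ball(1)[OF t] c d in_ball(2)[OF t] r(1)] by (simp add: e_def[abs_def])
      then show ?thesis
        by (rule has_field_derivative_at_within)
    qed
    obtain q0 where "\<forall>t\<in>ball t0 \<epsilon>. q t = q0"
      using has_field_derivative_zero_constant[OF convex_ball Dq] by blast
    moreover obtain e0 where "\<forall>t\<in>ball t0 \<epsilon>. e t = e0"
      using has_field_derivative_zero_constant[OF convex_ball De] by blast
    ultimately have "\<forall>t\<in>ball t0 \<epsilon>. V t = V t0"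
      using Vqe \<open>\<epsilon> > 0\<close> by simp
    moreover have "openin (top_of_set I) (ball t0 \<epsilon>)"
      using in_ball(1) by (intro open_openin_trans conn(2)) auto
    moreover have "t0 \<in> ball t0 \<epsilon>"
      using \<open>\<epsilon> > 0\<close> by simp
    ultimately show "\<exists>T. openin (top_of_set I) T \<and> t0 \<in> T \<and> (\<forall>t\<in>T. V t = V t0)"
      by blast
  qed
  then obtain C where "\<And>t. t \<in> I \<Longrightarrow> V t = C"
    by (auto simp: constant_on_def)
  with V show ?thesis
    unfolding val_def by (intro exI[of _ C]) (simp add: V val_def)
qed

text \<open>The angle is a geometric quantity; here this follows from the Clairaut relation along a geodesic through p,
  which holds with the same constant in all charts.\<close>

lemma angle_chart_independent:
  assumes cl: "clairaut_conformal_submersion A g B g' F r"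
    and c: "c \<in> A" "d \<in> B" "p \<in> fst c \<inter> F -` fst d" and c': "c' \<in> A" "d' \<in> B" "p \<in> fst c' \<inter> F -` fst d'" and v: "v \<noteq> 0"
  shows "sin (angle c d p v) = sin (angle c' d' p (frechet_derivative (snd c' \<circ> param c) (at (snd c p)) v))"
proof -
  interpret ch: chart_change A g c c'
    using riem c(1) c'(1) by unfold_locales
  obtain T \<alpha> where \<alpha>: "T > 0" "regular_geodesic_on A g {-T<..<T} \<alpha>" "\<alpha> 0 = p" "velocity c \<alpha> 0 = v"
    using geodesic_exists[OF riem c(1) _ v] c(3) by blast
  obtain C where C: "\<And>t c d. t \<in> {-T<..<T} \<Longrightarrow> c \<in> A \<Longrightarrow> d \<in> B \<Longrightarrow> \<alpha> t \<in> fst c \<Longrightarrow> F (\<alpha> t) \<in> fst d \<Longrightarrow>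
      r (\<alpha> t) * sin (angle c d (\<alpha> t) (velocity c \<alpha> t)) = C"
    using cl \<alpha>(2) unfolding clairaut_conformal_submersion_def by metis
  have T0: "0 \<in> {-T<..<T}"
    using \<alpha>(1) by simp
  have cont: "isCont \<alpha> 0"
    using \<alpha>(2) T0 by (auto simp: regular_geodesic_on_def geodesic_on_def continuous_on_eq_continuous_at)
  have "((snd c \<circ> \<alpha>) has_vector_derivative v) (at 0)"
    using geodesic_in_chart(1)[OF \<alpha>(2) T0 c(1)] \<alpha>(3,4) c(3) by simp
  then have "((snd c' \<circ> \<alpha>) has_vector_derivative ch.D (snd c p) v) (at 0)"
    using ch.velocity_change[OF _ cont] \<alpha>(3) c(3) c'(3) by simp
  then have "velocity c' \<alpha> 0 = ch.D (snd c p) v"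
    unfolding velocity_def by (rule vector_derivative_at)
  then have "r p * sin (angle c d p v) = r p * sin (angle c' d' p (ch.D (snd c p) v))"
    using C[OF T0 c(1,2)] C[OF T0 c'(1,2)] c(3) c'(3) \<alpha>(3,4) by simp
  moreover have "r p > 0"
    using cl by (simp add: clairaut_conformal_submersion_def)
  ultimately show ?thesis by simp
qed

text \<open>By the straightening of fibers a function without vertical derivative is locally
  constant on each fiber, hence constant on the connected components.\<close>

lemma constant_along_fibers_chart:
  assumes h: "smooth_function A h"
    and vert: "\<And>c d p v. c \<in> A \<Longrightarrow> d \<in> B \<Longrightarrow> p \<in> fst c \<inter> F -` fst d \<Longrightarrow>
      frechet_derivative (local_rep c d F) (at (snd c p)) v = 0 \<Longrightarrow> frechet_derivative (h \<circ> param c) (at (snd c p)) v = 0"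
  shows "constant_along_fibers F h"
  unfolding constant_along_fibers_def
proof (intro allI impI)
  fix b S assume S: "S \<in> components (F -` {b})"
  have "connected S"
    using S by (rule in_components_connected)
  then show "h constant_on S"
  proof (rule locally_constant_imp_constant)
    fix p assume p: "p \<in> S"
    have fib: "F q = b" if "q \<in> S" for q
      using in_components_subset[OF S] that by blast
    obtain c d where c: "c \<in> A" and d: "d \<in> B" and pc: "p \<in> fst c \<inter> F -` fst d"
      using atlas unfolding smooth_atlas_def by blast
    interpret conformal_chart "U c d" "snd d ` fst d" "g c \<circ> param c" "g' d \<circ> param d" "local_rep c d F" "inverse_square_dilation c dil"
      by (rule chart[OF c d])
    note cc = atlas_chart[OF atlas(1) c]
    have x: "snd c p \<in> U c d"
      using pc by blast
    have hd: "(h \<circ> param c) differentiable (at y)" if "y \<in> U c d" for y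
      using smooth_function_chart(2)[OF h c] that by blast
    have hv: "frechet_derivative (h \<circ> param c) (at y) v = 0"
      if "y \<in> U c d" "frechet_derivative (local_rep c d F) (at y) v = 0" for y v
      using vert[OF c d] that by blast
    have C1: "C_times_on 1 (U c d) (local_rep c d F)"
      using \<Phi>_C2 unfolding numeral_2_eq_2 One_nat_def by (rule C_times_on_SucD)
    obtain N where N: "open N" "snd c p \<in> N" "N \<subseteq> U c d"
      and const: "\<And>y. y \<in> N \<Longrightarrow> local_rep c d F y = local_rep c d F (snd c p) \<Longrightarrow> (h \<circ> param c) y = (h \<circ> param c) (snd c p)"
      using locally_constant_on_fiber[OF open_chart_domain(2)[OF c d] x C1 hd submersive[OF x] hv] by metis
    have "open (fst c \<inter> snd c -` N)"
      by (rule continuous_open_preimage[OF cc(6,1) N(1)])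
    then have "openin (top_of_set S) (S \<inter> (fst c \<inter> snd c -` N))"
      by (rule openin_open_Int)
    moreover have "p \<in> S \<inter> (fst c \<inter> snd c -` N)"
      using p pc N(2) by blast
    moreover have "h q = h p" if q: "q \<in> S \<inter> (fst c \<inter> snd c -` N)" for q
    proof -
      have "param c (snd c q) = q" "param c (snd c p) = p"
        using q pc cc(3) by auto
      with const[of "snd c q"] q fib[of q] fib[OF p] show ?thesis
        by (simp add: local_rep_def)
    qed
    ultimately show "\<exists>T. openin (top_of_set S) T \<and> p \<in> T \<and> (\<forall>q\<in>T. h q = h p)"
      by blast
  qed
qed

text \<open>The second hypothesis is the 1-form that \<open>tension\<close> finds for the traced
  second fundamental form. The rest identifies the component-wise definition of the tension field
  with the vector-valued \<open>second_form\<close>.\<close>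

lemma harmonic:
  assumes "\<And>c d p. c \<in> A \<Longrightarrow> d \<in> B \<Longrightarrow> p \<in> fst c \<inter> F -` fst d \<Longrightarrow> clairaut c d (r \<circ> param c) (snd c p)"
    and "\<And>c d p v. c \<in> A \<Longrightarrow> d \<in> B \<Longrightarrow> p \<in> fst c \<inter> F -` fst d \<Longrightarrow>
      (real CARD('n) - 2) / 2 * (frechet_derivative (inverse_square_dilation c dil) (at (snd c p)) v / inverse_square_dilation c dil (snd c p))
      + (real CARD('m) - real CARD('n)) * (frechet_derivative (r \<circ> param c) (at (snd c p)) v / (r \<circ> param c) (snd c p)) = 0"
  shows "harmonic_map A g B g' F"
  unfolding harmonic_map_def
proof (intro conjI ballI)
  show "smooth_map A B F"
    using submersion by (simp add: conformal_submersion_with_def submersion_def)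
  fix c d p assume c: "c \<in> A" and d: "d \<in> B" and p: "p \<in> fst c \<inter> F -` fst d"
  interpret clairaut_chart "U c d" "snd d ` fst d" "g c \<circ> param c" "g' d \<circ> param d" "local_rep c d F" "inverse_square_dilation c dil"
    "r \<circ> param c" "snd c p"
    by (rule assms(1)[OF c d p])
  have pp: "param c (snd c p) = p" "local_rep c d F (snd c p) = snd d (F p)" "param d (snd d (F p)) = F p"
    using p atlas_chart(3)[OF atlas(1) c] atlas_chart(3)[OF atlas(2) d] by (auto simp: local_rep_def)
  have nth: "frechet_derivative (\<lambda>y. local_rep c d F y $ k) (at y) v = D y v $ k" if "y \<in> U c d" for y v k
    using frechet_derivative_at[OF bounded_linear.has_derivative[OF bounded_linear_vec_nth
        frechet_derivative_works[THEN iffD1, OF \<Phi>_diff[OF that]], of k]] by (simp add: fun_eq_iff)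
  have nth2: "partial i (partial j (\<lambda>y. local_rep c d F y $ k)) (snd c p) =
      frechet_derivative (\<lambda>y. D y (axis j 1)) (at (snd c p)) (axis i 1) $ k" for i j k
  proof -
    have "((\<lambda>y. D y (axis j 1)) has_derivative frechet_derivative (\<lambda>y. D y (axis j 1)) (at (snd c p))) (at (snd c p))"
      using \<Phi>_C2 x by (auto simp: numeral_2_eq_2 frechet_derivative_works)
    then have "((\<lambda>y. D y (axis j 1) $ k) has_derivative (\<lambda>z. frechet_derivative (\<lambda>y. D y (axis j 1)) (at (snd c p)) z $ k)) (at (snd c p))"
      by (rule bounded_linear.has_derivative[OF bounded_linear_vec_nth])
    then have "(partial j (\<lambda>y. local_rep c d F y $ k) has_derivative (\<lambda>z. frechet_derivative (\<lambda>y. D y (axis j 1)) (at (snd c p)) z $ k)) (at (snd c p))"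
      by (rule has_derivative_transform_within_open[OF _ open_chart_domain(2)[OF c d] x]) (simp add: partial_def nth)
    from frechet_derivative_at[OF this] show ?thesis
      unfolding partial_def[of i] by (metis (no_types))
  qed
  have second_form: "second_fundamental_form g g' F c d p k i j = second_form (snd c p) (axis i 1) (axis j 1) $ k" for k i j
  proof -
    have "D (snd c p) (gam (g c \<circ> param c) (snd c p) (axis i 1) (axis j 1)) =
      (\<Sum>l\<in>UNIV. gam (g c \<circ> param c) (snd c p) (axis i 1) (axis j 1) $ l *\<^sub>R D (snd c p) (axis l 1))"
      by (rule linear_sum_axis[OF linear_D[OF x]])
    moreover have "gam G y (axis i 1) (axis j 1) $ l = christ G y l i j" for G :: "real^'m \<Rightarrow> real^'m^'m" and y l
    proof -
      have "a * axis q 1 $ i = (if i = q then a else 0)" for a :: real and q i :: 'm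
        by (simp add: axis_def)
      then show ?thesis
        by (simp add: gam_def)
    qed
    ultimately show ?thesis
      unfolding second_fundamental_form_def nth2 second_form_def
      using christoffel_christ[of c p g, OF pp(1)] christoffel_christ[of d "F p" g', OF pp(3)]
      by (simp add: partial_def nth[OF x] pp(2) gam_def[of "g' d \<circ> param d"])
  qed
  have "(\<Sum>i\<in>UNIV. \<Sum>j\<in>UNIV. matrix_inv ((g c \<circ> param c) (snd c p)) $ i $ j *\<^sub>R second_form (snd c p) (axis i 1) (axis j 1)) = 0"
    by (rule tension_zero) (rule assms(2)[OF c d p])
  then have "(\<Sum>i\<in>UNIV. \<Sum>j\<in>UNIV. matrix_inv (g c p) $ i $ j * second_form (snd c p) (axis i 1) (axis j 1) $ k) = 0" for k
    unfolding vec_eq_iff by (simp add: pp(1))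
  then show "tension_field g g' F c d p = 0"
    by (simp add: tension_field_def second_form vec_eq_iff)
qed

end

section \<open>The conformal change that makes the submersion harmonic\<close>

lemma smooth_function_powr_mult:
  assumes "smooth_atlas A" "smooth_function A u" "smooth_function A r" "\<And>p. u p > 0" "\<And>p. r p > 0"
  shows "smooth_function A (\<lambda>p. u p powr s * r p powr t)"
  unfolding smooth_function_def smooth_on_def
proof (intro ballI allI)
  fix c n assume c: "c \<in> A"
  have "C_times_on n (snd c ` fst c) (\<lambda>x. (u \<circ> param c) x powr s * (r \<circ> param c) x powr t)"
    using assms c by (intro C_times_on_mult C_times_on_powr smooth_function_chart atlas_chart) auto
  then show "C_times_on n (snd c ` fst c) ((\<lambda>p. u p powr s * r p powr t) \<circ> param c)"
    by (simp add: o_def)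
qed

text \<open>In this factored form the logarithmic derivative is visibly linear in the exponents s
  and t.\<close>

lemma has_derivative_powr_mult:
  fixes u r :: "'a::real_normed_vector \<Rightarrow> real"
  assumes "u differentiable (at x)" "r differentiable (at x)" "u x > 0" "r x > 0"
  shows "((\<lambda>y. u y powr s * r y powr t) has_derivative
    (\<lambda>z. (u x powr s * r x powr t) * (s * (frechet_derivative u (at x) z / u x) + t * (frechet_derivative r (at x) z / r x)))) (at x)"
proof -
  have "(u has_derivative frechet_derivative u (at x)) (at x)" "(r has_derivative frechet_derivative r (at x)) (at x)"
    using assms by (simp_all add: frechet_derivative_works)
  then have "((\<lambda>y. u y powr s * r y powr t) has_derivative
    (\<lambda>z. u x powr s * (t * r x powr (t - 1) * frechet_derivative r (at x) z)
       + (s * u x powr (s - 1) * frechet_derivative u (at x) z) * r x powr t)) (at x)"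
    using assms(3,4) by (auto intro!: derivative_eq_intros simp: fun_eq_iff powr_diff mult_ac)
  then show ?thesis
    using assms(3,4) by (simp add: powr_diff algebra_simps)
qed

lemma riemannian_conformal_change:
  assumes riem: "riemannian_manifold A g" and \<phi>: "smooth_function A \<phi>" "\<And>p. \<phi> p > 0"
  shows "riemannian_manifold A (conformal_change \<phi> g)"
proof -
  have atlas: "smooth_atlas A"
    using riem by (simp add: riemannian_manifold_def)
  have "C_times_on n (snd c ` fst c) (conformal_change \<phi> g c \<circ> param c)" if c: "c \<in> A" for c n
  proof -
    note op = atlas_chart(2)[OF atlas c] and C = smooth_function_chart(1)[OF \<phi>(1) c]
    have "C_times_on n (snd c ` fst c) (\<lambda>x. ((\<phi> \<circ> param c) x * (\<phi> \<circ> param c) x) *\<^sub>R (g c \<circ> param c) x)"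
      by (intro C_times_on_bilinear[OF bounded_bilinear_scaleR op] C_times_on_mult op C riemannian_chart(1)[OF riem c])
    then show ?thesis
      by (simp add: conformal_change_def o_def power2_eq_square)
  qed
  moreover have "transpose (conformal_change \<phi> g c p) = conformal_change \<phi> g c p \<and>
      (\<forall>v. v \<noteq> 0 \<longrightarrow> ip (conformal_change \<phi> g c p) v v > 0)" if "c \<in> A" "p \<in> fst c" for c p
  proof -
    have "posdef (g c p)"
      using riem that unfolding riemannian_manifold_def posdef_def by blast
    then have "posdef (conformal_change \<phi> g c p)"
      unfolding conformal_change_def using \<phi>(2)[of p] by (intro posdef_scale) simp_all
    then show ?thesis
      by (simp add: posdef_def)
  qed
  moreover have "ip (conformal_change \<phi> g c p) u v =
      ip (conformal_change \<phi> g d p) (differential c d id p u) (differential c d id p v)"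
    if "c \<in> A" "d \<in> A" "p \<in> fst c \<inter> fst d" for c d p u v
  proof -
    have "ip (g c p) u v = ip (g d p) (differential c d id p u) (differential c d id p v)"
      using riem that unfolding riemannian_manifold_def by blast
    then show ?thesis
      by (simp add: conformal_change_def ip_simps)
  qed
  ultimately show ?thesis
    unfolding riemannian_manifold_def smooth_on_def using atlas by blast
qed

lemma horizontal_conformal_change: "\<phi> p > 0 \<Longrightarrow> horizontal (conformal_change \<phi> g) c d F p = horizontal g c d F p"
  by (simp add: horizontal_def conformal_change_def ip_simps)

lemma angle_conformal_change: "\<phi> p > 0 \<Longrightarrow>
  angle_with (conformal_change \<phi> g c p) (horizontal (conformal_change \<phi> g) c d F p) v = angle_with (g c p) (horizontal g c d F p) v"
  by (simp add: horizontal_conformal_change) (simp add: conformal_change_def angle_with_scale)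

theorem corollary19:
  fixes A :: "('a::{t2_space, second_countable_topology}, 'm::finite) chart set"
    and g :: "('a, 'm) metric"
    and B :: "('b::{t2_space, second_countable_topology}, 'n::finite) chart set"
    and g' :: "('b, 'n) metric"
    and F :: "'a \<Rightarrow> 'b"
    and f :: "'a \<Rightarrow> real"
  assumes "clairaut_conformal_submersion A g B g' F (\<lambda>p. exp (f p))"
    and "CARD('m) \<noteq> 2"
  shows "\<exists>\<phi>. smooth_function A \<phi> \<and> (\<forall>p. \<phi> p > 0) \<and> constant_along_fibers F \<phi> \<and>
           clairaut_conformal_submersion A (conformal_change \<phi> g) B g' F (\<lambda>p. \<phi> p * exp (f p)) \<and>
           harmonic_map A (conformal_change \<phi> g) B g' F"
proof -
  note cl = assms(1)
  define r where "r p = exp (f p)" for p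
  have r: "smooth_function A r" "r p > 0" for p
    using cl by (auto simp: clairaut_conformal_submersion_def r_def[abs_def])
  obtain dil where "conformal_submersion_with A g B g' F dil"
    using cl unfolding clairaut_conformal_submersion_def by blast
  then interpret old: manifold_submersion A g B g' F dil
    using cl by unfold_locales (auto simp: clairaut_conformal_submersion_def)
  \<comment> \<open>All functions that occur, \<lambda>, r, \<phi>, \<lambda>/\<phi>, \<phi> r and
    (\<phi>/\<lambda>)^2, are monomials in \<lambda> and r. Products then become sums of exponents
    and logarithmic derivatives become linear expressions in them.\<close>
  define mon where "mon s t p = dil p powr s * r p powr t" for s t p
  have mon_pos: "mon s t p > 0" for s t p
    using old.dil(2)[of p] r(2)[of p] by (simp add: mon_def)
  have mon_smooth: "smooth_function A (mon s t)" for s t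
    unfolding mon_def[abs_def]
    by (rule smooth_function_powr_mult[OF old.atlas(1) old.dil(1) r(1) old.dil(2) r(2)])
  have mon_mult: "mon s t p * mon s' t' p = mon (s + s') (t + t') p" for s t s' t' p
    by (simp add: mon_def powr_add)
  have mon_base: "mon 1 0 p = dil p" "mon 0 1 p = r p" for p
    using old.dil(2)[of p] r(2)[of p] by (simp_all add: mon_def)
  have mon_deriv: "((mon s t \<circ> param c) has_derivative (\<lambda>z. mon s t p *
      (s * (frechet_derivative (dil \<circ> param c) (at (snd c p)) z / dil p) + t * (frechet_derivative (r \<circ> param c) (at (snd c p)) z / r p)))) (at (snd c p))"
    if "c \<in> A" "p \<in> fst c" for s t c p
  proof -
    have x: "snd c p \<in> snd c ` fst c" "param c (snd c p) = p"
      using that atlas_chart(3)[OF old.atlas(1)] by auto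
    show ?thesis
      using has_derivative_powr_mult[OF smooth_function_chart(2)[OF old.dil(1) that(1) x(1)] smooth_function_chart(2)[OF r(1) that(1) x(1)], of s t]
        old.dil(2)[of p] r(2)[of p] x(2)
      by (simp add: mon_def[abs_def] o_def)
  qed
  \<comment> \<open>For the new metric the trace involves (2 - n) dlog(\<lambda>/\<phi>) + (m - n)
    dlog(\<phi> r), in which dlog \<phi> has the coefficient (n - 2) + (m - n) = m - 2. Solving with
    log \<phi> = a log \<lambda> + b log r gives these exponents; the division is where m \<noteq> 2
    enters.\<close>
  define a b where "a = (real CARD('n) - 2) / (real CARD('m) - 2)"
    and "b = - (real CARD('m) - real CARD('n)) / (real CARD('m) - 2)"
  have m2: "real CARD('m) - 2 \<noteq> 0"
    using assms(2) by (metis eq_iff_diff_eq_0 of_nat_eq_iff of_nat_numeral)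
  have ab: "(real CARD('m) - 2) * a = real CARD('n) - 2" "(real CARD('m) - 2) * b = - (real CARD('m) - real CARD('n))"
    using m2 by (simp_all add: a_def b_def)
  define \<phi> where "\<phi> = mon a b"
  define dil' where "dil' = mon (1 - a) (- b)"
  define r' where "r' = mon a (b + 1)"
  let ?g = "conformal_change \<phi> g"
  have \<phi>: "smooth_function A \<phi>" "\<phi> p > 0" for p
    unfolding \<phi>_def by (rule mon_smooth mon_pos)+
  have dil': "smooth_function A dil'" "dil' p > 0" "\<phi> p * dil' p = dil p" for p
    unfolding dil'_def \<phi>_def mon_mult by (simp_all add: mon_smooth mon_pos mon_base)
  have r': "smooth_function A r'" "r' p > 0" "r' p = \<phi> p * r p" for p
    unfolding r'_def \<phi>_def mon_base(2)[symmetric] mon_mult by (simp_all add: mon_smooth mon_pos)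
  have isd: "inverse_square_dilation c dil' = mon (2 * a - 2) (2 * b) \<circ> param c" for c :: "('a, 'm) chart"
  proof
    fix x
    have "mon (2 * a - 2) (2 * b) (param c x) * (dil' (param c x) * dil' (param c x)) = mon 0 0 (param c x)"
      unfolding dil'_def mon_mult by simp
    also have "\<dots> = 1"
      using old.dil(2)[of "param c x"] r(2)[of "param c x"] by (simp add: mon_def)
    finally show "inverse_square_dilation c dil' x = (mon (2 * a - 2) (2 * b) \<circ> param c) x"
      using dil'(2)[of "param c x"] by (simp add: inverse_square_dilation_def power2_eq_square field_simps)
  qed
  have riem: "riemannian_manifold A ?g"
    by (rule riemannian_conformal_change[OF old.riem \<phi>])
  have "conformal_submersion_with A ?g B g' F dil'"
    unfolding conformal_submersion_with_def
  proof (intro conjI ballI allI)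
    fix c d p X Y
    assume cd: "c \<in> A" "d \<in> B" "p \<in> fst c \<inter> F -` fst d"
      and XY: "X \<in> horizontal ?g c d F p" "Y \<in> horizontal ?g c d F p"
    have "ip (g' d (F p)) (differential c d F p X) (differential c d F p Y) = (dil p)\<^sup>2 * ip (g c p) X Y"
      using old.submersion cd XY unfolding horizontal_conformal_change[where \<phi> = \<phi>, OF \<phi>(2)] conformal_submersion_with_def by blast
    then show "ip (g' d (F p)) (differential c d F p X) (differential c d F p Y) = (dil' p)\<^sup>2 * ip (?g c p) X Y"
      by (simp add: conformal_change_def ip_simps dil'(3)[symmetric] power_mult_distrib mult_ac)
  qed (use old.submersion dil' in \<open>auto simp: conformal_submersion_with_def\<close>)
  then interpret new: manifold_submersion A ?g B g' F dil'
    using riem old.riem' by unfold_locales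
  have old_chart: "old.clairaut c d (r \<circ> param c) (snd c p)" if "c \<in> A" "d \<in> B" "p \<in> fst c \<inter> F -` fst d" for c d p
    using old.clairaut_imp_clairaut_chart[OF cl that] by (simp add: r_def[abs_def])
  have vert: "frechet_derivative (\<phi> \<circ> param c) (at (snd c p)) v = 0"
    if cd: "c \<in> A" "d \<in> B" "p \<in> fst c \<inter> F -` fst d" and v: "frechet_derivative (local_rep c d F) (at (snd c p)) v = 0" for c d p v
  proof -
    interpret clairaut_chart "old.U c d" "snd d ` fst d" "g c \<circ> param c" "g' d \<circ> param d" "local_rep c d F" "inverse_square_dilation c dil"
      "r \<circ> param c" "snd c p"
      by (rule old_chart[OF cd])
    have p: "p \<in> fst c" "param c (snd c p) = p"
      using cd atlas_chart(3)[OF old.atlas(1) cd(1)] by auto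
    \<comment> \<open>\<open>mu_vert\<close> concerns \<lambda>^(-2). Read as a monomial, its
      derivative is a nonzero multiple of that of \<lambda>, so \<lambda> has no vertical derivative
      either.\<close>
    have "inverse_square_dilation c dil = mon (-2) 0 \<circ> param c"
    proof
      fix y
      show "inverse_square_dilation c dil y = (mon (-2) 0 \<circ> param c) y"
        using old.dil(2)[of "param c y"] r(2)[of "param c y"]
        by (simp add: inverse_square_dilation_def mon_def powr_minus_divide powr_numeral)
    qed
    then have "mon (-2) 0 p * (- 2 * (frechet_derivative (dil \<circ> param c) (at (snd c p)) v / dil p)) = 0"
      using mu_vert[OF v] fun_cong[OF frechet_derivative_at[OF mon_deriv[OF cd(1) p(1), of "-2" 0]], of v] by simp
    then have "frechet_derivative (dil \<circ> param c) (at (snd c p)) v / dil p = 0"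
      using mon_pos[of "-2" 0 p] by simp
    moreover have "frechet_derivative (r \<circ> param c) (at (snd c p)) v / r p = 0"
      using rho_vert[OF v] p(2) by (simp add: rho_def)
    ultimately show ?thesis
      unfolding \<phi>_def fun_cong[OF frechet_derivative_at[OF mon_deriv[OF cd(1) p(1), of a b]], of v, symmetric]
      by (simp only: mult_zero_right add_0_right)
  qed
  have new_chart: "new.clairaut c d (r' \<circ> param c) (snd c p)" if cd: "c \<in> A" "d \<in> B" "p \<in> fst c \<inter> F -` fst d" for c d p
  proof -
    interpret clairaut_chart "old.U c d" "snd d ` fst d" "g c \<circ> param c" "g' d \<circ> param d" "local_rep c d F" "inverse_square_dilation c dil"
      "r \<circ> param c" "snd c p"
      by (rule old_chart[OF cd])
    have "clairaut_chart (old.U c d) (snd d ` fst d) (\<lambda>x. ((\<phi> \<circ> param c) x)\<^sup>2 *\<^sub>R (g c \<circ> param c) x) (g' d \<circ> param d) (local_rep c d F)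
       (\<lambda>x. ((\<phi> \<circ> param c) x)\<^sup>2 * inverse_square_dilation c dil x) (\<lambda>x. (\<phi> \<circ> param c) x * (r \<circ> param c) x) (snd c p)"
    proof (rule conformal_change_clairaut_chart)
      show "(\<phi> \<circ> param c) x > 0" for x
        using \<phi>(2) by simp
      show "(\<phi> \<circ> param c) differentiable (at x)" if "x \<in> old.U c d" for x
        using smooth_function_chart(2)[OF \<phi>(1) cd(1)] that by blast
      show "frechet_derivative (\<phi> \<circ> param c) (at (snd c p)) v = 0"
        if "frechet_derivative (local_rep c d F) (at (snd c p)) v = 0" for v
        by (rule vert[OF cd that])
    qed
    moreover have "(\<lambda>x. ((\<phi> \<circ> param c) x)\<^sup>2 *\<^sub>R (g c \<circ> param c) x) = ?g c \<circ> param c"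
      by (simp add: conformal_change_def fun_eq_iff)
    moreover have "(\<lambda>x. ((\<phi> \<circ> param c) x)\<^sup>2 * inverse_square_dilation c dil x) = inverse_square_dilation c dil'"
    proof
      fix x
      show "((\<phi> \<circ> param c) x)\<^sup>2 * inverse_square_dilation c dil x = inverse_square_dilation c dil' x"
        using \<phi>(2)[of "param c x"] dil'(2)[of "param c x"]
        by (simp add: inverse_square_dilation_def dil'(3)[symmetric] power_mult_distrib)
    qed
    moreover have "(\<lambda>x. (\<phi> \<circ> param c) x * (r \<circ> param c) x) = r' \<circ> param c"
      by (simp add: r'(3) fun_eq_iff)
    ultimately show ?thesis
      by (simp only:)
  qed
  \<comment> \<open>The curve is a geodesic of the new metric, but the claim concerns only its
    velocity at one point. Angles do not change under conformal change, so the independence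
    established for the old metric along its own geodesics applies.\<close>
  have indep: "sin (new.angle c d (\<alpha> t) (velocity c \<alpha> t)) = sin (new.angle c' d' (\<alpha> t) (velocity c' \<alpha> t))"
    if geo: "regular_geodesic_on A ?g I \<alpha>" and t: "t \<in> I" and cd: "c \<in> A" "d \<in> B" and cd': "c' \<in> A" "d' \<in> B"
      and \<alpha>: "\<alpha> t \<in> fst c \<inter> F -` fst d" and \<alpha>': "\<alpha> t \<in> fst c' \<inter> F -` fst d'" for I \<alpha> t c d c' d'
  proof -
    interpret ch: chart_change A g c c'
      using old.riem cd cd' by unfold_locales
    have \<alpha>c: "\<alpha> t \<in> fst c" "\<alpha> t \<in> fst c \<inter> fst c'"
      using \<alpha> \<alpha>' by auto
    have cont: "isCont \<alpha> t"
      using geo t unfolding regular_geodesic_on_def geodesic_on_def by (metis continuous_on_eq_continuous_at)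
    note gc = new.geodesic_in_chart[OF geo t cd(1) \<alpha>c(1)]
    have "velocity c' \<alpha> t = ch.D (snd c (\<alpha> t)) (velocity c \<alpha> t)"
      unfolding velocity_def[of c'] by (rule vector_derivative_at[OF ch.velocity_change[OF \<alpha>c(2) cont gc(1)]])
    then show ?thesis
      using old.angle_chart_independent[OF cl cd \<alpha> cd' \<alpha>' gc(3)]
      by (simp add: angle_conformal_change \<phi>(2))
  qed
  have "clairaut_conformal_submersion A ?g B g' F r'"
    unfolding clairaut_conformal_submersion_def
  proof (intro conjI allI impI)
    fix I \<alpha> assume geo: "regular_geodesic_on A ?g I \<alpha>"
    show "\<exists>C. \<forall>t\<in>I. \<forall>c\<in>A. \<forall>d\<in>B. \<alpha> t \<in> fst c \<and> F (\<alpha> t) \<in> fst d \<longrightarrow>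
          r' (\<alpha> t) * sin (angle_with (?g c (\<alpha> t)) (horizontal ?g c d F (\<alpha> t)) (velocity c \<alpha> t)) = C"
      by (rule new.clairaut_relation[OF r'(1,2) new_chart indep[OF geo] geo])
  qed (use new.riem new.riem' new.submersion r' in auto)
  moreover have "r' = (\<lambda>p. \<phi> p * exp (f p))"
    by (simp add: r'(3) r_def fun_eq_iff)
  moreover have "constant_along_fibers F \<phi>"
    by (rule old.constant_along_fibers_chart[OF \<phi>(1) vert])
  moreover have "harmonic_map A ?g B g' F"
  proof (rule new.harmonic[OF new_chart])
    fix c d p v
    assume cd: "c \<in> A" "d \<in> B" "p \<in> fst c \<inter> F -` fst d"
    then have p: "p \<in> fst c" "param c (snd c p) = p"
      using atlas_chart(3)[OF old.atlas(1) cd(1)] by auto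
    define k l where "k = frechet_derivative (dil \<circ> param c) (at (snd c p)) v / dil p"
      and "l = frechet_derivative (r \<circ> param c) (at (snd c p)) v / r p"
    have log_deriv: "frechet_derivative (mon s t \<circ> param c) (at (snd c p)) v / mon s t p = s * k + t * l" for s t
      unfolding fun_cong[OF frechet_derivative_at[OF mon_deriv[OF cd(1) p(1), of s t]], of v, symmetric] k_def l_def
      using mon_pos[of s t p] by simp
    have "frechet_derivative (inverse_square_dilation c dil') (at (snd c p)) v / inverse_square_dilation c dil' (snd c p) = (2 * a - 2) * k + 2 * b * l"
      using log_deriv[of "2 * a - 2" "2 * b"] by (simp add: isd p(2))
    moreover have "frechet_derivative (r' \<circ> param c) (at (snd c p)) v / (r' \<circ> param c) (snd c p) = a * k + (b + 1) * l"
      using log_deriv[of a "b + 1"] by (simp add: r'_def p(2))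
    \<comment> \<open>An identity of polynomials in the exponents; both coefficients on the right
      vanish by \<open>ab\<close>.\<close>
    moreover have "(real CARD('n) - 2) / 2 * ((2 * a - 2) * k + 2 * b * l) + (real CARD('m) - real CARD('n)) * (a * k + (b + 1) * l)
       = ((real CARD('m) - 2) * a - (real CARD('n) - 2)) * k + ((real CARD('m) - 2) * b + (real CARD('m) - real CARD('n))) * l"
      by (simp add: field_simps)
    ultimately show "(real CARD('n) - 2) / 2 * (frechet_derivative (inverse_square_dilation c dil') (at (snd c p)) v / inverse_square_dilation c dil' (snd c p))
      + (real CARD('m) - real CARD('n)) * (frechet_derivative (r' \<circ> param c) (at (snd c p)) v / (r' \<circ> param c) (snd c p)) = 0"
      by (simp add: ab)
  qed
  ultimately show ?thesis
    using \<phi> by (intro exI[of _ \<phi>]) simp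
qed

end
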